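(* Let $V$ be a superspace of dimension $(n|m)$. The subalgebra of $\mathfrak{gl}(V)$-invariant elements of $\mathfrak A^{p,q}_{k,l}=S^\bullet(U\otimes V\oplus V^*\otimes W)$ is generated by the elements $$(v_r^*,v_s)=\sum_{i\in R_V}x_{ri}x^*_{is},\qquad r\in R_U,\ s\in R_W.$$
   Context: $U$, $W$ are superspaces with $\dim U=(k|l)$, $\dim W=(p|q)$ and homogeneous bases $u_r$ ($r\in R_U=\{1,\dots,k,\bar1,\dots,\bar l\}$), $w_s$ ($s\in R_W=\{1,\dots,p,\bar1,\dots,\bar q\}$); $V$ has homogeneous basis $e_i$, $i\in R_V=\{1,\dots,n,\bar1,\dots,\bar m\}$, with $p(e_i)=0$ for unbarred and $1$ for barred indices, and $\{e_i^*\}$ is the left dual basis of $V^*$. $x_{ri}=u_r\otimes e_i$, $x^*_{is}=e^*_i\otimes w_s$. $\mathfrak{gl}(V)$ acts naturally on $V$ and $V^*$ and trivially on $U,W$, hence by derivations on $\mathfrak A^{p,q}_{k,l}$. *)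

theory Defs
  imports Complex_Main "HOL-Library.Product_Lexorder"
begin

text \<open>Indices.  An index is a pair (b, t): b = False is the unbarred index t,
  b = True is the barred index t-bar.  The first component is thus the parity.\<close>
type_synonym idx = "bool \<times> nat"

definition Ridx :: "nat \<Rightarrow> nat \<Rightarrow> idx set" where
  "Ridx a b = {(False, t) | t. 1 \<le> t \<and> t \<le> a} \<union> {(True, t) | t. 1 \<le> t \<and> t \<le> b}"

text \<open>Variables (generators of the supersymmetric algebra):
  (False, (r, i)) is x_{ri} = u_r \<otimes> e_i,  (True, (i, s)) is x*_{is} = e*_i \<otimes> w_s.\<close>
type_synonym var = "bool \<times> idx \<times> idx"

definition vpar :: "var \<Rightarrow> bool" where
  "vpar v = (fst (fst (snd v)) \<noteq> fst (snd (snd v)))"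

definition valid_var :: "nat \<Rightarrow> nat \<Rightarrow> nat \<Rightarrow> nat \<Rightarrow> nat \<Rightarrow> nat \<Rightarrow> var \<Rightarrow> bool" where
  "valid_var k l p q n m v =
     (if fst v then fst (snd v) \<in> Ridx n m \<and> snd (snd v) \<in> Ridx p q
      else fst (snd v) \<in> Ridx k l \<and> snd (snd v) \<in> Ridx n m)"

text \<open>Monomials: exponent functions with finite support, odd variables with exponent \<le> 1.
  The monomial alpha stands for the ordered product of its variables in increasing order.\<close>
type_synonym mono = "var \<Rightarrow> nat"

definition is_mono :: "mono \<Rightarrow> bool" where
  "is_mono \<alpha> = (finite {v. \<alpha> v \<noteq> 0} \<and> (\<forall>v. vpar v \<longrightarrow> \<alpha> v \<le> 1))"

type_synonym spoly = "mono \<Rightarrow> complex"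

definition Alg :: "nat \<Rightarrow> nat \<Rightarrow> nat \<Rightarrow> nat \<Rightarrow> nat \<Rightarrow> nat \<Rightarrow> spoly set" where
  "Alg k l p q n m = {f. finite {\<alpha>. f \<alpha> \<noteq> 0} \<and>
      (\<forall>\<alpha>. f \<alpha> \<noteq> 0 \<longrightarrow> is_mono \<alpha> \<and> (\<forall>v. \<alpha> v \<noteq> 0 \<longrightarrow> valid_var k l p q n m v))}"

text \<open>Koszul sign of the product of two ordered monomials (0 if an odd variable repeats).\<close>
definition msign :: "mono \<Rightarrow> mono \<Rightarrow> complex" where
  "msign \<alpha> \<beta> = (if \<exists>v. vpar v \<and> \<alpha> v \<noteq> 0 \<and> \<beta> v \<noteq> 0 then 0
     else (-1) ^ card {(a, b). vpar a \<and> vpar b \<and> \<alpha> a \<noteq> 0 \<and> \<beta> b \<noteq> 0 \<and> b < a})"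

definition padd :: "spoly \<Rightarrow> spoly \<Rightarrow> spoly" where
  "padd f g = (\<lambda>\<gamma>. f \<gamma> + g \<gamma>)"

definition pscale :: "complex \<Rightarrow> spoly \<Rightarrow> spoly" where
  "pscale c f = (\<lambda>\<gamma>. c * f \<gamma>)"

definition smul :: "spoly \<Rightarrow> spoly \<Rightarrow> spoly" where
  "smul f g = (\<lambda>\<gamma>. \<Sum>(\<alpha>, \<beta>) \<in> {(\<alpha>, \<beta>). f \<alpha> \<noteq> 0 \<and> g \<beta> \<noteq> 0 \<and> (\<lambda>v. \<alpha> v + \<beta> v) = \<gamma>}.
                     msign \<alpha> \<beta> * f \<alpha> * g \<beta>)"

definition monop :: "mono \<Rightarrow> spoly" where
  "monop \<alpha> = (\<lambda>\<gamma>. if \<gamma> = \<alpha> then 1 else 0)"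

definition pone :: spoly where
  "pone = monop (\<lambda>_. 0)"

definition pvar :: "var \<Rightarrow> spoly" where
  "pvar v = monop (\<lambda>w. if w = v then 1 else 0)"

definition sg :: "bool \<Rightarrow> complex" where
  "sg b = (if b then -1 else 1)"

definition mdeg :: "mono \<Rightarrow> nat" where
  "mdeg \<alpha> = (\<Sum>v \<in> {v. \<alpha> v \<noteq> 0}. \<alpha> v)"

text \<open>Superderivation of parity d with values g on the generators, on basis monomials
  (peeling off the least variable: x_{v1}...x_{vt} = x_{v1} * (x_{v2}...x_{vt})).\<close>
fun Dm :: "bool \<Rightarrow> (var \<Rightarrow> spoly) \<Rightarrow> nat \<Rightarrow> mono \<Rightarrow> spoly" where
  "Dm d g 0 \<alpha> = (\<lambda>_. 0)"
| "Dm d g (Suc t) \<alpha> =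
     (if \<alpha> = (\<lambda>_. 0) then (\<lambda>_. 0)
      else (let v = (LEAST v. \<alpha> v \<noteq> 0); \<beta> = \<alpha>(v := \<alpha> v - 1)
            in padd (smul (g v) (monop \<beta>))
                    (pscale (sg (d \<and> vpar v)) (smul (pvar v) (Dm d g t \<beta>)))))"

definition Dpoly :: "bool \<Rightarrow> (var \<Rightarrow> spoly) \<Rightarrow> spoly \<Rightarrow> spoly" where
  "Dpoly d g f = (\<lambda>\<gamma>. \<Sum>\<alpha> \<in> {\<alpha>. f \<alpha> \<noteq> 0}. f \<alpha> * Dm d g (mdeg \<alpha>) \<alpha> \<gamma>)"

text \<open>Action of the elementary matrix E_{ij} \<in> gl(V) (E_{ij} e_k = \<delta>_{jk} e_i) on generators:
  E_{ij} x_{rk} = (-1)^{p(E_ij) p(u_r)} \<delta>_{jk} x_{ri},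
  E_{ij} x*_{ks} = -(-1)^{p(E_ij) p(e_i)} \<delta>_{ki} x*_{js}
  (natural action on V*: (X f)(v) = -(-1)^{p(X)p(f)} f(X v)).\<close>
definition Egen :: "idx \<Rightarrow> idx \<Rightarrow> var \<Rightarrow> spoly" where
  "Egen i j v = (let d = (fst i \<noteq> fst j) in
     (if \<not> fst v then
        (let r = fst (snd v); k = snd (snd v) in
           if k = j then pscale (sg (d \<and> fst r)) (pvar (False, r, i)) else (\<lambda>_. 0))
      else
        (let k = fst (snd v); s = snd (snd v) in
           if k = i then pscale (- sg (d \<and> fst i)) (pvar (True, j, s)) else (\<lambda>_. 0))))"

definition Eact :: "idx \<Rightarrow> idx \<Rightarrow> spoly \<Rightarrow> spoly" where
  "Eact i j f = Dpoly (fst i \<noteq> fst j) (Egen i j) f"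

text \<open>gl(V)-invariance: annihilated by every basis element E_{ij} (hence by all of gl(V)).\<close>
definition gl_invariant :: "nat \<Rightarrow> nat \<Rightarrow> spoly \<Rightarrow> bool" where
  "gl_invariant n m f = (\<forall>i \<in> Ridx n m. \<forall>j \<in> Ridx n m. Eact i j f = (\<lambda>_. 0))"

inductive_set gen_alg :: "spoly set \<Rightarrow> spoly set" for S where
  one: "pone \<in> gen_alg S"
| base: "s \<in> S \<Longrightarrow> s \<in> gen_alg S"
| add: "a \<in> gen_alg S \<Longrightarrow> b \<in> gen_alg S \<Longrightarrow> padd a b \<in> gen_alg S"
| scale: "a \<in> gen_alg S \<Longrightarrow> pscale c a \<in> gen_alg S"
| mult: "a \<in> gen_alg S \<Longrightarrow> b \<in> gen_alg S \<Longrightarrow> smul a b \<in> gen_alg S"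

definition pairing :: "nat \<Rightarrow> nat \<Rightarrow> idx \<Rightarrow> idx \<Rightarrow> spoly" where
  "pairing n m r s = (\<lambda>\<gamma>. \<Sum>i \<in> Ridx n m. smul (pvar (False, r, i)) (pvar (True, i, s)) \<gamma>)"

end

theory Submission
  imports Defs "HOL-Library.Function_Algebras" "HOL-Library.Product_Plus" "HOL-Library.FuncSet"
    "HOL-Combinatorics.Multiset_Permutations"
begin

text \<open>An invariant that is homogeneous in a row \<open>r\<close> is recovered, up to a nonzero factor, from its
  polarisation \<open>E\<^sub>r\<^sub>'\<^sub>r f\<close> in a fresh even row \<open>r'\<close> by applying \<open>E\<^sub>r\<^sub>r\<^sub>'\<close>; both operators belong to the action
  of \<open>gl(U)\<close>, so they preserve invariants and the algebra generated by the pairings.  Hence one may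
  assume that the invariant \<open>f\<close> is linear in each row of a set \<open>T\<close> of even rows, and it then lies in
  \<open>M \<otimes> N\<close> with \<open>M = V\<^sup>\<otimes>\<^sup>T\<close> and \<open>N\<close> the part of degree \<open>|T|\<close> of the symmetric algebra of \<open>V\<^sup>* \<otimes> W\<close>.

  Average a linear projection of \<open>M \<otimes> N\<close> onto the span of the products of pairings over the
  permutations of \<open>T\<close>.  Its matrix entries with respect to a basis of \<open>N\<close> are operators on \<open>M\<close> that
  commute with these permutations, so they are polynomials in the operators of \<open>gl(V)\<close> on \<open>M\<close>.  On an
  invariant, \<open>gl(V)\<close> acting on \<open>M\<close> can be traded for \<open>gl(V)\<close> acting on \<open>N\<close>; so on invariants the averaged
  projection is a fixed operator on \<open>N\<close>.  It fixes the products \<open>\<Prod>\<^sub>t (v\<^sub>t\<^sup>*, v\<^sub>s\<^sub>(\<^sub>t\<^sub>))\<close>, whose coefficients along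
  the basis of \<open>M\<close> span \<open>N\<close>, so this operator is the identity and every invariant lies in the image.\<close>

text \<open>For n, m > 0 finite-dimensional modules over gl(V) are in general not completely
  reducible, and there is no group average projecting onto the invariants. The group permuting the
  rows is finite, so averaging over it is always possible; this is the reason for the detour through
  its commutant. That commutant is reached by hand: every operator on \<open>M\<close> is a
  combination of products of matrix units, one per row; averaging turns such a product into a sum
  over all assignments of rows, and normal ordering expresses this sum through operators each of
  which is a sum over the rows of a single unit, that is, an operator of gl(V). Auxiliary rows are
  taken even, so that renaming them preserves the parity of every variable; an odd row is traded for
  even ones by an odd polarisation operator. Dividing by row degrees and by the number of
  permutations uses characteristic 0.\<close>

declare split_paired_All [simp del] split_paired_Ex [simp del]

section \<open>The supersymmetric algebra\<close>

definition odd_supp :: "mono \<Rightarrow> var set" where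
  "odd_supp \<alpha> = {v. vpar v \<and> \<alpha> v \<noteq> 0}"

definition inversions :: "var set \<Rightarrow> var set \<Rightarrow> (var \<times> var) set" where
  "inversions A B = {(a, b). a \<in> A \<and> b \<in> B \<and> b < a}"

lemma msign_alt:
  "msign \<alpha> \<beta> = (if odd_supp \<alpha> \<inter> odd_supp \<beta> \<noteq> {} then 0
     else (-1) ^ card (inversions (odd_supp \<alpha>) (odd_supp \<beta>)))"
proof -
  have "{(a, b). vpar a \<and> vpar b \<and> \<alpha> a \<noteq> 0 \<and> \<beta> b \<noteq> 0 \<and> b < a} = inversions (odd_supp \<alpha>) (odd_supp \<beta>)"
    by (auto simp: inversions_def odd_supp_def)
  moreover have "(\<exists>v. vpar v \<and> \<alpha> v \<noteq> 0 \<and> \<beta> v \<noteq> 0) \<longleftrightarrow> odd_supp \<alpha> \<inter> odd_supp \<beta> \<noteq> {}"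
    by (auto simp: odd_supp_def)
  ultimately show ?thesis by (simp add: msign_def)
qed

lemma odd_supp_plus: "odd_supp (\<alpha> + \<beta>) = odd_supp \<alpha> \<union> odd_supp \<beta>"
  by (auto simp: odd_supp_def)

lemma finite_odd_supp: "is_mono \<alpha> \<Longrightarrow> finite (odd_supp \<alpha>)"
  by (rule finite_subset[of _ "{v. \<alpha> v \<noteq> 0}"]) (auto simp: odd_supp_def is_mono_def)

lemma finite_inversions: "finite A \<Longrightarrow> finite B \<Longrightarrow> finite (inversions A B)"
  by (rule finite_subset[of _ "A \<times> B"]) (auto simp: inversions_def)

lemma card_inversions_Un_left:
  assumes "finite A" "finite B" "finite C" "A \<inter> B = {}"
  shows "card (inversions (A \<union> B) C) = card (inversions A C) + card (inversions B C)"
proof -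
  have "inversions (A \<union> B) C = inversions A C \<union> inversions B C"
    by (auto simp: inversions_def)
  moreover have "inversions A C \<inter> inversions B C = {}"
    using assms(4) by (auto simp: inversions_def)
  ultimately show ?thesis
    using assms by (simp add: card_Un_disjoint finite_inversions)
qed

lemma card_inversions_Un_right:
  assumes "finite A" "finite B" "finite C" "B \<inter> C = {}"
  shows "card (inversions A (B \<union> C)) = card (inversions A B) + card (inversions A C)"
proof -
  have "inversions A (B \<union> C) = inversions A B \<union> inversions A C"
    by (auto simp: inversions_def)
  moreover have "inversions A B \<inter> inversions A C = {}"
    using assms(4) by (auto simp: inversions_def)
  ultimately show ?thesis
    using assms by (simp add: card_Un_disjoint finite_inversions)
qed

text \<open>Inversions against a disjoint union add up, so both sides count the inversions of the
  three pairs of factors; if two odd supports meet, both sides are 0. This is the sign identity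
  behind associativity.\<close>

lemma msign_cocycle:
  assumes "is_mono \<alpha>" "is_mono \<beta>" "is_mono \<kappa>"
  shows "msign \<alpha> \<beta> * msign (\<alpha> + \<beta>) \<kappa> = msign \<beta> \<kappa> * msign \<alpha> (\<beta> + \<kappa>)"
  using assms[THEN finite_odd_supp]
  by (auto simp: msign_alt odd_supp_plus card_inversions_Un_left card_inversions_Un_right
      Int_Un_distrib Int_Un_distrib2 power_add)

lemma is_mono_plus:
  assumes "is_mono \<alpha>" "is_mono \<beta>" "msign \<alpha> \<beta> \<noteq> 0"
  shows "is_mono (\<alpha> + \<beta>)"
proof -
  have "{v. (\<alpha> + \<beta>) v \<noteq> 0} = {v. \<alpha> v \<noteq> 0} \<union> {v. \<beta> v \<noteq> 0}" by auto
  moreover have "\<alpha> v + \<beta> v \<le> 1" if "vpar v" for v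
  proof -
    have "\<alpha> v = 0 \<or> \<beta> v = 0"
      using assms(3) that by (auto simp: msign_def split: if_splits)
    thus ?thesis using assms(1,2) that by (auto simp: is_mono_def)
  qed
  ultimately show ?thesis using assms(1,2) by (auto simp: is_mono_def)
qed

lemma is_mono_0 [simp]: "is_mono 0"
  by (simp add: is_mono_def)

lemma msign_0_left [simp]: "msign 0 \<beta> = 1"
  by (simp add: msign_alt odd_supp_def inversions_def)

lemma msign_0_right [simp]: "msign \<alpha> 0 = 1"
  by (simp add: msign_alt odd_supp_def inversions_def)

section \<open>The ring of finite combinations of monomials\<close>

lemma smul_eq_sum:
  assumes "finite S" "finite T" "\<And>\<alpha>. f \<alpha> \<noteq> 0 \<Longrightarrow> \<alpha> \<in> S" "\<And>\<beta>. g \<beta> \<noteq> 0 \<Longrightarrow> \<beta> \<in> T"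
  shows "smul f g \<gamma> = (\<Sum>\<alpha>\<in>S. \<Sum>\<beta>\<in>T. if \<alpha> + \<beta> = \<gamma> then msign \<alpha> \<beta> * f \<alpha> * g \<beta> else 0)"
proof -
  have "smul f g \<gamma> = (\<Sum>x \<in> {(\<alpha>, \<beta>). f \<alpha> \<noteq> 0 \<and> g \<beta> \<noteq> 0 \<and> \<alpha> + \<beta> = \<gamma>}.
      msign (fst x) (snd x) * f (fst x) * g (snd x))"
    by (simp add: smul_def plus_fun_def case_prod_unfold)
  also have "\<dots> = (\<Sum>x \<in> S \<times> T. if fst x + snd x = \<gamma>
      then msign (fst x) (snd x) * f (fst x) * g (snd x) else 0)"
    by (rule sum.mono_neutral_cong_left) (use assms in auto)
  also have "\<dots> = (\<Sum>\<alpha>\<in>S. \<Sum>\<beta>\<in>T. if \<alpha> + \<beta> = \<gamma> then msign \<alpha> \<beta> * f \<alpha> * g \<beta> else 0)"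
    by (simp add: sum.cartesian_product case_prod_unfold)
  finally show ?thesis .
qed

text \<open>All variables are admitted, not only the valid ones: polarisation needs auxiliary rows.\<close>

typedef salg = "{f :: spoly. finite {\<alpha>. f \<alpha> \<noteq> 0} \<and> (\<forall>\<alpha>. f \<alpha> \<noteq> 0 \<longrightarrow> is_mono \<alpha>)}"
  morphisms cf Salg
  by (rule exI[of _ "\<lambda>_. 0"]) simp

definition supp :: "salg \<Rightarrow> mono set" where
  "supp x = {\<alpha>. cf x \<alpha> \<noteq> 0}"

lemma supp_iff: "\<alpha> \<in> supp x \<longleftrightarrow> cf x \<alpha> \<noteq> 0"
  by (simp add: supp_def)

lemma finite_supp [simp]: "finite (supp x)"
  using cf[of x] by (simp add: supp_def)

lemma supp_is_mono: "\<alpha> \<in> supp x \<Longrightarrow> is_mono \<alpha>"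
  using cf[of x] by (simp add: supp_def)

lemma cf_not_mono: "\<not> is_mono \<alpha> \<Longrightarrow> cf x \<alpha> = 0"
  using cf[of x] by auto

lemma salg_eqI: "(\<And>\<alpha>. is_mono \<alpha> \<Longrightarrow> cf x \<alpha> = cf y \<alpha>) \<Longrightarrow> x = y"
  by (metis cf_inject cf_not_mono ext)

lemma cf_Salg:
  assumes "finite {\<alpha>. f \<alpha> \<noteq> 0}" "\<And>\<alpha>. f \<alpha> \<noteq> 0 \<Longrightarrow> is_mono \<alpha>"
  shows "cf (Salg f) = f"
  using assms by (simp add: Salg_inverse)

instantiation salg :: ring_1
begin

definition "0 = Salg (\<lambda>_. 0)"
definition "1 = Salg pone"
definition "x + y = Salg (padd (cf x) (cf y))"
definition "- x = Salg (\<lambda>\<alpha>. - cf x \<alpha>)"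
definition "x - y = Salg (\<lambda>\<alpha>. cf x \<alpha> - cf y \<alpha>)"
definition "x * y = Salg (smul (cf x) (cf y))"

lemma cf_0: "cf 0 = (\<lambda>_. 0)"
  unfolding zero_salg_def by (rule cf_Salg) auto

lemma cf_1: "cf 1 = pone"
  unfolding one_salg_def
  by (rule cf_Salg) (auto simp: pone_def monop_def is_mono_def split: if_splits)

lemma cf_plus: "cf (x + y) = padd (cf x) (cf y)"
  unfolding plus_salg_def
proof (rule cf_Salg)
  show "finite {\<alpha>. padd (cf x) (cf y) \<alpha> \<noteq> 0}"
    by (rule finite_subset[of _ "supp x \<union> supp y"]) (auto simp: padd_def supp_iff)
  show "padd (cf x) (cf y) \<alpha> \<noteq> 0 \<Longrightarrow> is_mono \<alpha>" for \<alpha>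
    by (cases "is_mono \<alpha>") (simp_all add: padd_def cf_not_mono)
qed

lemma cf_uminus: "cf (- x) = (\<lambda>\<alpha>. - cf x \<alpha>)"
  unfolding uminus_salg_def
  using cf[of x] by (intro cf_Salg) auto

lemma cf_minus: "cf (x - y) = (\<lambda>\<alpha>. cf x \<alpha> - cf y \<alpha>)"
  unfolding minus_salg_def
proof (rule cf_Salg)
  show "finite {\<alpha>. cf x \<alpha> - cf y \<alpha> \<noteq> 0}"
    by (rule finite_subset[of _ "supp x \<union> supp y"]) (auto simp: supp_iff)
  show "cf x \<alpha> - cf y \<alpha> \<noteq> 0 \<Longrightarrow> is_mono \<alpha>" for \<alpha>
    by (cases "is_mono \<alpha>") (simp_all add: cf_not_mono)
qed

lemma smul_nonzeroE:
  assumes "smul f g \<gamma> \<noteq> 0"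
  obtains \<alpha> \<beta> where "f \<alpha> \<noteq> 0" "g \<beta> \<noteq> 0" "msign \<alpha> \<beta> \<noteq> 0" "\<gamma> = \<alpha> + \<beta>"
proof -
  obtain x where "x \<in> {(\<alpha>, \<beta>). f \<alpha> \<noteq> 0 \<and> g \<beta> \<noteq> 0 \<and> (\<lambda>v. \<alpha> v + \<beta> v) = \<gamma>}"
      "(case x of (\<alpha>, \<beta>) \<Rightarrow> msign \<alpha> \<beta> * f \<alpha> * g \<beta>) \<noteq> 0"
    using assms unfolding smul_def by (rule sum.not_neutral_contains_not_neutral)
  thus ?thesis using that by (fastforce simp: plus_fun_def)
qed

lemma cf_times: "cf (x * y) = smul (cf x) (cf y)"
  unfolding times_salg_def
proof (rule cf_Salg)
  show "finite {\<alpha>. smul (cf x) (cf y) \<alpha> \<noteq> 0}"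
    by (rule finite_subset[of _ "(\<lambda>(\<alpha>, \<beta>). \<alpha> + \<beta>) ` (supp x \<times> supp y)"])
      (force elim!: smul_nonzeroE simp: supp_iff, simp)
  show "smul (cf x) (cf y) \<alpha> \<noteq> 0 \<Longrightarrow> is_mono \<alpha>" for \<alpha>
    by (metis cf_not_mono is_mono_plus smul_nonzeroE)
qed

lemma cf_times_sum:
  assumes "finite S" "finite T" "supp x \<subseteq> S" "supp y \<subseteq> T"
  shows "cf (x * y) \<gamma> = (\<Sum>\<alpha>\<in>S. \<Sum>\<beta>\<in>T. if \<alpha> + \<beta> = \<gamma> then msign \<alpha> \<beta> * cf x \<alpha> * cf y \<beta> else 0)"
  unfolding cf_times by (rule smul_eq_sum) (use assms in \<open>auto simp: supp_iff\<close>)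

lemma supp_times: "supp (x * y) \<subseteq> (\<lambda>(\<alpha>, \<beta>). \<alpha> + \<beta>) ` (supp x \<times> supp y)"
  by (force simp: supp_iff cf_times elim!: smul_nonzeroE)

text \<open>Coefficients of the inner products are themselves sums, so each side first runs over an
  extra monomial \<delta> from the finite image of a product set. That monomial is determined by its
  two parts and is summed away; the resulting triple sums agree by
  \<open>msign_cocycle\<close>.\<close>

lemma times_assoc_salg: "(x * y) * z = x * (y * (z :: salg))"
proof (rule salg_eqI)
  fix \<gamma>
  let ?S = "supp x" and ?T = "supp y" and ?U = "supp z"
  let ?ST = "(\<lambda>(\<alpha>, \<beta>). \<alpha> + \<beta>) ` (?S \<times> ?T)" and ?TU = "(\<lambda>(\<alpha>, \<beta>). \<alpha> + \<beta>) ` (?T \<times> ?U)"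
  let ?c = "\<lambda>\<alpha> \<beta> \<kappa>. cf x \<alpha> * cf y \<beta> * cf z \<kappa>"
  have "cf ((x * y) * z) \<gamma> = (\<Sum>\<delta>\<in>?ST. \<Sum>\<kappa>\<in>?U. if \<delta> + \<kappa> = \<gamma> then msign \<delta> \<kappa> * cf (x * y) \<delta> * cf z \<kappa> else 0)"
    by (rule cf_times_sum) (simp_all add: supp_times)
  also have "\<dots> = (\<Sum>\<delta>\<in>?ST. \<Sum>\<kappa>\<in>?U. \<Sum>\<alpha>\<in>?S. \<Sum>\<beta>\<in>?T. if \<delta> = \<alpha> + \<beta> then (if \<alpha> + \<beta> + \<kappa> = \<gamma>
      then msign \<alpha> \<beta> * msign (\<alpha> + \<beta>) \<kappa> * ?c \<alpha> \<beta> \<kappa> else 0) else 0)"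
    by (intro sum.cong refl, subst cf_times_sum[of ?S ?T])
      (auto simp: sum_distrib_left sum_distrib_right intro!: sum.cong sum.neutral)
  also have "\<dots> = (\<Sum>\<delta>\<in>?ST. \<Sum>\<alpha>\<in>?S. \<Sum>\<beta>\<in>?T. \<Sum>\<kappa>\<in>?U. if \<delta> = \<alpha> + \<beta> then (if \<alpha> + \<beta> + \<kappa> = \<gamma>
      then msign \<alpha> \<beta> * msign (\<alpha> + \<beta>) \<kappa> * ?c \<alpha> \<beta> \<kappa> else 0) else 0)"
    by (rule sum.cong[OF refl], rule trans[OF sum.swap], rule sum.cong[OF refl], rule sum.swap)
  also have "\<dots> = (\<Sum>\<alpha>\<in>?S. \<Sum>\<beta>\<in>?T. \<Sum>\<kappa>\<in>?U. \<Sum>\<delta>\<in>?ST. if \<delta> = \<alpha> + \<beta> then (if \<alpha> + \<beta> + \<kappa> = \<gamma>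
      then msign \<alpha> \<beta> * msign (\<alpha> + \<beta>) \<kappa> * ?c \<alpha> \<beta> \<kappa> else 0) else 0)"
    by (rule trans[OF sum.swap], rule sum.cong[OF refl], rule trans[OF sum.swap], rule sum.cong[OF refl],
        rule sum.swap)
  also have "\<dots> = (\<Sum>\<alpha>\<in>?S. \<Sum>\<beta>\<in>?T. \<Sum>\<kappa>\<in>?U. if \<alpha> + \<beta> + \<kappa> = \<gamma>
      then msign \<alpha> \<beta> * msign (\<alpha> + \<beta>) \<kappa> * ?c \<alpha> \<beta> \<kappa> else 0)"
    by (intro sum.cong refl, subst sum.delta) auto
  also have "\<dots> = (\<Sum>\<alpha>\<in>?S. \<Sum>\<beta>\<in>?T. \<Sum>\<kappa>\<in>?U. if \<alpha> + (\<beta> + \<kappa>) = \<gamma>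
      then msign \<beta> \<kappa> * msign \<alpha> (\<beta> + \<kappa>) * ?c \<alpha> \<beta> \<kappa> else 0)"
    by (intro sum.cong refl) (auto simp: msign_cocycle supp_is_mono add.assoc)
  also have "\<dots> = (\<Sum>\<alpha>\<in>?S. \<Sum>\<beta>\<in>?T. \<Sum>\<kappa>\<in>?U. \<Sum>\<delta>\<in>?TU. if \<delta> = \<beta> + \<kappa> then (if \<alpha> + (\<beta> + \<kappa>) = \<gamma>
      then msign \<beta> \<kappa> * msign \<alpha> (\<beta> + \<kappa>) * ?c \<alpha> \<beta> \<kappa> else 0) else 0)"
    by (intro sum.cong refl, subst sum.delta) auto
  also have "\<dots> = (\<Sum>\<alpha>\<in>?S. \<Sum>\<delta>\<in>?TU. \<Sum>\<beta>\<in>?T. \<Sum>\<kappa>\<in>?U. if \<delta> = \<beta> + \<kappa> then (if \<alpha> + (\<beta> + \<kappa>) = \<gamma>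
      then msign \<beta> \<kappa> * msign \<alpha> (\<beta> + \<kappa>) * ?c \<alpha> \<beta> \<kappa> else 0) else 0)"
    by (rule sum.cong[OF refl], rule sym, rule trans[OF sum.swap], rule sum.cong[OF refl], rule sum.swap)
  also have "\<dots> = (\<Sum>\<alpha>\<in>?S. \<Sum>\<delta>\<in>?TU. if \<alpha> + \<delta> = \<gamma> then msign \<alpha> \<delta> * cf x \<alpha> * cf (y * z) \<delta> else 0)"
    by (intro sum.cong refl, subst cf_times_sum[of ?T ?U])
      (auto simp: sum_distrib_left sum_distrib_right intro!: sum.cong sum.neutral)
  also have "\<dots> = cf (x * (y * z)) \<gamma>"
    by (rule cf_times_sum[symmetric]) (simp_all add: supp_times)
  finally show "cf ((x * y) * z) \<gamma> = cf (x * (y * z)) \<gamma>" .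
qed

instance
proof
  fix a b c :: salg
  show "a + b + c = a + (b + c)" by (rule salg_eqI) (simp add: cf_plus padd_def)
  show "a + b = b + a" by (rule salg_eqI) (simp add: cf_plus padd_def)
  show "0 + a = a" by (rule salg_eqI) (simp add: cf_plus padd_def cf_0)
  show "- a + a = 0" by (rule salg_eqI) (simp add: cf_plus padd_def cf_0 cf_uminus)
  show "a - b = a + - b" by (rule salg_eqI) (simp add: cf_plus padd_def cf_minus cf_uminus)
  show "a * b * c = a * (b * c)" by (rule times_assoc_salg)
  have s1: "supp 1 \<subseteq> {0}"
    by (auto simp: supp_iff cf_1 pone_def monop_def zero_fun_def split: if_splits)
  have c1: "cf 1 0 = 1"
    by (simp add: cf_1 pone_def monop_def zero_fun_def)
  show "1 * a = a"
    by (rule salg_eqI, subst cf_times_sum[of "{0}" "supp a"])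
      (use s1 c1 in \<open>auto simp: supp_iff\<close>)
  show "a * 1 = a"
    by (rule salg_eqI, subst cf_times_sum[of "supp a" "{0}"])
      (use s1 c1 in \<open>auto simp: supp_iff\<close>)
  show "(a + b) * c = a * c + b * c"
  proof (rule salg_eqI)
    fix \<gamma>
    have s: "supp (a + b) \<subseteq> supp a \<union> supp b" by (auto simp: supp_iff cf_plus padd_def)
    show "cf ((a + b) * c) \<gamma> = cf (a * c + b * c) \<gamma>"
      by (simp add: cf_plus[of "a * c"] padd_def, subst (1 2 3) cf_times_sum[of "supp a \<union> supp b" "supp c"])
       (use s in \<open>auto simp: cf_plus padd_def sum.distrib[symmetric] algebra_simps intro!: sum.cong\<close>)
  qed
  show "a * (b + c) = a * b + a * c"
  proof (rule salg_eqI)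
    fix \<gamma>
    have s: "supp (b + c) \<subseteq> supp b \<union> supp c" by (auto simp: supp_iff cf_plus padd_def)
    show "cf (a * (b + c)) \<gamma> = cf (a * b + a * c) \<gamma>"
      by (simp add: cf_plus[of "a * b"] padd_def, subst (1 2 3) cf_times_sum[of "supp a" "supp b \<union> supp c"])
       (use s in \<open>auto simp: cf_plus padd_def sum.distrib[symmetric] algebra_simps intro!: sum.cong\<close>)
  qed
  show "(0::salg) \<noteq> 1" using c1 by (metis cf_0 zero_neq_one)
qed

end

section \<open>Scalars and the basis of monomials\<close>

definition scl :: "complex \<Rightarrow> salg \<Rightarrow> salg" where
  "scl c x = Salg (pscale c (cf x))"

lemma cf_scl: "cf (scl c x) = pscale c (cf x)"
  unfolding scl_def
proof (rule cf_Salg)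
  show "finite {\<alpha>. pscale c (cf x) \<alpha> \<noteq> 0}"
    by (rule finite_subset[of _ "supp x"]) (auto simp: pscale_def supp_iff)
  show "pscale c (cf x) \<alpha> \<noteq> 0 \<Longrightarrow> is_mono \<alpha>" for \<alpha>
    by (cases "is_mono \<alpha>") (simp_all add: pscale_def cf_not_mono)
qed

lemmas cf_simps [simp] = cf_0[unfolded fun_eq_iff] cf_minus[THEN fun_cong] cf_uminus[THEN fun_cong]
  cf_plus[THEN fun_cong, unfolded padd_def] cf_scl[THEN fun_cong, unfolded pscale_def]

lemma cf_sum [simp]: "cf (sum f A) \<alpha> = (\<Sum>a\<in>A. cf (f a) \<alpha>)"
  by (induction A rule: infinite_finite_induct) auto

global_interpretation sv: vector_space scl
  by unfold_locales (auto intro!: salg_eqI simp: algebra_simps)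

global_interpretation svp: vector_space_pair scl scl
  by unfold_locales

abbreviation lin :: "(salg \<Rightarrow> salg) \<Rightarrow> bool" where
  "lin \<equiv> Vector_Spaces.linear scl scl"

lemma linI: "(\<And>x y. D (x + y) = D x + D y) \<Longrightarrow> (\<And>c x. D (scl c x) = scl c (D x)) \<Longrightarrow> lin D"
  by (simp add: Vector_Spaces.linear_iff sv.vector_space_axioms)

lemma scl_mult_left: "scl c x * y = scl c (x * y)"
proof (rule salg_eqI)
  fix \<gamma>
  have "supp (scl c x) \<subseteq> supp x" by (auto simp: supp_iff)
  thus "cf (scl c x * y) \<gamma> = cf (scl c (x * y)) \<gamma>"
    by (simp, subst (1 2) cf_times_sum[of "supp x" "supp y"])
      (auto simp: sum_distrib_left intro!: sum.cong)
qed

lemma scl_mult_right: "x * scl c y = scl c (x * y)"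
proof (rule salg_eqI)
  fix \<gamma>
  have "supp (scl c y) \<subseteq> supp y" by (auto simp: supp_iff)
  thus "cf (x * scl c y) \<gamma> = cf (scl c (x * y)) \<gamma>"
    by (simp, subst (1 2) cf_times_sum[of "supp x" "supp y"])
      (auto simp: sum_distrib_left intro!: sum.cong)
qed

text \<open>The value 0 outside the monomials lets products with a repeated odd variable be written
  like all others.\<close>

definition mon :: "mono \<Rightarrow> salg" where
  "mon \<alpha> = Salg (if is_mono \<alpha> then monop \<alpha> else (\<lambda>_. 0))"

lemma cf_mon_eq: "is_mono \<alpha> \<Longrightarrow> cf (mon \<alpha>) = monop \<alpha>"
  unfolding mon_def by (simp, rule cf_Salg) (auto simp: monop_def split: if_splits)

lemma cf_mon: "cf (mon \<alpha>) \<beta> = (if is_mono \<alpha> \<and> \<alpha> = \<beta> then 1 else 0)"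
proof (cases "is_mono \<alpha>")
  case True
  thus ?thesis by (simp only: cf_mon_eq) (simp add: monop_def)
next
  case False
  thus ?thesis by (simp add: mon_def zero_salg_def[symmetric])
qed

lemma mon_not_mono: "\<not> is_mono \<alpha> \<Longrightarrow> mon \<alpha> = 0"
  by (simp add: mon_def zero_salg_def)

lemma supp_mon: "supp (mon \<alpha>) = (if is_mono \<alpha> then {\<alpha>} else {})"
  by (auto simp: supp_iff cf_mon split: if_splits)

lemma mon_0 [simp]: "mon 0 = 1"
  by (rule salg_eqI) (auto simp: cf_mon cf_1 pone_def monop_def zero_fun_def)

lemma mon_times_mon:
  assumes "is_mono \<alpha>" "is_mono \<beta>"
  shows "mon \<alpha> * mon \<beta> = scl (msign \<alpha> \<beta>) (mon (\<alpha> + \<beta>))"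
proof (rule salg_eqI)
  fix \<gamma>
  show "cf (mon \<alpha> * mon \<beta>) \<gamma> = cf (scl (msign \<alpha> \<beta>) (mon (\<alpha> + \<beta>))) \<gamma>"
    by (subst cf_times_sum[of "{\<alpha>}" "{\<beta>}"]) (use assms is_mono_plus[of \<alpha> \<beta>] in \<open>auto simp: supp_mon cf_mon\<close>)
qed

lemma salg_expand:
  assumes "finite S" "supp x \<subseteq> S"
  shows "x = (\<Sum>\<alpha>\<in>S. scl (cf x \<alpha>) (mon \<alpha>))"
proof (rule salg_eqI)
  fix \<gamma> assume "is_mono \<gamma>"
  have "(\<Sum>\<alpha>\<in>S. cf (scl (cf x \<alpha>) (mon \<alpha>)) \<gamma>) = (\<Sum>\<alpha>\<in>S. if \<alpha> = \<gamma> then cf x \<gamma> else 0)"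
    using \<open>is_mono \<gamma>\<close> by (intro sum.cong) (auto simp: cf_mon)
  also have "\<dots> = cf x \<gamma>"
    using assms by (auto simp: supp_iff)
  finally show "cf x \<gamma> = cf (\<Sum>\<alpha>\<in>S. scl (cf x \<alpha>) (mon \<alpha>)) \<gamma>" by simp
qed

section \<open>Variables and the universal property\<close>

lemma sg_simps [simp]: "sg False = 1" "sg True = -1" "sg b * sg b = 1" "sg b * (sg b * z) = z" "sg b \<noteq> 0"
  by (auto simp: sg_def)

definition sng :: "var \<Rightarrow> mono" where
  "sng v = (\<lambda>w. if w = v then 1 else 0)"

lemma sng_apply: "sng v w = (if w = v then 1 else 0)"
  by (simp add: sng_def)

lemma is_mono_sng [simp]: "is_mono (sng v)"
  by (auto simp: is_mono_def sng_def)

definition var :: "var \<Rightarrow> salg" where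
  "var v = mon (sng v)"

lemma cf_var: "cf (var v) = pvar v"
  unfolding var_def by (simp add: cf_mon_eq) (simp add: pvar_def sng_def)

lemma odd_supp_sng: "odd_supp (sng v) = (if vpar v then {v} else {})"
  by (auto simp: odd_supp_def sng_def)

text \<open>A variable placed before variables that are not smaller creates no inversion. Hence a
  sorted monomial is, without sign, the product of its variables in increasing order.\<close>

lemma msign_sng_least:
  assumes "\<And>w. \<beta> w \<noteq> 0 \<Longrightarrow> v \<le> w" "vpar v \<Longrightarrow> \<beta> v = 0"
  shows "msign (sng v) \<beta> = 1"
proof -
  have "x \<notin> inversions (odd_supp (sng v)) (odd_supp \<beta>)" for x
    using assms(1)[of "snd x"]
    by (cases x) (auto simp: inversions_def odd_supp_def sng_def not_less)
  hence "inversions (odd_supp (sng v)) (odd_supp \<beta>) = {}" by blast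
  moreover have "odd_supp (sng v) \<inter> odd_supp \<beta> = {}"
    using assms(2) by (auto simp: odd_supp_def sng_def)
  ultimately show ?thesis by (simp add: msign_alt)
qed

lemma var_commute: "var u * var v = scl (sg (vpar u \<and> vpar v)) (var v * var u)"
proof -
  have i: "inversions {a} {b} = (if b < a then {(a, b)} else {})" for a b
    by (auto simp: inversions_def)
  have "msign (sng u) (sng v) = sg (vpar u \<and> vpar v) * msign (sng v) (sng u)"
    by (cases "vpar u"; cases "vpar v"; cases "u = v")
      (auto simp: msign_alt odd_supp_sng i, auto simp: inversions_def)
  thus ?thesis by (simp add: var_def mon_times_mon add.commute)
qed

lemma var_left_commute: "var u * (var v * x) = scl (sg (vpar u \<and> vpar v)) (var v * (var u * x))"
  by (subst mult.assoc[symmetric], subst var_commute) (simp add: scl_mult_left mult.assoc)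

lemma var_square: "vpar v \<Longrightarrow> var v * var v = 0"
  by (simp add: var_def mon_times_mon msign_alt odd_supp_sng)

lemma var_times_mon: "is_mono \<alpha> \<Longrightarrow> var v * mon \<alpha> = scl (msign (sng v) \<alpha>) (mon (sng v + \<alpha>))"
  by (simp add: var_def mon_times_mon)

section \<open>Weights and degrees of monomials\<close>

definition wt :: "(var \<Rightarrow> 'a::comm_semiring_1) \<Rightarrow> mono \<Rightarrow> 'a" where
  "wt w \<alpha> = (\<Sum>v | \<alpha> v \<noteq> 0. of_nat (\<alpha> v) * w v)"

lemma wt_eq_sum:
  assumes "finite S" "\<And>v. \<alpha> v \<noteq> 0 \<Longrightarrow> v \<in> S"
  shows "wt w \<alpha> = (\<Sum>v\<in>S. of_nat (\<alpha> v) * w v)"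
  unfolding wt_def by (rule sum.mono_neutral_left) (use assms in auto)

lemma wt_plus:
  assumes "is_mono \<alpha>" "is_mono \<beta>"
  shows "wt w (\<alpha> + \<beta>) = wt w \<alpha> + wt w \<beta>"
  using assms
  by (subst (1 2 3) wt_eq_sum[of "{v. \<alpha> v \<noteq> 0} \<union> {v. \<beta> v \<noteq> 0}"])
    (auto simp: is_mono_def sum.distrib[symmetric] algebra_simps intro!: sum.cong)

lemma wt_sng [simp]: "wt w (sng v) = w v"
  by (subst wt_eq_sum[of "{v}"]) (auto simp: sng_def split: if_splits)

lemma wt_0 [simp]: "wt w 0 = 0"
  by (simp add: wt_def)

lemma mdeg_eq_wt: "mdeg \<alpha> = wt (\<lambda>_. 1) \<alpha>"
  by (simp add: mdeg_def wt_def)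

lemma mdeg_sng_plus: "is_mono \<beta> \<Longrightarrow> mdeg (sng v + \<beta>) = Suc (mdeg \<beta>)"
  by (simp add: mdeg_eq_wt wt_plus)

text \<open>The last two conclusions give the peeled variable and the remainder in the literal form
  in which \<open>Dm\<close> and \<open>eval_mono\<close> recurse.\<close>

lemma mono_peel_least:
  assumes "is_mono \<alpha>" "\<alpha> \<noteq> 0"
  obtains v \<beta> where "\<alpha> = sng v + \<beta>" "is_mono \<beta>" "\<And>w. \<beta> w \<noteq> 0 \<Longrightarrow> v \<le> w" "vpar v \<Longrightarrow> \<beta> v = 0"
    "v = (LEAST v. \<alpha> v \<noteq> 0)" "\<beta> = \<alpha>(v := \<alpha> v - 1)"
proof -
  define v where "v = (LEAST v. \<alpha> v \<noteq> 0)"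
  define \<beta> where "\<beta> = \<alpha>(v := \<alpha> v - 1)"
  have fin: "finite {v. \<alpha> v \<noteq> 0}" using assms by (simp add: is_mono_def)
  have ne: "\<exists>v. \<alpha> v \<noteq> 0" using assms(2) by (auto simp: fun_eq_iff)
  have vM: "v = Min {v. \<alpha> v \<noteq> 0}" unfolding v_def by (rule Least_Min[OF fin ne])
  have v: "\<alpha> v \<noteq> 0" using Min_in[OF fin] ne vM by auto
  have le: "v \<le> w" if "\<alpha> w \<noteq> 0" for w using vM fin that by simp
  show ?thesis
  proof (rule that[OF _ _ _ _ v_def \<beta>_def])
    show "\<alpha> = sng v + \<beta>" using v by (auto simp: fun_eq_iff \<beta>_def sng_def)
    have "{w. \<beta> w \<noteq> 0} \<subseteq> {w. \<alpha> w \<noteq> 0}" by (auto simp: \<beta>_def split: if_splits)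
    hence "finite {w. \<beta> w \<noteq> 0}" using fin finite_subset by blast
    moreover have "\<beta> w \<le> \<alpha> w" for w by (simp add: \<beta>_def)
    ultimately show "is_mono \<beta>"
      using assms(1) unfolding is_mono_def by (meson order_trans)
    show "v \<le> w" if "\<beta> w \<noteq> 0" for w using that le v by (auto simp: \<beta>_def split: if_splits)
    show "\<beta> v = 0" if "vpar v" using that assms(1) unfolding is_mono_def \<beta>_def by (simp add: le_Suc_eq)
  qed
qed

lemma var_times_mon_least:
  assumes "is_mono \<beta>" "\<And>w. \<beta> w \<noteq> 0 \<Longrightarrow> v \<le> w" "vpar v \<Longrightarrow> \<beta> v = 0"
  shows "var v * mon \<beta> = mon (sng v + \<beta>)"
  using assms by (simp add: var_times_mon msign_sng_least)

lemma is_mono_sng_plus: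
  assumes "is_mono \<beta>" "vpar v \<Longrightarrow> \<beta> v = 0"
  shows "is_mono (sng v + \<beta>)"
proof (rule is_mono_plus[OF is_mono_sng assms(1)])
  have "odd_supp (sng v) \<inter> odd_supp \<beta> = {}"
    using assms(2) by (auto simp: odd_supp_def sng_def)
  thus "msign (sng v) \<beta> \<noteq> 0" by (simp add: msign_alt)
qed

lemma sng_plus_least:
  assumes "\<And>w. \<beta> w \<noteq> 0 \<Longrightarrow> v \<le> w"
  shows "(LEAST w. (sng v + \<beta>) w \<noteq> 0) = v"
  by (rule Least_equality) (use assms in \<open>auto simp: sng_def split: if_splits\<close>)

text \<open>Sorted monomials arise from 1 by repeated multiplication with their least variable, and
  they span; so linear identities can be checked one variable at a time.\<close>

lemma salg_induct [case_names one var add scl]: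
  assumes one: "P 1" and var: "\<And>v x. P x \<Longrightarrow> P (var v * x)"
    and add: "\<And>x y. P x \<Longrightarrow> P y \<Longrightarrow> P (x + y)" and scl: "\<And>c x. P x \<Longrightarrow> P (scl c x)"
  shows "P x"
proof -
  have m: "P (mon \<alpha>)" if "is_mono \<alpha>" for \<alpha>
    using that
  proof (induction "mdeg \<alpha>" arbitrary: \<alpha> rule: less_induct)
    case less
    show ?case
    proof (cases "\<alpha> = 0")
      case True
      thus ?thesis by (simp add: one)
    next
      case False
      then obtain v \<beta> where b: "\<alpha> = sng v + \<beta>" "is_mono \<beta>" "\<And>w. \<beta> w \<noteq> 0 \<Longrightarrow> v \<le> w" "vpar v \<Longrightarrow> \<beta> v = 0"
        using mono_peel_least[OF less.prems] by metis
      have "P (mon \<beta>)" using less.hyps[of \<beta>] b(1,2) by (simp add: mdeg_sng_plus)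
      moreover have "mon \<alpha> = var v * mon \<beta>" using b var_times_mon_least by metis
      ultimately show ?thesis by (simp add: var)
    qed
  qed
  have P0: "P 0" using scl[OF one, of 0] by simp
  have "P (\<Sum>\<alpha>\<in>A. scl (cf x \<alpha>) (mon \<alpha>))" if "finite A" "A \<subseteq> supp x" for A
    using that by (induction A rule: finite_induct) (auto simp: P0 intro!: add scl m supp_is_mono)
  from this[of "supp x"] show ?thesis using salg_expand[of "supp x" x] by simp
qed

section \<open>The universal property for supercommuting operators\<close>

fun eval_mono :: "(var \<Rightarrow> 'w \<Rightarrow> 'w) \<Rightarrow> 'w \<Rightarrow> nat \<Rightarrow> mono \<Rightarrow> 'w" where
  "eval_mono L w 0 \<alpha> = w"
| "eval_mono L w (Suc t) \<alpha> = (if \<alpha> = 0 then w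
     else let v = (LEAST v. \<alpha> v \<noteq> 0) in L v (eval_mono L w t (\<alpha>(v := \<alpha> v - 1))))"

definition eval :: "(complex \<Rightarrow> 'w \<Rightarrow> 'w) \<Rightarrow> (var \<Rightarrow> 'w \<Rightarrow> 'w) \<Rightarrow> 'w \<Rightarrow> salg \<Rightarrow> 'w::ab_group_add" where
  "eval s L w x = (\<Sum>\<alpha>\<in>supp x. s (cf x \<alpha>) (eval_mono L w (mdeg \<alpha>) \<alpha>))"

text \<open>The variables act on the algebra by operators which supercommute, and the algebra is the
  universal module with this property.\<close>

locale supercommuting = vector_space s for s :: "complex \<Rightarrow> 'w::ab_group_add \<Rightarrow> 'w" +
  fixes L :: "var \<Rightarrow> 'w \<Rightarrow> 'w" and w0 :: 'w
  assumes L_add: "L v (x + y) = L v x + L v y"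
    and L_scl: "L v (s c x) = s c (L v x)"
    and L_commute: "L u (L v x) = s (sg (vpar u \<and> vpar v)) (L v (L u x))"
begin

lemma L_0 [simp]: "L v 0 = 0"
  using L_add[of v 0 0] by simp

lemma L_square: assumes "vpar v" shows "L v (L v x) = 0"
proof -
  have "L v (L v x) = - L v (L v x)"
    using L_commute[of v v x] assms by simp
  hence "s 2 (L v (L v x)) = 0"
    using scale_left_distrib[of 1 1 "L v (L v x)"] by (simp add: eq_neg_iff_add_eq_0)
  thus ?thesis by simp
qed

lemma eval_eq_sum:
  assumes "finite S" "supp x \<subseteq> S"
  shows "eval s L w0 x = (\<Sum>\<alpha>\<in>S. s (cf x \<alpha>) (eval_mono L w0 (mdeg \<alpha>) \<alpha>))"
  unfolding eval_def by (rule sum.mono_neutral_left) (use assms in \<open>auto simp: supp_iff\<close>)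

lemma eval_add: "eval s L w0 (x + y) = eval s L w0 x + eval s L w0 y"
  by (subst (1 2 3) eval_eq_sum[of "supp x \<union> supp y"])
    (auto simp: supp_iff sum.distrib scale_left_distrib)

lemma eval_scl: "eval s L w0 (scl c x) = s c (eval s L w0 x)"
  by (subst (1 2) eval_eq_sum[of "supp x"]) (auto simp: supp_iff scale_sum_right)

lemma eval_0 [simp]: "eval s L w0 0 = 0"
  using eval_scl[of 0 0] by simp

lemma eval_mon: "is_mono \<alpha> \<Longrightarrow> eval s L w0 (mon \<alpha>) = eval_mono L w0 (mdeg \<alpha>) \<alpha>"
  by (simp add: eval_def supp_mon cf_mon)

lemma eval_1 [simp]: "eval s L w0 1 = w0"
  using eval_mon[of 0] by (simp add: mdeg_eq_wt)

lemma eval_mon_least: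
  assumes "is_mono \<beta>" "\<And>w. \<beta> w \<noteq> 0 \<Longrightarrow> v \<le> w" "vpar v \<Longrightarrow> \<beta> v = 0"
  shows "eval s L w0 (mon (sng v + \<beta>)) = L v (eval s L w0 (mon \<beta>))"
proof -
  have l: "(LEAST w. (sng v + \<beta>) w \<noteq> 0) = v" by (rule sng_plus_least) (rule assms(2))
  have ne: "sng v + \<beta> \<noteq> 0" by (metis add_is_0 plus_fun_apply sng_apply zero_fun_apply zero_neq_one)
  have "(sng v + \<beta>)(v := (sng v + \<beta>) v - 1) = \<beta>" by (auto simp: sng_def)
  thus ?thesis
    using ne by (simp only: eval_mon is_mono_sng_plus assms mdeg_sng_plus Let_def eval_mono.simps l if_False)
qed

text \<open>Induction on the degree, comparing \<open>v\<close> with the least variable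
  \<open>u\<close> of the monomial. If \<open>v\<close> stays in front, the product is already
  sorted; if \<open>v = u\<close> is odd, both sides vanish by \<open>L_square\<close>; otherwise
  \<open>v\<close> is moved past \<open>u\<close>, in the algebra by \<open>var_left_commute\<close>
  and among the operators by \<open>L_commute\<close>, and meets a monomial of smaller
  degree.\<close>

lemma eval_var_times_mon:
  "is_mono \<alpha> \<Longrightarrow> eval s L w0 (var v * mon \<alpha>) = L v (eval s L w0 (mon \<alpha>))"
proof (induction "mdeg \<alpha>" arbitrary: \<alpha> rule: less_induct)
  case less
  show ?case
  proof (cases "\<alpha> = 0")
    case True
    thus ?thesis using eval_mon_least[of 0 v] by (simp add: var_def)
  next
    case False
    then obtain u \<beta> where b: "\<alpha> = sng u + \<beta>" "is_mono \<beta>" "\<And>w. \<beta> w \<noteq> 0 \<Longrightarrow> u \<le> w" "vpar u \<Longrightarrow> \<beta> u = 0"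
      using mono_peel_least[OF less.prems] by metis
    have m\<alpha>: "mon \<alpha> = var u * mon \<beta>" using b var_times_mon_least by metis
    have e\<alpha>: "eval s L w0 (mon \<alpha>) = L u (eval s L w0 (mon \<beta>))"
      using b eval_mon_least by metis
    have IH: "eval s L w0 (var v * mon \<beta>) = L v (eval s L w0 (mon \<beta>))"
      by (rule less.hyps) (use b in \<open>simp_all add: mdeg_sng_plus\<close>)
    have \<alpha>w: "\<alpha> w \<noteq> 0 \<Longrightarrow> u \<le> w" for w using b(1,3) by (auto simp: sng_def split: if_splits)
    consider "v < u \<or> v = u \<and> \<not> vpar v" | "v = u" "vpar v" | "u < v" by fastforce
    thus ?thesis
    proof cases
      case 1
      have le: "\<alpha> w \<noteq> 0 \<Longrightarrow> v \<le> w" for w using \<alpha>w[of w] 1 by auto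
      have z: "vpar v \<Longrightarrow> \<alpha> v = 0" using \<alpha>w[of v] 1 by (meson leD)
      have "var v * mon \<alpha> = mon (sng v + \<alpha>)"
        by (rule var_times_mon_least) (use less.prems le z in auto)
      thus ?thesis using eval_mon_least[OF less.prems le z] by simp
    next
      case 2
      hence "var v * mon \<alpha> = 0" by (simp add: m\<alpha> var_square mult.assoc[symmetric])
      thus ?thesis using 2 by (simp add: e\<alpha> L_square)
    next
      case 3
      let ?c = "sg (vpar v \<and> vpar u)"
      \<comment> \<open>The induction hypothesis does not reach \<open>u\<close> acting on
        \<open>v * \<beta>\<close>, whose degree has not dropped. But \<open>u\<close> is still
        least there, unless \<open>v * \<beta>\<close> is 0 because an odd \<open>v\<close>
        repeats.\<close>
      have "eval s L w0 (var u * (var v * mon \<beta>)) = L u (eval s L w0 (var v * mon \<beta>))"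
      proof (cases "is_mono (sng v + \<beta>)")
        case True
        have le: "(sng v + \<beta>) w \<noteq> 0 \<Longrightarrow> u \<le> w" for w using b(3)[of w] 3 by (auto simp: sng_def split: if_splits)
        have z: "vpar u \<Longrightarrow> (sng v + \<beta>) u = 0" using b(4) 3 by (auto simp: sng_def)
        have "var u * mon (sng v + \<beta>) = mon (sng u + (sng v + \<beta>))"
          by (rule var_times_mon_least[of "sng v + \<beta>" u, OF True le z])
        thus ?thesis using eval_mon_least[of "sng v + \<beta>" u, OF True le z] b(2)
          by (simp add: var_times_mon scl_mult_right eval_scl L_scl)
      next
        case False
        hence "var v * mon \<beta> = 0" using b(2) by (simp add: var_times_mon mon_not_mono)
        thus ?thesis by simp
      qed
      moreover have "var v * mon \<alpha> = scl ?c (var u * (var v * mon \<beta>))"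
        unfolding m\<alpha> by (rule var_left_commute)
      ultimately show ?thesis
        by (simp add: eval_scl IH e\<alpha> L_commute[of v u])
    qed
  qed
qed

lemma eval_var_times: "eval s L w0 (var v * x) = L v (eval s L w0 x)"
proof -
  have "eval s L w0 (var v * (\<Sum>\<alpha>\<in>A. scl (cf x \<alpha>) (mon \<alpha>)))
      = L v (eval s L w0 (\<Sum>\<alpha>\<in>A. scl (cf x \<alpha>) (mon \<alpha>)))" if "finite A" "A \<subseteq> supp x" for A
    using that by (induction A rule: finite_induct)
      (auto simp: distrib_left eval_add L_add scl_mult_right eval_scl L_scl eval_var_times_mon supp_is_mono)
  from this[of "supp x"] show ?thesis using salg_expand[of "supp x" x] by simp
qed

end

section \<open>Homomorphisms and superderivations\<close>

text \<open>Nothing is asked where \<open>c\<close> vanishes: the operators below kill most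
  variables, and the value of \<open>\<phi>\<close> there is arbitrary.\<close>

definition par_shift :: "bool \<Rightarrow> (var \<Rightarrow> complex) \<Rightarrow> (var \<Rightarrow> var) \<Rightarrow> bool" where
  "par_shift d c \<phi> \<longleftrightarrow> (\<forall>v. c v \<noteq> 0 \<longrightarrow> vpar (\<phi> v) = (vpar v \<noteq> d))"

text \<open>For \<open>par_shift False c \<phi>\<close> this is the algebra homomorphism sending
  \<open>var v\<close> to \<open>scl (c v) (var (\<phi> v))\<close>. Its instances are the parity
  automorphism \<open>gam\<close>, the map \<open>keep\<close> that kills variables, and the
  renaming \<open>ren\<close> of rows.\<close>

definition Sub :: "(var \<Rightarrow> complex) \<Rightarrow> (var \<Rightarrow> var) \<Rightarrow> salg \<Rightarrow> salg" where
  "Sub c \<phi> = eval scl (\<lambda>v x. scl (c v) (var (\<phi> v) * x)) 1"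

lemma supercommuting_Sub:
  assumes "par_shift False c \<phi>"
  shows "supercommuting scl (\<lambda>v x. scl (c v) (var (\<phi> v) * x))"
proof unfold_locales
  fix u v x
  show "scl (c u) (var (\<phi> u) * scl (c v) (var (\<phi> v) * x)) =
    scl (sg (vpar u \<and> vpar v)) (scl (c v) (var (\<phi> v) * scl (c u) (var (\<phi> u) * x)))"
  proof (cases "c u = 0 \<or> c v = 0")
    case True
    thus ?thesis by (auto simp: scl_mult_right)
  next
    case False
    hence "var (\<phi> u) * (var (\<phi> v) * x) = scl (sg (vpar u \<and> vpar v)) (var (\<phi> v) * (var (\<phi> u) * x))"
      using assms var_commute[of "\<phi> u" "\<phi> v"]
      by (simp add: par_shift_def scl_mult_left mult.assoc[symmetric])
    thus ?thesis by (simp add: scl_mult_right mult.commute mult.left_commute)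
  qed
qed (auto simp: distrib_left sv.scale_right_distrib scl_mult_right mult.commute)

context
  fixes c \<phi> assumes p: "par_shift False c \<phi>"
begin

interpretation supercommuting scl "\<lambda>v x. scl (c v) (var (\<phi> v) * x)" 1
  by (rule supercommuting_Sub[OF p])

lemma Sub_1: "Sub c \<phi> 1 = 1"
  by (simp add: Sub_def)

lemma lin_Sub: "lin (Sub c \<phi>)"
  unfolding Sub_def by (rule linI) (simp_all add: eval_add eval_scl)

lemma Sub_var_times: "Sub c \<phi> (var v * x) = scl (c v) (var (\<phi> v) * Sub c \<phi> x)"
  by (simp add: Sub_def eval_var_times)

lemma Sub_var: "Sub c \<phi> (var v) = scl (c v) (var (\<phi> v))"
  using Sub_var_times[of v 1] by (simp add: Sub_1)

lemma Sub_mult: "Sub c \<phi> (x * y) = Sub c \<phi> x * Sub c \<phi> y"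
  by (induction x rule: salg_induct)
    (simp_all add: Sub_1 mult.assoc Sub_var_times scl_mult_left distrib_right
      svp.linear_add[OF lin_Sub] svp.linear_scale[OF lin_Sub])

end

text \<open>The parity automorphism for \<open>d = True\<close>, the identity for
  \<open>d = False\<close>; indexing by the parity gives even and odd derivations the same Leibniz
  rule.\<close>

definition gam :: "bool \<Rightarrow> salg \<Rightarrow> salg" where
  "gam d = Sub (\<lambda>v. sg (d \<and> vpar v)) id"

lemma par_shift_sg: "par_shift False (\<lambda>v. sg (d \<and> vpar v)) id"
  by (simp add: par_shift_def)

lemma gam_1 [simp]: "gam d 1 = 1"
  unfolding gam_def by (rule Sub_1[OF par_shift_sg])

lemma lin_gam: "lin (gam d)"
  unfolding gam_def by (rule lin_Sub[OF par_shift_sg])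

lemmas gam_add = svp.linear_add[OF lin_gam] and gam_scl = svp.linear_scale[OF lin_gam]
  and gam_0 [simp] = svp.linear_0[OF lin_gam] and gam_diff = svp.linear_diff[OF lin_gam]
  and gam_sum = svp.linear_sum[OF lin_gam]

lemma gam_mult: "gam d (x * y) = gam d x * gam d y"
  unfolding gam_def by (rule Sub_mult[OF par_shift_sg])

lemma gam_var: "gam d (var v) = scl (sg (d \<and> vpar v)) (var v)"
  unfolding gam_def by (simp add: Sub_var[OF par_shift_sg])

lemma gam_False [simp]: "gam False x = x"
  by (induction x rule: salg_induct) (simp_all add: gam_mult gam_var gam_add gam_scl)

lemma gam_gam: "gam d (gam e x) = gam (d \<noteq> e) x"
  by (induction x rule: salg_induct)
    (auto simp: gam_mult gam_var gam_add gam_scl scl_mult_left sg_def)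

lemma gam_same [simp]: "gam d (gam d x) = x"
  by (simp add: gam_gam)

text \<open>The last clause expresses that \<open>D\<close> is homogeneous of parity
  \<open>d\<close> without splitting elements into even and odd parts: conjugation with the parity
  automorphism multiplies \<open>D\<close> by its sign.\<close>

definition superderiv :: "bool \<Rightarrow> (salg \<Rightarrow> salg) \<Rightarrow> bool" where
  "superderiv d D \<longleftrightarrow> lin D \<and> (\<forall>x y. D (x * y) = D x * y + gam d x * D y)
     \<and> (\<forall>e x. gam e (D x) = scl (sg (d \<and> e)) (D (gam e x)))"

lemma superderivD:
  assumes "superderiv d D"
  shows "lin D" "D (x * y) = D x * y + gam d x * D y" "gam e (D x) = scl (sg (d \<and> e)) (D (gam e x))"
    "D 1 = 0" "D 0 = 0" "D (x + y) = D x + D y" "D (x - y) = D x - D y" "D (scl c x) = scl c (D x)"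
    "D (sum f A) = (\<Sum>a\<in>A. D (f a))"
proof -
  show l: "lin D" and m: "D (x * y) = D x * y + gam d x * D y" for x y
    using assms by (auto simp: superderiv_def)
  show "gam e (D x) = scl (sg (d \<and> e)) (D (gam e x))"
    using assms by (auto simp: superderiv_def)
  show "D 1 = 0" using m[of 1 1] by simp
  show "D 0 = 0" "D (x + y) = D x + D y" "D (x - y) = D x - D y" "D (scl c x) = scl c (D x)"
    "D (sum f A) = (\<Sum>a\<in>A. D (f a))"
    using svp.linear_0[OF l] svp.linear_add[OF l] svp.linear_diff[OF l] svp.linear_scale[OF l]
      svp.linear_sum[OF l] by auto
qed

lemma superderiv_eqI:
  assumes D: "superderiv d D" and D': "superderiv d D'" and v: "\<And>v. D (var v) = D' (var v)"
  shows "D x = D' x"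
  by (induction x rule: salg_induct) (simp_all add: superderivD[OF D] superderivD[OF D'] v)

lemma superderiv_zero: "superderiv d (\<lambda>_. 0)"
  by (auto simp: superderiv_def intro!: linI)

lemma superderiv_add:
  assumes D: "superderiv d D" and D': "superderiv d D'"
  shows "superderiv d (\<lambda>x. D x + D' x)"
  unfolding superderiv_def
  by (auto simp: superderivD[OF D] superderivD[OF D'] gam_add algebra_simps sv.scale_right_distrib
      intro!: linI)

lemma superderiv_scl:
  assumes D: "superderiv d D"
  shows "superderiv d (\<lambda>x. scl c (D x))"
  unfolding superderiv_def
  by (auto simp: superderivD[OF D] gam_scl algebra_simps sv.scale_right_distrib
      scl_mult_left scl_mult_right intro!: linI)

lemma superderiv_diff:
  assumes D: "superderiv d D" and D': "superderiv d D'"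
  shows "superderiv d (\<lambda>x. D x - D' x)"
  using superderiv_add[OF D superderiv_scl[OF D', of "-1"]] by simp

lemma superderiv_sum:
  assumes "\<And>a. a \<in> A \<Longrightarrow> superderiv d (D a)"
  shows "superderiv d (\<lambda>x. \<Sum>a\<in>A. D a x)"
  using assms by (induction A rule: infinite_finite_induct) (auto intro: superderiv_add superderiv_zero)

text \<open>A supercommutator is thus determined by its values on the variables, and commutation
  rules between the operators below need only be verified there.\<close>

lemma superderiv_commutator:
  assumes D: "superderiv d D" and D': "superderiv e D'"
  shows "superderiv (d \<noteq> e) (\<lambda>x. D (D' x) - scl (sg (d \<and> e)) (D' (D x)))"
  unfolding superderiv_def
proof (intro conjI allI)
  show "lin (\<lambda>x. D (D' x) - scl (sg (d \<and> e)) (D' (D x)))"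
    by (rule linI) (auto simp: superderivD[OF D] superderivD[OF D'] algebra_simps sv.scale_right_distrib
      sv.scale_right_diff_distrib mult.commute)
  fix x y b
  show "D (D' (x * y)) - scl (sg (d \<and> e)) (D' (D (x * y))) =
    (D (D' x) - scl (sg (d \<and> e)) (D' (D x))) * y +
    gam (d \<noteq> e) x * (D (D' y) - scl (sg (d \<and> e)) (D' (D y)))"
  proof -
    have g: "gam d (D' x) = scl (sg (d \<and> e)) (D' (gam d x))"
      "gam e (D x) = scl (sg (d \<and> e)) (D (gam e x))"
      using superderivD(3)[OF D', of d x] superderivD(3)[OF D, of e x] by (simp_all add: conj_commute)
    have gg: "gam d (gam e x) = gam (d \<noteq> e) x" "gam e (gam d x) = gam (d \<noteq> e) x"
      by (auto simp: gam_gam intro!: arg_cong[of _ _ "\<lambda>b. gam b x"])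
    show ?thesis
      by (simp add: superderivD(2)[OF D] superderivD(2)[OF D'] superderivD(6)[OF D] superderivD(6)[OF D'] g gg
        algebra_simps sv.scale_right_distrib sv.scale_right_diff_distrib scl_mult_left scl_mult_right)
  qed
  show "gam b (D (D' x) - scl (sg (d \<and> e)) (D' (D x))) =
    scl (sg ((d \<noteq> e) \<and> b)) (D (D' (gam b x)) - scl (sg (d \<and> e)) (D' (D (gam b x))))"
    by (simp add: gam_diff gam_scl superderivD(3,8)[OF D] superderivD(3,8)[OF D'] sv.scale_right_diff_distrib)
      (auto simp: sg_def)
qed

definition pscl :: "complex \<Rightarrow> salg \<times> salg \<Rightarrow> salg \<times> salg" where
  "pscl c p = (scl c (fst p), scl c (snd p))"

lemma pscl_simps [simp]: "fst (pscl c p) = scl c (fst p)" "snd (pscl c p) = scl c (snd p)"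
  by (simp_all add: pscl_def)

text \<open>A superderivation is read off the operators of multiplication by the variables on first order
  deformations.\<close>

definition Der :: "bool \<Rightarrow> (var \<Rightarrow> complex) \<Rightarrow> (var \<Rightarrow> var) \<Rightarrow> salg \<Rightarrow> salg" where
  "Der d c \<phi> x = snd (eval pscl (\<lambda>v p. (var v * fst p,
     scl (c v) (var (\<phi> v) * fst p) + scl (sg (d \<and> vpar v)) (var v * snd p))) (1, 0) x)"

lemma supercommuting_Der:
  assumes "par_shift d c \<phi>"
  shows "supercommuting pscl (\<lambda>v p. (var v * fst p,
     scl (c v) (var (\<phi> v) * fst p) + scl (sg (d \<and> vpar v)) (var v * snd p)))"
proof unfold_locales
  fix u v and p :: "salg \<times> salg"
  obtain x y where p: "p = (x, y)" by (cases p)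
  have vv: "var v * (var u * z) = scl (sg (vpar u \<and> vpar v)) (var u * (var v * z))" for u v z
    by (subst var_left_commute) (simp add: conj_commute)
  \<comment> \<open>\<open>\<phi> u\<close> differs in parity from \<open>u\<close> by
    \<open>d\<close>, so carrying it past \<open>v\<close> costs the sign of \<open>u\<close>
    against \<open>v\<close> and that of \<open>d\<close> against \<open>v\<close>; the latter is
    the sign built into the second component of the operator.\<close>
  have g: "scl (c u) (var (\<phi> u) * (var v * z))
    = scl (sg (vpar u \<and> vpar v)) (scl (sg (d \<and> vpar v)) (scl (c u) (var v * (var (\<phi> u) * z))))" for u v z
  proof (cases "c u = 0")
    case False
    hence "vpar (\<phi> u) = (vpar u \<noteq> d)" using assms by (simp add: par_shift_def)
    thus ?thesis using vv[of "\<phi> u" v z] by (auto simp: sg_def)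
  qed simp
  show "(var u * fst (var v * fst p, scl (c v) (var (\<phi> v) * fst p) + scl (sg (d \<and> vpar v)) (var v * snd p)),
        scl (c u) (var (\<phi> u) * fst (var v * fst p,
           scl (c v) (var (\<phi> v) * fst p) + scl (sg (d \<and> vpar v)) (var v * snd p))) +
        scl (sg (d \<and> vpar u)) (var u * snd (var v * fst p,
           scl (c v) (var (\<phi> v) * fst p) + scl (sg (d \<and> vpar v)) (var v * snd p)))) =
       pscl (sg (vpar u \<and> vpar v))
        (var v * fst (var u * fst p, scl (c u) (var (\<phi> u) * fst p) + scl (sg (d \<and> vpar u)) (var u * snd p)),
         scl (c v) (var (\<phi> v) * fst (var u * fst p,
           scl (c u) (var (\<phi> u) * fst p) + scl (sg (d \<and> vpar u)) (var u * snd p))) +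
         scl (sg (d \<and> vpar v)) (var v * snd (var u * fst p,
           scl (c u) (var (\<phi> u) * fst p) + scl (sg (d \<and> vpar u)) (var u * snd p))))"
    unfolding p pscl_def fst_conv snd_conv distrib_left scl_mult_right sv.scale_right_distrib
    unfolding g[of u v] g[of v u] vv[of v u] conj_commute[of "vpar v" "vpar u"]
    by (simp add: algebra_simps)
qed (auto simp: pscl_def distrib_left sv.scale_right_distrib sv.scale_left_distrib scl_mult_right
    algebra_simps)

context
  fixes d c \<phi> assumes p: "par_shift d c \<phi>"
begin

interpretation supercommuting pscl "\<lambda>v p. (var v * fst p,
     scl (c v) (var (\<phi> v) * fst p) + scl (sg (d \<and> vpar v)) (var v * snd p))" "(1, 0)"
  by (rule supercommuting_Der[OF p])

lemma lin_Der: "lin (Der d c \<phi>)"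
  unfolding Der_def by (rule linI) (simp_all add: eval_add eval_scl)

lemma Der_1: "Der d c \<phi> 1 = 0"
  by (simp add: Der_def)

lemma Der_var_times:
  "Der d c \<phi> (var v * x) = scl (c v) (var (\<phi> v) * x) + scl (sg (d \<and> vpar v)) (var v * Der d c \<phi> x)"
proof -
  have "fst (eval pscl (\<lambda>v p. (var v * fst p, scl (c v) (var (\<phi> v) * fst p)
      + scl (sg (d \<and> vpar v)) (var v * snd p))) (1, 0) x) = x"
    by (induction x rule: salg_induct) (simp_all add: eval_add eval_scl eval_var_times)
  thus ?thesis by (simp add: Der_def eval_var_times)
qed

lemma Der_var: "Der d c \<phi> (var v) = scl (c v) (var (\<phi> v))"
  using Der_var_times[of v 1] by (simp add: Der_1)

lemma superderiv_Der: "superderiv d (Der d c \<phi>)"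
  unfolding superderiv_def
proof (intro conjI allI)
  show "lin (Der d c \<phi>)" by (rule lin_Der)
  note D = svp.linear_add[OF lin_Der] svp.linear_scale[OF lin_Der]
  fix x y e
  show "Der d c \<phi> (x * y) = Der d c \<phi> x * y + gam d x * Der d c \<phi> y"
    by (induction x rule: salg_induct)
      (simp_all add: Der_1 D mult.assoc Der_var_times gam_add gam_scl gam_mult gam_var algebra_simps
        sv.scale_right_distrib scl_mult_left scl_mult_right)
  show "gam e (Der d c \<phi> x) = scl (sg (d \<and> e)) (Der d c \<phi> (gam e x))"
  proof (induction x rule: salg_induct)
    case (var v x)
    show ?case
    proof (cases "c v = 0")
      case True
      thus ?thesis using var
        by (simp add: Der_var_times D gam_scl gam_mult gam_var scl_mult_left scl_mult_right mult.commute)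
    next
      case False
      hence "vpar (\<phi> v) = (vpar v \<noteq> d)" using p by (simp add: par_shift_def)
      thus ?thesis using var
        by (simp add: Der_var_times D gam_add gam_scl gam_mult gam_var scl_mult_left scl_mult_right
            sv.scale_right_distrib mult.commute) (auto simp: sg_def)
    qed
  qed (simp_all add: Der_1 D gam_add gam_scl sv.scale_right_distrib mult.commute)
qed

text \<open>Both recursions peel off the least variable, and there the monomial is exactly the
  product of this variable and the remainder, so the Leibniz rule of \<open>Der\<close> reproduces
  the clause of \<open>Dm\<close>.\<close>

lemma Dm_eq_Der:
  assumes g: "\<And>v. g v = pscale (c v) (pvar (\<phi> v))"
  shows "is_mono \<alpha> \<Longrightarrow> mdeg \<alpha> = t \<Longrightarrow> Dm d g t \<alpha> = cf (Der d c \<phi> (mon \<alpha>))"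
proof (induction t arbitrary: \<alpha>)
  case 0
  have "\<alpha> = 0"
  proof (rule ccontr)
    assume "\<alpha> \<noteq> 0"
    then obtain v \<beta> where "\<alpha> = sng v + \<beta>" "is_mono \<beta>" by (metis mono_peel_least "0.prems"(1))
    thus False using mdeg_sng_plus[of \<beta> v] "0.prems"(2) by (metis nat.distinct(1))
  qed
  hence "mon \<alpha> = 1" by (simp only: mon_0)
  thus ?case by (simp add: Der_1 cf_0)
next
  case (Suc t)
  hence "\<alpha> \<noteq> 0" by (auto simp: mdeg_eq_wt)
  then obtain v \<beta> where b: "\<alpha> = sng v + \<beta>" "is_mono \<beta>" "\<And>w. \<beta> w \<noteq> 0 \<Longrightarrow> v \<le> w" "vpar v \<Longrightarrow> \<beta> v = 0"
      "v = (LEAST v. \<alpha> v \<noteq> 0)" "\<beta> = \<alpha>(v := \<alpha> v - 1)"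
    by (rule mono_peel_least[OF Suc.prems(1)]) (rule that)
  have m: "mon \<alpha> = var v * mon \<beta>" using b var_times_mon_least by metis
  have "Dm d g t \<beta> = cf (Der d c \<phi> (mon \<beta>))"
    using mdeg_sng_plus[OF b(2), of v] Suc.prems(2) unfolding b(1)[symmetric]
    by (intro Suc.IH b(2)) simp
  moreover have "Dm d g (Suc t) \<alpha> = padd (smul (g v) (monop \<beta>))
      (pscale (sg (d \<and> vpar v)) (smul (pvar v) (Dm d g t \<beta>)))"
    using \<open>\<alpha> \<noteq> 0\<close> unfolding Dm.simps Let_def b(5)[symmetric] b(6)[symmetric] zero_fun_def
    by (simp only: if_False)
  moreover have "g v = cf (scl (c v) (var (\<phi> v)))"
    by (simp add: g cf_scl cf_var)
  ultimately show ?case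
    unfolding m Der_var_times
    by (simp only: cf_plus cf_scl[symmetric] cf_times[symmetric] cf_var[symmetric] cf_mon_eq[OF b(2), symmetric]
        scl_mult_left)
qed

lemma Dpoly_eq_Der:
  assumes g: "\<And>v. g v = pscale (c v) (pvar (\<phi> v))"
  shows "Dpoly d g (cf x) = cf (Der d c \<phi> x)"
proof
  fix \<gamma>
  have "cf (Der d c \<phi> x) \<gamma> = cf (Der d c \<phi> (\<Sum>\<alpha>\<in>supp x. scl (cf x \<alpha>) (mon \<alpha>))) \<gamma>"
    using salg_expand[of "supp x" x] by simp
  also have "\<dots> = (\<Sum>\<alpha>\<in>supp x. cf x \<alpha> * cf (Der d c \<phi> (mon \<alpha>)) \<gamma>)"
    by (simp add: svp.linear_sum[OF lin_Der] svp.linear_scale[OF lin_Der])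
  also have "\<dots> = Dpoly d g (cf x) \<gamma>"
    unfolding Dpoly_def supp_def[symmetric] by (intro sum.cong refl) (simp add: Dm_eq_Der[OF g] supp_is_mono)
  finally show "Dpoly d g (cf x) \<gamma> = cf (Der d c \<phi> x) \<gamma>" ..
qed

end

declare plus_fun_apply [simp del] zero_fun_apply [simp del]

section \<open>Words, supports and weights\<close>

definition pm1 :: "complex \<Rightarrow> bool" where
  "pm1 z \<longleftrightarrow> z = 1 \<or> z = -1"

lemma pm1_simps [simp]: "pm1 1" "pm1 (-1)" "pm1 (sg b)" "pm1 z \<Longrightarrow> z \<noteq> 0" "pm1 z \<Longrightarrow> z * z = 1"
  "pm1 z \<Longrightarrow> z * (z * y) = y"
  by (auto simp: pm1_def sg_def)

lemma pm1_mult: "pm1 y \<Longrightarrow> pm1 z \<Longrightarrow> pm1 (y * z)"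
  by (auto simp: pm1_def)

lemma mono_plusD: "is_mono (\<alpha> + \<beta>) \<Longrightarrow> is_mono \<alpha>" "is_mono (\<alpha> + \<beta>) \<Longrightarrow> is_mono \<beta>"
proof -
  assume a: "is_mono (\<alpha> + \<beta>)"
  have "{v. \<alpha> v \<noteq> 0} \<subseteq> {v. (\<alpha> + \<beta>) v \<noteq> 0}" "{v. \<beta> v \<noteq> 0} \<subseteq> {v. (\<alpha> + \<beta>) v \<noteq> 0}" by (auto simp: plus_fun_apply)
  hence "finite {v. \<alpha> v \<noteq> 0}" "finite {v. \<beta> v \<noteq> 0}"
    using a finite_subset unfolding is_mono_def by blast+
  moreover have "\<alpha> v \<le> (\<alpha> + \<beta>) v" "\<beta> v \<le> (\<alpha> + \<beta>) v" for v by (auto simp: plus_fun_apply)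
  ultimately show "is_mono \<alpha>" "is_mono \<beta>"
    using a unfolding is_mono_def by (meson order_trans)+
qed

text \<open>From here on it mostly suffices to know that a sign is 1 or -1. If
  \<open>sng v + \<alpha>\<close> is no monomial, both sides are 0.\<close>

lemma var_times_mon_pm: "\<exists>\<zeta>. pm1 \<zeta> \<and> var v * mon \<alpha> = scl \<zeta> (mon (sng v + \<alpha>))"
proof (cases "is_mono (sng v + \<alpha>)")
  case True
  hence a: "is_mono \<alpha>" by (rule mono_plusD)
  have "msign (sng v) \<alpha> \<noteq> 0"
  proof
    assume "msign (sng v) \<alpha> = 0"
    then obtain w where "vpar w" "sng v w \<noteq> 0" "\<alpha> w \<noteq> 0"
      by (auto simp: msign_def split: if_splits)
    hence "(sng v + \<alpha>) w > 1" by (auto simp: plus_fun_apply sng_def split: if_splits)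
    moreover have "(sng v + \<alpha>) w \<le> 1" using True \<open>vpar w\<close> unfolding is_mono_def by blast
    ultimately show False by simp
  qed
  hence "pm1 (msign (sng v) \<alpha>)"
    by (auto simp: msign_alt pm1_def minus_one_power_iff split: if_splits)
  thus ?thesis using var_times_mon[OF a] by blast
next
  case False
  moreover have "var v * mon \<alpha> = 0"
    using False by (cases "is_mono \<alpha>") (auto simp: var_times_mon mon_not_mono)
  ultimately show ?thesis by (intro exI[of _ 1]) (simp add: mon_not_mono)
qed

section \<open>Words in the variables\<close>

definition wprod :: "var list \<Rightarrow> salg" where
  "wprod vs = prod_list (map var vs)"

definition cnt :: "var list \<Rightarrow> mono" where
  "cnt vs = count_list vs"

lemma wprod_simps [simp]: "wprod [] = 1" "wprod (v # vs) = var v * wprod vs"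
  "wprod (vs @ ws) = wprod vs * wprod ws"
  by (simp_all add: wprod_def)

lemma cnt_simps [simp]: "cnt [] = 0" "cnt (v # vs) = sng v + cnt vs" "cnt (vs @ ws) = cnt vs + cnt ws"
  by (auto simp: cnt_def sng_def fun_eq_iff plus_fun_apply zero_fun_apply)

lemma cnt_eq_0_iff: "cnt vs v = 0 \<longleftrightarrow> v \<notin> set vs"
  by (simp add: cnt_def count_list_0_iff)

text \<open>Unsorted words admit plain list induction, which sorted monomials do not; passing
  between the two costs only a sign.\<close>

lemma wprod_eq_mon: "\<exists>\<zeta>. pm1 \<zeta> \<and> wprod vs = scl \<zeta> (mon (cnt vs))"
proof (induction vs)
  case Nil
  show ?case by (intro exI[of _ 1]) (simp)
next
  case (Cons v vs)
  then obtain \<zeta> where z: "pm1 \<zeta>" "wprod vs = scl \<zeta> (mon (cnt vs))" by blast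
  obtain \<xi> where x: "pm1 \<xi>" "var v * mon (cnt vs) = scl \<xi> (mon (sng v + cnt vs))"
    using var_times_mon_pm by blast
  show ?case using z x
    by (intro exI[of _ "\<zeta> * \<xi>"]) (simp add: scl_mult_right pm1_mult)
qed

lemma mon_eq_wprod:
  assumes "is_mono \<alpha>"
  shows "\<exists>vs. cnt vs = \<alpha> \<and> mon \<alpha> = wprod vs"
  using assms
proof (induction "mdeg \<alpha>" arbitrary: \<alpha> rule: less_induct)
  case less
  show ?case
  proof (cases "\<alpha> = 0")
    case True
    thus ?thesis by (intro exI[of _ "[]"]) (simp only: cnt_simps wprod_simps mon_0 simp_thms)
  next
    case False
    then obtain v \<beta> where b: "\<alpha> = sng v + \<beta>" "is_mono \<beta>" "\<And>w. \<beta> w \<noteq> 0 \<Longrightarrow> v \<le> w" "vpar v \<Longrightarrow> \<beta> v = 0"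
      using mono_peel_least[OF less.prems] by metis
    have "mdeg \<beta> < mdeg \<alpha>" using mdeg_sng_plus[OF b(2), of v] unfolding b(1)[symmetric] by simp
    then obtain vs where "cnt vs = \<beta>" "mon \<beta> = wprod vs" using less.hyps b(2) by blast
    moreover have "mon \<alpha> = var v * mon \<beta>" using b var_times_mon_least by metis
    ultimately show ?thesis using b(1) by (intro exI[of _ "v # vs"]) simp
  qed
qed

section \<open>Subspaces spanned by monomials\<close>

definition Sp :: "mono set \<Rightarrow> salg set" where
  "Sp A = {x. supp x \<subseteq> A}"

lemma Sp_iff: "x \<in> Sp A \<longleftrightarrow> (\<forall>\<alpha>. cf x \<alpha> \<noteq> 0 \<longrightarrow> \<alpha> \<in> A)"
  by (auto simp: Sp_def supp_iff)

lemma Sp_mono: "x \<in> Sp A \<Longrightarrow> A \<subseteq> B \<Longrightarrow> x \<in> Sp B"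
  by (auto simp: Sp_def)

lemma Sp_subspace: "sv.subspace (Sp A)"
  by (rule sv.subspaceI) (auto simp: Sp_iff, metis add.right_neutral)

lemmas Sp_0 [simp] = sv.subspace_0[OF Sp_subspace]
  and Sp_add = sv.subspace_add[OF Sp_subspace]
  and Sp_scl = sv.subspace_scale[OF Sp_subspace]
  and Sp_sum = sv.subspace_sum[OF Sp_subspace]

lemma mon_in_Sp: "\<alpha> \<in> A \<Longrightarrow> mon \<alpha> \<in> Sp A"
  by (auto simp: Sp_def supp_mon)

lemma var_times_Sp:
  assumes "x \<in> Sp A"
  shows "var v * x \<in> Sp ((+) (sng v) ` A)"
proof -
  have "supp (var v * x) \<subseteq> (\<lambda>(\<alpha>, \<beta>). \<alpha> + \<beta>) ` ({sng v} \<times> supp x)"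
    using supp_times[of "var v" x] by (simp add: var_def supp_mon)
  also have "\<dots> = (+) (sng v) ` supp x" by auto
  also have "\<dots> \<subseteq> (+) (sng v) ` A" using assms by (auto simp: Sp_def)
  finally show ?thesis by (simp add: Sp_def)
qed

lemma lin_expand:
  assumes "lin D"
  shows "D x = (\<Sum>\<alpha>\<in>supp x. scl (cf x \<alpha>) (D (mon \<alpha>)))"
  by (subst (1) salg_expand[of "supp x" x])
    (simp_all add: svp.linear_sum[OF assms] svp.linear_scale[OF assms])

lemma lin_Sp:
  assumes "lin D" "x \<in> Sp A" "\<And>\<alpha>. \<alpha> \<in> A \<Longrightarrow> is_mono \<alpha> \<Longrightarrow> D (mon \<alpha>) \<in> Sp B"
  shows "D x \<in> Sp B"
  unfolding lin_expand[OF assms(1), of x]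
  using assms(2,3) by (intro Sp_sum Sp_scl) (metis Sp_def mem_Collect_eq subsetD supp_is_mono)

lemma lin_eq_on:
  assumes "lin D" "lin D'" "x \<in> Sp A" "\<And>\<alpha>. \<alpha> \<in> A \<Longrightarrow> is_mono \<alpha> \<Longrightarrow> D (mon \<alpha>) = D' (mon \<alpha>)"
  shows "D x = D' x"
  unfolding lin_expand[OF assms(1), of x] lin_expand[OF assms(2), of x]
  using assms(3,4) by (intro sum.cong) (auto simp: Sp_def supp_is_mono subset_iff)

lemma lin_zero: "lin (\<lambda>_. 0)"
  by (rule linI) auto

text \<open>By the Leibniz rule each term replaces one occurrence of a variable \<open>v\<close> by
  \<open>\<phi> v\<close>. Adding \<open>sng v\<close> on the left instead of removing it on the
  right keeps truncated subtraction out of the relation.\<close>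

lemma Der_mon_Sp:
  assumes p: "par_shift d c \<phi>" and "is_mono \<alpha>"
  shows "Der d c \<phi> (mon \<alpha>) \<in> Sp {\<gamma>. \<exists>v. \<alpha> v \<noteq> 0 \<and> c v \<noteq> 0 \<and> \<gamma> + sng v = \<alpha> + sng (\<phi> v)}"
proof -
  have W: "Der d c \<phi> (wprod vs) \<in> Sp {\<gamma>. \<exists>v\<in>set vs. c v \<noteq> 0 \<and> \<gamma> + sng v = cnt vs + sng (\<phi> v)}" for vs
  proof (induction vs)
    case Nil
    show ?case by (simp add: Der_1[OF p])
  next
    case (Cons u vs)
    let ?B = "{\<gamma>. \<exists>v\<in>set (u # vs). c v \<noteq> 0 \<and> \<gamma> + sng v = cnt (u # vs) + sng (\<phi> v)}"
    obtain \<zeta> where "wprod vs = scl \<zeta> (mon (cnt vs))" using wprod_eq_mon by blast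
    hence "wprod vs \<in> Sp {cnt vs}" by (simp add: Sp_scl mon_in_Sp)
    hence "var (\<phi> u) * wprod vs \<in> Sp {sng (\<phi> u) + cnt vs}" using var_times_Sp by fastforce
    hence "scl (c u) (var (\<phi> u) * wprod vs) \<in> Sp ?B"
      by (cases "c u = 0") (auto intro!: Sp_scl elim!: Sp_mono simp: add_ac)
    moreover have "var u * Der d c \<phi> (wprod vs) \<in> Sp ?B"
    proof (rule Sp_mono[OF var_times_Sp[OF Cons.IH]], rule image_subsetI, clarify)
      fix \<gamma> b q k assume a: "(b, q, k) \<in> set vs" "c (b, q, k) \<noteq> 0"
        and g: "\<gamma> + sng (b, q, k) = cnt vs + sng (\<phi> (b, q, k))"
      have "sng u + \<gamma> + sng (b, q, k) = cnt (u # vs) + sng (\<phi> (b, q, k))"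
        using g by (simp only: cnt_simps add.assoc)
      thus "\<exists>v\<in>set (u # vs). c v \<noteq> 0 \<and> sng u + \<gamma> + sng v = cnt (u # vs) + sng (\<phi> v)"
        using a by (meson list.set_intros(2))
    qed
    ultimately show ?case
      by (simp add: Der_var_times[OF p] Sp_add Sp_scl)
  qed
  obtain vs where vs: "cnt vs = \<alpha>" "mon \<alpha> = wprod vs" using mon_eq_wprod[OF assms(2)] by blast
  have sub: "{\<gamma>. \<exists>v\<in>set vs. c v \<noteq> 0 \<and> \<gamma> + sng v = \<alpha> + sng (\<phi> v)}
      \<subseteq> {\<gamma>. \<exists>v. \<alpha> v \<noteq> 0 \<and> c v \<noteq> 0 \<and> \<gamma> + sng v = \<alpha> + sng (\<phi> v)}"
    using cnt_eq_0_iff[of vs] unfolding vs(1) by blast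
  show ?thesis unfolding vs(2) by (rule Sp_mono[OF W[of vs, unfolded vs(1)] sub])
qed

lemma wt_cnt: "is_mono (cnt vs) \<Longrightarrow> wt c (cnt vs) = sum_list (map c vs)"
proof (induction vs)
  case (Cons v vs)
  hence "is_mono (cnt vs)" using mono_plusD(2) by auto
  thus ?case using Cons by (simp add: wt_plus)
qed simp

lemma par_shift_id: "par_shift False c id"
  by (simp add: par_shift_def)

lemma Der_id_var_times: "Der False c id (var v * x) = scl (c v) (var v * x) + var v * Der False c id x"
  using Der_var_times[OF par_shift_id, of c v x] by simp

lemma Sub_id_var_times: "Sub c id (var v * x) = scl (c v) (var v * Sub c id x)"
  using Sub_var_times[OF par_shift_id, of c v x] by simp

lemma Der_diag:
  assumes "is_mono \<alpha>"
  shows "Der False c id (mon \<alpha>) = scl (wt c \<alpha>) (mon \<alpha>)"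
proof -
  have W: "Der False c id (wprod vs) = scl (sum_list (map c vs)) (wprod vs)" for vs
    by (induction vs) (simp_all add: Der_1[OF par_shift_id] Der_id_var_times scl_mult_right
        sv.scale_left_distrib del: id_apply)
  obtain vs where vs: "cnt vs = \<alpha>" "mon \<alpha> = wprod vs" using mon_eq_wprod[OF assms] by blast
  show ?thesis using wt_cnt[of vs, unfolded vs(1), OF assms] unfolding vs(2) W by (rule arg_cong[OF sym])
qed

text \<open>Serves to read off single coefficients of a product factor by factor, and to discard the
  auxiliary rows at the very end.\<close>

definition keep :: "var set \<Rightarrow> salg \<Rightarrow> salg" where
  "keep K = Sub (\<lambda>v. if v \<in> K then 1 else 0) id"

lemma keep_mon:
  assumes "is_mono \<alpha>"
  shows "keep K (mon \<alpha>) = (if {v. \<alpha> v \<noteq> 0} \<subseteq> K then mon \<alpha> else 0)"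
proof -
  have W: "keep K (wprod vs) = (if set vs \<subseteq> K then wprod vs else 0)" for vs
    by (induction vs) (simp_all add: keep_def Sub_1[OF par_shift_id] Sub_id_var_times del: id_apply)
  obtain vs where vs: "cnt vs = \<alpha>" "mon \<alpha> = wprod vs" using mon_eq_wprod[OF assms] by blast
  have e: "{v. \<alpha> v \<noteq> 0} = set vs" unfolding vs(1)[symmetric] cnt_eq_0_iff by simp
  show ?thesis unfolding vs(2) e by (rule W)
qed

lemmas keep_mult = Sub_mult[OF par_shift_id, of "\<lambda>v. if v \<in> K then 1 else 0" for K, folded keep_def]
  and keep_1 = Sub_1[OF par_shift_id, of "\<lambda>v. if v \<in> K then 1 else 0" for K, folded keep_def]
  and lin_keep = lin_Sub[OF par_shift_id, of "\<lambda>v. if v \<in> K then 1 else 0" for K, folded keep_def]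

lemma keep_var: "keep K (var v) = (if v \<in> K then var v else 0)"
  by (simp add: keep_def Sub_var[OF par_shift_id])

lemma cf_keep: "cf (keep K x) \<alpha> = (if {v. \<alpha> v \<noteq> 0} \<subseteq> K then cf x \<alpha> else 0)"
proof -
  have "cf (keep K x) \<alpha> = (\<Sum>\<beta>\<in>supp x. if \<beta> = \<alpha> then (if {v. \<alpha> v \<noteq> 0} \<subseteq> K then cf x \<alpha> else 0) else 0)"
    unfolding lin_expand[OF lin_keep, of _ x] cf_sum
    by (intro sum.cong refl) (auto simp: keep_mon supp_is_mono cf_mon)
  also have "\<dots> = (if {v. \<alpha> v \<noteq> 0} \<subseteq> K then cf x \<alpha> else 0)"
    by (simp add: supp_iff)
  finally show ?thesis .
qed

lemma wt_plus_sng: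
  assumes "is_mono \<beta>"
  shows "wt w (\<beta> + sng x) = wt w \<beta> + (w x :: nat)"
proof -
  have f: "finite {v. \<beta> v \<noteq> 0}" using assms by (simp add: is_mono_def)
  have "wt w (\<beta> + sng x) = (\<Sum>v\<in>insert x {v. \<beta> v \<noteq> 0}. \<beta> v * w v + (if v = x then w v else 0))"
    by (subst wt_eq_sum[of "insert x {v. \<beta> v \<noteq> 0}"])
      (use f in \<open>auto simp: plus_fun_apply sng_def split: if_splits intro!: sum.cong\<close>)
  also have "\<dots> = wt w \<beta> + w x"
    by (subst wt_eq_sum[of "insert x {v. \<beta> v \<noteq> 0}" \<beta>]) (use f in \<open>auto simp: sum.distrib\<close>)
  finally show ?thesis .
qed

lemma wt_move:
  assumes "is_mono \<alpha>" "is_mono \<gamma>" "\<gamma> + sng v = \<alpha> + sng u" "w u = w v"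
  shows "wt w \<gamma> = (wt w \<alpha> :: nat)"
  using wt_plus_sng[OF assms(1), of w u] wt_plus_sng[OF assms(2), of w v] assms(3,4) by simp

section \<open>The operators of the two Lie superalgebras\<close>

abbreviation Xv :: "idx \<Rightarrow> idx \<Rightarrow> var" where "Xv r i \<equiv> (False, r, i)"
abbreviation Yv :: "idx \<Rightarrow> idx \<Rightarrow> var" where "Yv i s \<equiv> (True, i, s)"

lemma vpar_XY [simp]: "vpar (b, r, i) = (fst r \<noteq> fst i)"
  by (simp add: vpar_def)

definition EV_coef :: "idx \<Rightarrow> idx \<Rightarrow> var \<Rightarrow> complex" where
  "EV_coef i j v = (case v of (b, r, k) \<Rightarrow>
     if b then (if r = i then - sg ((fst i \<noteq> fst j) \<and> fst i) else 0)
     else (if k = j then sg ((fst i \<noteq> fst j) \<and> fst r) else 0))"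

definition EV_var :: "idx \<Rightarrow> idx \<Rightarrow> var \<Rightarrow> var" where
  "EV_var i j v = (case v of (b, r, k) \<Rightarrow> if b then Yv j k else Xv r i)"

definition EV :: "idx \<Rightarrow> idx \<Rightarrow> salg \<Rightarrow> salg" where
  "EV i j = Der (fst i \<noteq> fst j) (EV_coef i j) (EV_var i j)"

lemma EV_shift: "par_shift (fst i \<noteq> fst j) (EV_coef i j) (EV_var i j)"
  unfolding par_shift_def
proof (intro allI impI)
  fix v assume "EV_coef i j v \<noteq> 0"
  thus "vpar (EV_var i j v) = (vpar v \<noteq> (fst i \<noteq> fst j))"
    by (cases v) (auto simp: EV_coef_def EV_var_def split: if_splits)
qed

lemma Egen_eq: "Egen i j v = pscale (EV_coef i j v) (pvar (EV_var i j v))"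
  by (cases v) (auto simp: Egen_def EV_coef_def EV_var_def Let_def pscale_def)

lemma Eact_cf: "Eact i j (cf x) = cf (EV i j x)"
  unfolding Eact_def EV_def by (rule Dpoly_eq_Der[OF EV_shift Egen_eq])

lemma superderiv_EV: "superderiv (fst i \<noteq> fst j) (EV i j)"
  unfolding EV_def by (rule superderiv_Der[OF EV_shift])

lemmas EV_simps = superderivD[OF superderiv_EV]

lemma EV_var_X: "EV i j (var (Xv r k)) =
    (if k = j then scl (sg ((fst i \<noteq> fst j) \<and> fst r)) (var (Xv r i)) else 0)"
  unfolding EV_def Der_var[OF EV_shift] by (simp add: EV_coef_def EV_var_def)

lemma EV_var_Y: "EV i j (var (Yv k s)) =
    (if k = i then scl (- sg ((fst i \<noteq> fst j) \<and> fst i)) (var (Yv j s)) else 0)"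
  unfolding EV_def Der_var[OF EV_shift] by (simp add: EV_coef_def EV_var_def)

text \<open>The elementary matrix of gl(U) taking row \<open>r\<close> to row \<open>r'\<close>.
  Since \<open>U\<close> is the left tensor factor of the X-variables, no Koszul sign appears; the
  indices are arbitrary, \<open>U\<close> being tacitly enlarged by auxiliary rows.\<close>

definition EU :: "idx \<Rightarrow> idx \<Rightarrow> salg \<Rightarrow> salg" where
  "EU r' r = Der (fst r' \<noteq> fst r) (\<lambda>(b, q, k). if \<not> b \<and> q = r then 1 else 0) (\<lambda>(b, q, k). Xv r' k)"

lemma EU_shift: "par_shift (fst r' \<noteq> fst r) (\<lambda>(b, q, k). if \<not> b \<and> q = r then 1 else 0) (\<lambda>(b, q, k). Xv r' k)"
  by (auto simp: par_shift_def split: if_splits)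

lemma superderiv_EU: "superderiv (fst r' \<noteq> fst r) (EU r' r)"
  unfolding EU_def by (rule superderiv_Der[OF EU_shift])

lemmas EU_simps = superderivD[OF superderiv_EU]

lemma EU_var: "EU r' r (var (Xv q k)) = (if q = r then var (Xv r' k) else 0)" "EU r' r (var (Yv i s)) = 0"
  unfolding EU_def Der_var[OF EU_shift] by simp_all

text \<open>The two algebras act on different tensor factors: their supercommutator is a
  superderivation that kills every variable. Hence polarisation preserves invariance.\<close>

lemma EV_EU_commute: "EV i j (EU r' r x) = scl (sg ((fst i \<noteq> fst j) \<and> (fst r' \<noteq> fst r))) (EU r' r (EV i j x))"
proof -
  let ?s = "sg ((fst i \<noteq> fst j) \<and> (fst r' \<noteq> fst r))"
  have "EV i j (EU r' r x) - scl ?s (EU r' r (EV i j x)) = 0"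
  proof (rule superderiv_eqI[OF superderiv_commutator[OF superderiv_EV superderiv_EU] superderiv_zero])
    fix v :: var
    obtain b q k where v: "v = (b, q, k)" by (cases v)
    show "EV i j (EU r' r (var v)) - scl ?s (EU r' r (EV i j (var v))) = 0"
      by (cases b) (auto simp: v EU_var EV_var_X EV_var_Y EU_simps EV_simps sg_def svp.linear_neg[OF EU_simps(1)])
  qed
  thus ?thesis by simp
qed

definition Z :: "idx set \<Rightarrow> idx \<Rightarrow> idx \<Rightarrow> salg" where
  "Z R r s = (\<Sum>i\<in>R. var (Xv r i) * var (Yv i s))"

text \<open>The row \<open>r\<close> is left free so that the generated algebra is stable under
  every \<open>EU\<close>; rows outside \<open>U\<close> are removed at the end.\<close>

definition pairings :: "idx set \<Rightarrow> idx set \<Rightarrow> salg set" where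
  "pairings R S = {Z R r s | r s. s \<in> S}"

text \<open>Only \<open>k = j\<close> contributes through the X-factor and only \<open>k = i\<close>
  through the Y-factor; the sign in the dual action makes the two terms cancel.\<close>

lemma EV_Z:
  assumes "finite R" "i \<in> R" "j \<in> R"
  shows "EV i j (Z R r s) = 0"
proof -
  let ?d = "fst i \<noteq> fst j"
  let ?m = "scl (sg (?d \<and> fst r)) (var (Xv r i) * var (Yv j s))"
  have "EV i j (Z R r s) = (\<Sum>k\<in>R. EV i j (var (Xv r k)) * var (Yv k s))
      + (\<Sum>k\<in>R. gam ?d (var (Xv r k)) * EV i j (var (Yv k s)))"
    unfolding Z_def EV_simps(9) EV_simps(2) sum.distrib ..
  also have "(\<Sum>k\<in>R. EV i j (var (Xv r k)) * var (Yv k s)) = (\<Sum>k\<in>R. if k = j then ?m else 0)"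
    by (intro sum.cong) (auto simp: EV_var_X scl_mult_left)
  also have "(\<Sum>k\<in>R. gam ?d (var (Xv r k)) * EV i j (var (Yv k s))) = (\<Sum>k\<in>R. if k = i then - ?m else 0)"
    by (intro sum.cong) (auto simp: EV_var_Y gam_var scl_mult_left scl_mult_right sg_def)
  finally show ?thesis using assms by simp
qed

lemma EU_Z: "EU r' r (Z R q s) = (if q = r then Z R r' s else 0)"
  unfolding Z_def EU_simps(9) by (simp add: EU_simps(2) EU_var)

lemma gam_Z: "gam d (Z R r s) = scl (sg (d \<and> (fst r \<noteq> fst s))) (Z R r s)"
  unfolding Z_def gam_sum sv.scale_sum_right
  by (intro sum.cong refl) (auto simp: gam_mult gam_var scl_mult_left scl_mult_right sg_def)

section \<open>Generated subalgebras\<close>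

inductive_set Gen :: "salg set \<Rightarrow> salg set" for A where
  one: "1 \<in> Gen A"
| base: "a \<in> A \<Longrightarrow> a \<in> Gen A"
| add: "a \<in> Gen A \<Longrightarrow> b \<in> Gen A \<Longrightarrow> a + b \<in> Gen A"
| scl: "a \<in> Gen A \<Longrightarrow> scl c a \<in> Gen A"
| mult: "a \<in> Gen A \<Longrightarrow> b \<in> Gen A \<Longrightarrow> a * b \<in> Gen A"

lemma Gen_0: "0 \<in> Gen A"
  using Gen.scl[OF Gen.one[of A], where c = 0] by simp

lemma Gen_subspace: "sv.subspace (Gen A)"
  by (rule sv.subspaceI) (auto intro: Gen_0 Gen.add Gen.scl)

lemma Gen_prod_list: "(\<And>a. a \<in> set as \<Longrightarrow> a \<in> Gen A) \<Longrightarrow> prod_list as \<in> Gen A"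
  by (induction as) (auto intro: Gen.one Gen.mult)

lemma Gen_hom:
  assumes "lin h" "h 1 = 1" "\<And>x y. h (x * y) = h x * h y" "\<And>a. a \<in> A \<Longrightarrow> h a \<in> Gen B" "x \<in> Gen A"
  shows "h x \<in> Gen B"
  using assms(5)
  by (induction rule: Gen.induct)
    (auto simp: assms(2-4) svp.linear_add[OF assms(1)] svp.linear_scale[OF assms(1)]
      intro: Gen.intros)

text \<open>The Leibniz rule involves \<open>gam d\<close>, so the parity automorphism must also map
  the generators into the subalgebra.\<close>

lemma Gen_superderiv:
  assumes D: "superderiv d D" and A: "\<And>a. a \<in> A \<Longrightarrow> D a \<in> Gen A" "\<And>a. a \<in> A \<Longrightarrow> gam d a \<in> Gen A"
    and x: "x \<in> Gen A"
  shows "D x \<in> Gen A"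
  using x
proof (induction rule: Gen.induct)
  case (mult a b)
  have "gam d a \<in> Gen A"
    by (rule Gen_hom[OF lin_gam gam_1 gam_mult A(2) mult.hyps(1)])
  thus ?case using mult by (auto simp: superderivD(2)[OF D] intro: Gen.intros)
qed (auto simp: superderivD[OF D] A Gen_0 intro: Gen.intros)

section \<open>Operators acting on a single row\<close>

definition rdeg :: "idx \<Rightarrow> mono \<Rightarrow> nat" where
  "rdeg t = wt (\<lambda>(b, q, k). if \<not> b \<and> q = t then 1 else 0)"

lemma rdeg_sng: "rdeg t (sng (b, q, k)) = (if \<not> b \<and> q = t then 1 else 0)"
  by (simp add: rdeg_def)

lemma rdeg_plus: "is_mono \<alpha> \<Longrightarrow> is_mono \<beta> \<Longrightarrow> rdeg t (\<alpha> + \<beta>) = rdeg t \<alpha> + rdeg t \<beta>"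
  by (simp add: rdeg_def wt_plus)

lemma wt_eq_0D:
  assumes "is_mono \<alpha>" "wt w \<alpha> = (0::nat)" "w v \<noteq> 0"
  shows "\<alpha> v = 0"
  using assms by (auto simp: wt_def is_mono_def)

lemma rdeg_0D: "is_mono \<alpha> \<Longrightarrow> rdeg t \<alpha> = 0 \<Longrightarrow> \<alpha> (Xv t k) = 0"
  unfolding rdeg_def by (erule wt_eq_0D) auto

lemma wt_pos_ex:
  assumes "wt w \<alpha> \<noteq> (0::nat)"
  shows "\<exists>v. \<alpha> v \<noteq> 0 \<and> w v \<noteq> 0"
  using assms unfolding wt_def by (metis (mono_tags, lifting) mem_Collect_eq mult_zero_right sum.neutral)

lemma mono_peel: "\<alpha> v \<noteq> 0 \<Longrightarrow> \<alpha> = sng v + \<alpha>(v := \<alpha> v - 1)"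
  by (auto simp: fun_eq_iff sng_def plus_fun_apply)

lemma rdeg_1E:
  assumes "is_mono \<alpha>" "rdeg t \<alpha> = 1"
  obtains k \<beta> where "\<alpha> = sng (Xv t k) + \<beta>" "is_mono \<beta>" "rdeg t \<beta> = 0"
proof -
  obtain v where v: "\<alpha> v \<noteq> 0" "(case v of (b, q, k) \<Rightarrow> if \<not> b \<and> q = t then 1 else (0::nat)) \<noteq> 0"
    using wt_pos_ex[of "\<lambda>(b, q, k). if \<not> b \<and> q = t then 1 else 0" \<alpha>] assms(2)
    unfolding rdeg_def by auto
  then obtain k where k: "v = Xv t k" by (cases v) (auto split: if_splits)
  define \<beta> where "\<beta> = \<alpha>(v := \<alpha> v - 1)"
  have a: "\<alpha> = sng (Xv t k) + \<beta>" using mono_peel[of \<alpha> v, OF v(1)] unfolding \<beta>_def k .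
  have m: "is_mono \<beta>" using assms(1) unfolding a by (rule mono_plusD(2))
  have "rdeg t \<beta> = 0" using assms(2) rdeg_plus[OF is_mono_sng m, of t "Xv t k"] unfolding a
    by (simp add: rdeg_sng)
  thus ?thesis using that a m by blast
qed

lemma gam_mon: "\<exists>\<zeta>. pm1 \<zeta> \<and> gam d (mon \<alpha>) = scl \<zeta> (mon \<alpha>)"
proof (cases "is_mono \<alpha>")
  case True
  then obtain vs where vs: "cnt vs = \<alpha>" "mon \<alpha> = wprod vs" using mon_eq_wprod by blast
  have "\<exists>\<zeta>. pm1 \<zeta> \<and> gam d (wprod vs) = scl \<zeta> (wprod vs)"
  proof (induction vs)
    case Nil
    show ?case by (intro exI[of _ 1]) simp
  next
    case (Cons v vs)
    then obtain \<zeta> where "pm1 \<zeta>" "gam d (wprod vs) = scl \<zeta> (wprod vs)" by blast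
    thus ?case by (intro exI[of _ "sg (d \<and> vpar v) * \<zeta>"])
        (simp add: gam_mult gam_var scl_mult_left scl_mult_right pm1_mult mult.commute)
  qed
  thus ?thesis using vs(2) by simp
next
  case False
  thus ?thesis by (intro exI[of _ 1]) (simp add: mon_not_mono)
qed

lemma gam_Sp: "x \<in> Sp A \<Longrightarrow> gam d x \<in> Sp A"
  by (rule lin_Sp[OF lin_gam, of x A]) (metis gam_mon Sp_scl mon_in_Sp)+

definition odd_unit :: "idx \<times> idx \<Rightarrow> bool" where
  "odd_unit x \<longleftrightarrow> fst (fst x) \<noteq> fst (snd x)"

text \<open>For \<open>x = (i, j)\<close>, the matrix unit with these indices on the tensor factor
  of row \<open>t\<close>. On the variables of an even row it agrees with \<open>EV i j\<close>,
  whose sign there is 1.\<close>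

definition loc :: "idx \<Rightarrow> idx \<times> idx \<Rightarrow> salg \<Rightarrow> salg" where
  "loc t x = Der (odd_unit x) (\<lambda>v. if v = Xv t (snd x) then 1 else 0) (\<lambda>_. Xv t (fst x))"

lemma loc_shift: "par_shift (odd_unit x) (\<lambda>v. if v = Xv t (snd x) then 1 else 0) (\<lambda>_. Xv t (fst x))"
  by (auto simp: par_shift_def odd_unit_def)

lemma superderiv_loc: "superderiv (odd_unit x) (loc t x)"
  unfolding loc_def by (rule superderiv_Der[OF loc_shift])

lemmas loc_simps = superderivD[OF superderiv_loc]

lemma loc_var: "loc t x (var v) = (if v = Xv t (snd x) then var (Xv t (fst x)) else 0)"
  unfolding loc_def Der_var[OF loc_shift] by simp

lemma loc_commute:
  assumes "t \<noteq> u"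
  shows "loc t x (loc u y z) = scl (sg (odd_unit x \<and> odd_unit y)) (loc u y (loc t x z))"
proof -
  have "loc t x (loc u y z) - scl (sg (odd_unit x \<and> odd_unit y)) (loc u y (loc t x z)) = 0"
    by (rule superderiv_eqI[OF superderiv_commutator[OF superderiv_loc superderiv_loc] superderiv_zero])
      (use assms in \<open>auto simp: loc_var loc_simps\<close>)
  thus ?thesis by simp
qed

lemma loc_mon_0:
  assumes "is_mono \<beta>" "rdeg t \<beta> = 0"
  shows "loc t x (mon \<beta>) = 0"
proof -
  have "\<beta> (Xv t (snd x)) = 0" by (rule rdeg_0D[OF assms])
  hence "{\<gamma>. \<exists>v. \<beta> v \<noteq> 0 \<and> (if v = Xv t (snd x) then 1 else (0::complex)) \<noteq> 0
      \<and> \<gamma> + sng v = \<beta> + sng (Xv t (fst x))} = {}" by auto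
  hence "loc t x (mon \<beta>) \<in> Sp {}"
    using Der_mon_Sp[OF loc_shift assms(1), of x t] unfolding loc_def by (simp only:)
  thus ?thesis by (auto simp: Sp_iff intro: salg_eqI)
qed

lemma loc_row_times:
  assumes "is_mono \<beta>" "rdeg t \<beta> = 0"
  shows "loc t x (var (Xv t k) * mon \<beta>) = (if k = snd x then var (Xv t (fst x)) * mon \<beta> else 0)"
  by (simp add: loc_simps loc_var loc_mon_0[OF assms])

lemma lin_comp: "lin f \<Longrightarrow> lin g \<Longrightarrow> lin (\<lambda>x. f (g x))"
  using Vector_Spaces.linear_compose[of scl scl g scl f] by (simp add: comp_def)

lemma lin_scl: "lin f \<Longrightarrow> lin (\<lambda>x. scl c (f x))"
  by (rule linI) (simp_all add: svp.linear_add svp.linear_scale sv.scale_right_distrib mult.commute)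

lemma lin_sum: "(\<And>a. a \<in> A \<Longrightarrow> lin (f a)) \<Longrightarrow> lin (\<lambda>x. \<Sum>a\<in>A. f a x)"
  by (rule linI) (simp_all add: svp.linear_add svp.linear_scale sum.distrib sv.scale_sum_right)

text \<open>In an element linear in row \<open>t\<close> the second derivation can only hit the
  variable produced by the first, so two operators on one row multiply like matrix units.\<close>

lemma loc_merge:
  assumes "z \<in> Sp {\<alpha>. rdeg t \<alpha> = 1}"
  shows "loc t x (loc t y z) = scl (if snd x = fst y then 1 else 0) (loc t (fst x, snd y) z)"
proof (rule lin_eq_on[OF _ _ assms])
  show "lin (\<lambda>z. loc t x (loc t y z))" by (rule lin_comp[OF loc_simps(1) loc_simps(1)])
  show "lin (\<lambda>z. scl (if snd x = fst y then 1 else 0) (loc t (fst x, snd y) z))"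
    by (rule lin_scl[OF loc_simps(1)])
next
  fix \<alpha> assume a: "\<alpha> \<in> {\<alpha>. rdeg t \<alpha> = 1}" "is_mono \<alpha>"
  then obtain k \<beta> where b: "\<alpha> = sng (Xv t k) + \<beta>" "is_mono \<beta>" "rdeg t \<beta> = 0"
    using rdeg_1E by blast
  obtain \<zeta> where "pm1 \<zeta>" "var (Xv t k) * mon \<beta> = scl \<zeta> (mon \<alpha>)"
    using var_times_mon_pm[of "Xv t k" \<beta>] unfolding b(1) by blast
  hence m: "mon \<alpha> = scl \<zeta> (var (Xv t k) * mon \<beta>)" by simp
  show "loc t x (loc t y (mon \<alpha>)) = scl (if snd x = fst y then 1 else 0) (loc t (fst x, snd y) (mon \<alpha>))"
    by (auto simp: m loc_simps(8,5) loc_row_times[OF b(2,3)])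
qed

text \<open>The twist by the parity automorphism turns the action on the left factor of \<open>M \<otimes> N\<close> into one that
  commutes, without signs, with every operator on the right factor.\<close>

definition eh :: "idx \<Rightarrow> idx \<times> idx \<Rightarrow> salg \<Rightarrow> salg" where
  "eh t x z = gam (odd_unit x) (loc t x z)"

lemma lin_eh: "lin (eh t x)"
  using lin_comp[OF lin_gam loc_simps(1), of "odd_unit x" t x] unfolding eh_def[symmetric] by (simp only:)

lemmas eh_add = svp.linear_add[OF lin_eh] and eh_scl = svp.linear_scale[OF lin_eh]
  and eh_0 = svp.linear_0[OF lin_eh] and eh_sum = svp.linear_sum[OF lin_eh]

lemma eh_eh: "eh t x (eh u y z) =
  scl (sg (odd_unit x \<and> odd_unit y)) (gam (odd_unit x \<noteq> odd_unit y) (loc t x (loc u y z)))"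
proof -
  have "loc t x (gam (odd_unit y) w) = scl (sg (odd_unit x \<and> odd_unit y)) (gam (odd_unit y) (loc t x w))" for w
    by (simp add: loc_simps(3))
  thus ?thesis by (simp add: eh_def gam_scl gam_gam)
qed

lemma eh_commute:
  assumes "t \<noteq> u"
  shows "eh t x (eh u y z) = scl (sg (odd_unit x \<and> odd_unit y)) (eh u y (eh t x z))"
  unfolding eh_eh loc_commute[OF assms, of x y]
  by (simp add: gam_scl conj_commute[of "odd_unit y"] eq_commute[of "odd_unit y"])

text \<open>The structure constants of the twisted units: the sign comes from carrying the parity
  automorphism inside \<open>eh t y\<close> past \<open>loc t x\<close>.\<close>

definition merge_coef :: "idx \<times> idx \<Rightarrow> idx \<times> idx \<Rightarrow> complex" where
  "merge_coef x y = (if snd x = fst y then sg (odd_unit x \<and> odd_unit y) else 0)"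

lemma eh_merge:
  assumes "z \<in> Sp {\<alpha>. rdeg t \<alpha> = 1}"
  shows "eh t x (eh t y z) = scl (merge_coef x y) (eh t (fst x, snd y) z)"
proof (cases "snd x = fst y")
  case True
  hence "odd_unit (fst x, snd y) = (odd_unit x \<noteq> odd_unit y)" by (auto simp: odd_unit_def)
  thus ?thesis using True by (simp add: eh_eh loc_merge[OF assms] merge_coef_def) (simp add: eh_def)
next
  case False
  thus ?thesis by (simp add: eh_eh loc_merge[OF assms] merge_coef_def)
qed

lemma eh_Sp:
  assumes "z \<in> Sp A" "\<And>\<alpha> \<gamma>. \<alpha> \<in> A \<Longrightarrow> is_mono \<alpha> \<Longrightarrow> is_mono \<gamma>
    \<Longrightarrow> \<gamma> + sng (Xv t (snd x)) = \<alpha> + sng (Xv t (fst x)) \<Longrightarrow> \<alpha> (Xv t (snd x)) \<noteq> 0 \<Longrightarrow> \<gamma> \<in> A"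
  shows "eh t x z \<in> Sp A"
proof (rule lin_Sp[OF lin_eh assms(1)])
  fix \<alpha> assume "\<alpha> \<in> A" "is_mono \<alpha>"
  have "loc t x (mon \<alpha>) \<in> Sp A"
    using Der_mon_Sp[OF loc_shift \<open>is_mono \<alpha>\<close>, of x t] assms(2)[OF \<open>\<alpha> \<in> A\<close> \<open>is_mono \<alpha>\<close>]
    unfolding loc_def Sp_def subset_iff using supp_is_mono by (fastforce split: if_splits)
  thus "eh t x (mon \<alpha>) \<in> Sp A" unfolding eh_def by (rule gam_Sp)
qed

lemma eh_row:
  assumes "z \<in> Sp {\<alpha>. rdeg u \<alpha> = 1}"
  shows "eh t x z \<in> Sp {\<alpha>. rdeg u \<alpha> = 1}"
  using assms
proof (rule eh_Sp)
  fix \<alpha> \<gamma> assume a: "\<alpha> \<in> {\<alpha>. rdeg u \<alpha> = 1}" "is_mono \<alpha>" "is_mono \<gamma>"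
    "\<gamma> + sng (Xv t (snd x)) = \<alpha> + sng (Xv t (fst x))"
  have "rdeg u \<gamma> = rdeg u \<alpha>"
    unfolding rdeg_def by (rule wt_move[OF a(2-4)]) simp
  thus "\<gamma> \<in> {\<alpha>. rdeg u \<alpha> = 1}" using a(1) by simp
qed

text \<open>A symmetrised normal ordered product: the sum over all injective assignments of rows of
  \<open>T\<close> to the entries of the list, the head acting last. When the list has as many
  entries as \<open>T\<close> has rows, this is a sum over permutations.\<close>

fun Nop :: "idx set \<Rightarrow> (idx \<times> idx) list \<Rightarrow> salg \<Rightarrow> salg" where
  "Nop T [] z = z"
| "Nop T (x # L) z = (\<Sum>t\<in>T. eh t x (Nop (T - {t}) L z))"

lemma Nop_row: "z \<in> Sp {\<alpha>. rdeg u \<alpha> = 1} \<Longrightarrow> Nop T L z \<in> Sp {\<alpha>. rdeg u \<alpha> = 1}"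
proof (induction L arbitrary: T)
  case (Cons x L)
  show ?case unfolding Nop.simps by (intro Sp_sum eh_row Cons)
qed simp

lemma sum_remove_if:
  assumes "finite T"
  shows "(\<Sum>u\<in>T - {t}. f u) = (\<Sum>u\<in>T. if u \<noteq> t then f u else (0::salg))"
  using assms by (intro sum.mono_neutral_cong_left) auto

lemma Nop_swap:
  assumes "finite T"
  shows "Nop T (x # y # L) z = scl (sg (odd_unit x \<and> odd_unit y)) (Nop T (y # x # L) z)"
proof -
  let ?s = "sg (odd_unit x \<and> odd_unit y)"
  let ?W = "\<lambda>t u. Nop (T - {t} - {u}) L z"
  have "Nop T (x # y # L) z = (\<Sum>t\<in>T. \<Sum>u\<in>T. if u \<noteq> t then eh t x (eh u y (?W t u)) else 0)"
    by (simp add: eh_sum sum_remove_if[OF assms] if_distrib[of "eh _ _"] eh_0 cong: if_cong)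
  also have "\<dots> = (\<Sum>u\<in>T. \<Sum>t\<in>T. if u \<noteq> t then eh t x (eh u y (?W t u)) else 0)"
    by (rule sum.swap)
  also have "\<dots> = (\<Sum>u\<in>T. \<Sum>t\<in>T. if t \<noteq> u then scl ?s (eh u y (eh t x (?W u t))) else 0)"
    by (intro sum.cong refl) (simp add: eh_commute[of _ _ x y] Diff_insert2[symmetric] insert_commute)
  also have "\<dots> = scl ?s (Nop T (y # x # L) z)"
    by (simp add: eh_sum sum_remove_if[OF assms] sv.scale_sum_right if_distrib[of "scl ?s"]
        if_distrib[of "eh _ _"] eh_0 cong: if_cong)
  finally show ?thesis .
qed

lemma lin_sum_list: "lin f \<Longrightarrow> f (sum_list (map g xs)) = sum_list (map (\<lambda>x. f (g x)) xs)"
  by (induction xs) (auto simp: svp.linear_add svp.linear_0)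

lemma sum_sum_list: "(\<Sum>t\<in>T. sum_list (map (\<lambda>x. f x t) xs)) = sum_list (map (\<lambda>x. \<Sum>t\<in>T. f x t) xs)"
  for f :: "'b \<Rightarrow> 'c \<Rightarrow> salg"
  by (induction xs) (auto simp: sum.distrib)

text \<open>Normal ordering: the sums of products of operators on distinct rows are generated by the
  operators \<^term>\<open>\<Sum>t\<in>T. eh t x\<close>, with coefficients that do not depend on the set of rows.\<close>

lemma eh_Nop:
  "\<exists>cs. (\<forall>(c, L')\<in>set cs. length L' = length L \<and> fst ` set L' \<subseteq> fst ` set (x # L) \<and> snd ` set L' \<subseteq> snd ` set (x # L))
    \<and> (\<forall>T z. finite T \<longrightarrow> (\<forall>t\<in>T. z \<in> Sp {\<alpha>. rdeg t \<alpha> = 1}) \<longrightarrow>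
        (\<Sum>t\<in>T. eh t x (Nop T L z)) = Nop T (x # L) z + sum_list (map (\<lambda>(c, L'). scl c (Nop T L' z)) cs))"
proof (induction L)
  case Nil
  show ?case by (rule exI[of _ "[]"]) simp
next
  case (Cons y L)
  from Cons.IH obtain cs where cs0: "\<forall>(c, L')\<in>set cs. length L' = length L
        \<and> fst ` set L' \<subseteq> fst ` set (x # L) \<and> snd ` set L' \<subseteq> snd ` set (x # L)"
      and cs1: "\<forall>T z. finite T \<longrightarrow> (\<forall>t\<in>T. z \<in> Sp {\<alpha>. rdeg t \<alpha> = 1}) \<longrightarrow>
        (\<Sum>t\<in>T. eh t x (Nop T L z)) = Nop T (x # L) z + sum_list (map (\<lambda>(c, L'). scl c (Nop T L' z)) cs)"
    by (elim exE conjE)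
  define s where "s = sg (odd_unit x \<and> odd_unit y)"
  define m where "m = merge_coef x y"
  \<comment> \<open>An added operator on row \<open>u\<close> either hits the row \<open>t\<close>
    of \<open>y\<close>, where the two units merge, or another row, where it is moved past
    \<open>y\<close> and the induction hypothesis applies to \<open>T - {t}\<close>. The latter is
    why the coefficients must be common to all sets of rows.\<close>
  define cs' where "cs' = (m, (fst x, snd y) # L) # map (\<lambda>(c, L'). (s * c, y # L')) cs"
  show ?case
  proof (intro exI[of _ cs'] conjI allI impI ballI)
    fix p assume "p \<in> set cs'"
    then consider "p = (m, (fst x, snd y) # L)" | c L' where "(c, L') \<in> set cs" "p = (s * c, y # L')"
      unfolding cs'_def by auto
    thus "case p of (c, L') \<Rightarrow> length L' = length (y # L) \<and> fst ` set L' \<subseteq> fst ` set (x # y # L)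
        \<and> snd ` set L' \<subseteq> snd ` set (x # y # L)"
    proof cases
      case 1
      show ?thesis unfolding 1 by simp blast
    next
      case 2
      from bspec[OF cs0 2(1)] show ?thesis unfolding 2(2) by simp blast
    qed
  next
    fix T :: "idx set" and z
    assume T: "finite T" and z: "\<forall>t\<in>T. z \<in> Sp {\<alpha>. rdeg t \<alpha> = 1}"
    let ?W = "\<lambda>t. Nop (T - {t}) L z"
    have ls: "lin (scl s)" by (rule linI) (simp_all add: sv.scale_right_distrib mult.commute)
    have "(\<Sum>u\<in>T. eh u x (Nop T (y # L) z)) = (\<Sum>u\<in>T. \<Sum>t\<in>T. eh u x (eh t y (?W t)))"
      by (simp add: eh_sum)
    also have "\<dots> = (\<Sum>t\<in>T. \<Sum>u\<in>T. eh u x (eh t y (?W t)))" by (rule sum.swap)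
    also have "\<dots> = (\<Sum>t\<in>T. scl s (eh t y (Nop (T - {t}) (x # L) z
        + sum_list (map (\<lambda>(c, L'). scl c (Nop (T - {t}) L' z)) cs))) + scl m (eh t (fst x, snd y) (?W t)))"
    proof (rule sum.cong[OF refl])
      fix t assume t: "t \<in> T"
      have "(\<Sum>u\<in>T. eh u x (eh t y (?W t))) = (\<Sum>u\<in>T - {t}. eh u x (eh t y (?W t))) + eh t x (eh t y (?W t))"
        using T t by (simp add: sum.remove add.commute)
      also have "eh t x (eh t y (?W t)) = scl m (eh t (fst x, snd y) (?W t))"
        unfolding m_def using z t by (intro eh_merge Nop_row) blast
      also have "(\<Sum>u\<in>T - {t}. eh u x (eh t y (?W t))) = (\<Sum>u\<in>T - {t}. scl s (eh t y (eh u x (?W t))))"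
        by (intro sum.cong refl) (auto simp: eh_commute[of _ t] s_def)
      also have "\<dots> = scl s (eh t y (\<Sum>u\<in>T - {t}. eh u x (?W t)))"
        by (simp add: eh_sum sv.scale_sum_right)
      also have "(\<Sum>u\<in>T - {t}. eh u x (?W t)) = Nop (T - {t}) (x # L) z
          + sum_list (map (\<lambda>(c, L'). scl c (Nop (T - {t}) L' z)) cs)"
        by (rule cs1[rule_format]) (use T z in auto)
      finally show "(\<Sum>u\<in>T. eh u x (eh t y (?W t))) = scl s (eh t y (Nop (T - {t}) (x # L) z
        + sum_list (map (\<lambda>(c, L'). scl c (Nop (T - {t}) L' z)) cs))) + scl m (eh t (fst x, snd y) (?W t))" .
    qed
    also have "\<dots> = scl s (Nop T (y # x # L) z)
        + (\<Sum>t\<in>T. sum_list (map (\<lambda>(c, L'). scl s (eh t y (scl c (Nop (T - {t}) L' z)))) cs))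
        + scl m (Nop T ((fst x, snd y) # L) z)"
      by (simp add: eh_add sv.scale_right_distrib sum.distrib sv.scale_sum_right lin_sum_list[OF lin_eh]
          lin_sum_list[OF ls] case_prod_unfold)
    also have "scl s (Nop T (y # x # L) z) = Nop T (x # y # L) z"
      using Nop_swap[OF T, of x y L z] by (simp add: s_def)
    also have "(\<Sum>t\<in>T. sum_list (map (\<lambda>(c, L'). scl s (eh t y (scl c (Nop (T - {t}) L' z)))) cs))
        = sum_list (map (\<lambda>(c, L'). scl (s * c) (Nop T (y # L') z)) cs)"
      using sum_sum_list[of "\<lambda>p t. scl s (eh t y (scl (fst p) (Nop (T - {t}) (snd p) z)))" cs T]
      by (simp add: case_prod_unfold eh_scl sv.scale_sum_right)
    finally show "(\<Sum>t\<in>T. eh t x (Nop T (y # L) z)) = Nop T (x # y # L) z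
        + sum_list (map (\<lambda>(c, L'). scl c (Nop T L' z)) cs')"
      by (simp add: cs'_def comp_def case_prod_unfold add_ac)
  qed
qed

lemma sum_permutations_of_set:
  assumes "finite T" "T \<noteq> {}"
  shows "(\<Sum>us\<in>permutations_of_set T. f us) = (\<Sum>t\<in>T. \<Sum>vs\<in>permutations_of_set (T - {t}). f (t # vs))"
  unfolding permutations_of_set_nonempty[OF assms(2)]
  by (subst sum.UNION_disjoint) (use assms in \<open>auto simp: sum.reindex\<close>)

lemma sum_permutations_eq_Nop:
  assumes "finite T" "length xs = card T"
  shows "(\<Sum>us\<in>permutations_of_set T. foldr (\<lambda>(u, x). eh u x) (zip us xs) z) = Nop T xs z"
  using assms
proof (induction xs arbitrary: T)
  case Nil
  thus ?case by simp
next
  case (Cons x xs)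
  have "T \<noteq> {}" using Cons.prems(2) by (cases "T = {}") simp_all
  have "(\<Sum>us\<in>permutations_of_set T. foldr (\<lambda>(u, x). eh u x) (zip us (x # xs)) z)
      = (\<Sum>t\<in>T. eh t x (\<Sum>vs\<in>permutations_of_set (T - {t}). foldr (\<lambda>(u, x). eh u x) (zip vs xs) z))"
    by (simp add: sum_permutations_of_set[OF Cons.prems(1) \<open>T \<noteq> {}\<close>] eh_sum)
  also have "\<dots> = Nop T (x # xs) z"
    using Cons by simp
  finally show ?case .
qed

section \<open>Multilinear monomials\<close>

text \<open>The exponents of the product of the variables \<open>Xv t (I t)\<close> over the rows of
  \<open>T\<close>, which stands for the basis tensor of \<open>M\<close> with indices
  \<open>I\<close>.\<close>

definition mI :: "idx set \<Rightarrow> (idx \<Rightarrow> idx) \<Rightarrow> mono" where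
  "mI T I = (\<lambda>(b, q, k). if \<not> b \<and> q \<in> T \<and> k = I q then 1 else 0)"

lemma mI_apply: "mI T I (b, q, k) = (if \<not> b \<and> q \<in> T \<and> k = I q then 1 else 0)"
  by (simp add: mI_def)

lemma mI_cong: "(\<And>t. t \<in> T \<Longrightarrow> I t = J t) \<Longrightarrow> mI T I = mI T J"
  by (auto simp: mI_def fun_eq_iff)

lemma mI_eq_iff: "mI T I = mI T J \<longleftrightarrow> (\<forall>t\<in>T. I t = J t)"
proof
  assume e: "mI T I = mI T J"
  show "\<forall>t\<in>T. I t = J t"
  proof
    fix t assume "t \<in> T"
    thus "I t = J t" using fun_cong[OF e, of "Xv t (I t)"] by (simp add: mI_apply split: if_splits)
  qed
qed (rule mI_cong, blast)

lemma mI_split: "t \<in> T \<Longrightarrow> mI T I = sng (Xv t (I t)) + mI (T - {t}) I"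
proof
  fix v assume "t \<in> T"
  thus "mI T I v = (sng (Xv t (I t)) + mI (T - {t}) I) v"
    by (cases v) (simp add: mI_apply sng_def plus_fun_apply)
qed

lemma is_mono_mI: "finite T \<Longrightarrow> is_mono (mI T I)"
proof -
  assume "finite T"
  have "{v. mI T I v \<noteq> 0} \<subseteq> (\<lambda>t. Xv t (I t)) ` T" by (auto simp: mI_apply split: if_splits)
  hence "finite {v. mI T I v \<noteq> 0}" using \<open>finite T\<close> finite_subset by blast
  moreover have "mI T I v \<le> 1" for v by (cases v) (simp add: mI_apply)
  ultimately show ?thesis by (simp add: is_mono_def)
qed

lemma rdeg_mI: "finite T \<Longrightarrow> rdeg t (mI T I) = (if t \<in> T then 1 else 0)"
proof -
  assume T: "finite T"
  have 0: "rdeg t (mI S I) = 0" if "t \<notin> S" for S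
    unfolding rdeg_def wt_def
    by (rule sum.neutral) (use that in \<open>auto simp: mI_apply split: if_splits\<close>)
  show ?thesis
  proof (cases "t \<in> T")
    case True
    show ?thesis unfolding mI_split[OF True]
      using True T by (simp add: rdeg_plus is_mono_mI rdeg_sng 0)
  qed (simp add: 0)
qed

lemma eh_mI:
  assumes "finite T" "t \<in> T"
  shows "\<exists>\<zeta>. pm1 \<zeta> \<and> eh t x (mon (mI T K)) =
    (if K t = snd x then scl \<zeta> (mon (mI T (K(t := fst x)))) else 0)"
proof -
  let ?B = "mI (T - {t}) K"
  have b: "is_mono ?B" "rdeg t ?B = 0" using assms by (simp_all add: is_mono_mI rdeg_mI)
  obtain \<zeta> where z: "pm1 \<zeta>" "var (Xv t (K t)) * mon ?B = scl \<zeta> (mon (mI T K))"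
    using var_times_mon_pm[of "Xv t (K t)" ?B] unfolding mI_split[OF assms(2), of K, symmetric] by blast
  hence m: "mon (mI T K) = scl \<zeta> (var (Xv t (K t)) * mon ?B)" by simp
  have s: "mI T (K(t := fst x)) = sng (Xv t (fst x)) + ?B"
    unfolding mI_split[OF assms(2), of "K(t := fst x)"]
    by (simp, rule mI_cong) simp
  obtain \<xi> where x: "pm1 \<xi>" "var (Xv t (fst x)) * mon ?B = scl \<xi> (mon (mI T (K(t := fst x))))"
    using var_times_mon_pm[of "Xv t (fst x)" ?B] unfolding s[symmetric] by blast
  obtain \<eta> where e: "pm1 \<eta>" "gam (odd_unit x) (mon (mI T (K(t := fst x)))) = scl \<eta> (mon (mI T (K(t := fst x))))"
    using gam_mon by blast
  show ?thesis
    by (rule exI[of _ "\<zeta> * \<xi> * \<eta>"])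
      (use z(1) x e in \<open>auto simp: eh_def m loc_simps(8) loc_row_times[OF b] gam_scl pm1_mult\<close>)
qed

lemma foldr_eh_mI:
  assumes "finite T" "distinct ts" "set ts \<subseteq> T"
  shows "\<exists>\<zeta>. pm1 \<zeta> \<and> foldr (\<lambda>t. eh t (I' t, I t)) ts (mon (mI T K)) =
    (if \<forall>t\<in>set ts. K t = I t then scl \<zeta> (mon (mI T (override_on K I' (set ts)))) else 0)"
  using assms(2,3)
proof (induction ts)
  case Nil
  show ?case by (intro exI[of _ 1]) simp
next
  case (Cons t ts)
  then obtain \<zeta> where z: "pm1 \<zeta>" "foldr (\<lambda>t. eh t (I' t, I t)) ts (mon (mI T K)) =
    (if \<forall>t\<in>set ts. K t = I t then scl \<zeta> (mon (mI T (override_on K I' (set ts)))) else 0)" by auto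
  let ?K = "override_on K I' (set ts)"
  have t: "t \<in> T" "?K t = K t" using Cons.prems by (auto simp: override_on_def)
  obtain \<xi> where x: "pm1 \<xi>" "eh t (I' t, I t) (mon (mI T ?K)) =
      (if K t = I t then scl \<xi> (mon (mI T (?K(t := I' t)))) else 0)"
    using eh_mI[OF assms(1) t(1), of "(I' t, I t)" ?K] t(2) by auto
  have "?K(t := I' t) = override_on K I' (set (t # ts))" by (auto simp: override_on_def)
  thus ?case by (intro exI[of _ "\<zeta> * \<xi>"]) (use z x in \<open>auto simp: eh_scl eh_0 pm1_mult\<close>)
qed

text \<open>One matrix unit on every row makes a matrix unit of End(M), up to sign. The sign does
  not depend on \<open>K\<close> because only one basis monomial survives.\<close>

lemma foldr_eh_unit:
  assumes "finite T" "distinct ts" "set ts = T"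
  shows "\<exists>\<zeta>. pm1 \<zeta> \<and> (\<forall>K. foldr (\<lambda>t. eh t (I' t, I t)) ts (mon (mI T K)) =
    (if mI T K = mI T I then scl \<zeta> (mon (mI T I')) else 0))"
proof -
  have o: "mI T (override_on K I' T) = mI T I'" for K
    by (rule mI_cong) (simp add: override_on_def)
  obtain \<zeta> where z: "pm1 \<zeta>" "foldr (\<lambda>t. eh t (I' t, I t)) ts (mon (mI T I)) = scl \<zeta> (mon (mI T I'))"
    using foldr_eh_mI[OF assms(1,2), of I' I I] assms(3) o by auto
  have "foldr (\<lambda>t. eh t (I' t, I t)) ts (mon (mI T K)) =
    (if mI T K = mI T I then scl \<zeta> (mon (mI T I')) else 0)" for K
  proof (cases "mI T K = mI T I")
    case True
    thus ?thesis using z(2) by simp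
  next
    case False
    thus ?thesis using foldr_eh_mI[OF assms(1,2), of I' I K] assms(3) by (auto simp: mI_eq_iff)
  qed
  thus ?thesis using z(1) by blast
qed

section \<open>Permuting the rows\<close>

definition rv :: "(idx \<Rightarrow> idx) \<Rightarrow> var \<Rightarrow> var" where
  "rv g = (\<lambda>(b, q, k). if b then (b, q, k) else (b, g q, k))"

lemma rv_simps [simp]: "rv g (Xv q k) = Xv (g q) k" "rv g (Yv q k) = Yv q k"
  by (simp_all add: rv_def)

definition ren :: "(idx \<Rightarrow> idx) \<Rightarrow> salg \<Rightarrow> salg" where
  "ren g = Sub (\<lambda>_. 1) (rv g)"

text \<open>The inverse is carried along because averaging conjugates by row permutations;
  preserving the parity of rows makes the renaming of variables a homomorphism.\<close>

locale row_perm =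
  fixes g g' :: "idx \<Rightarrow> idx" and T :: "idx set"
  assumes gg': "g (g' t) = t" and g'g: "g' (g t) = t" and par: "fst (g t) = fst t"
    and gT: "t \<in> T \<Longrightarrow> g t \<in> T" and g'T: "t \<in> T \<Longrightarrow> g' t \<in> T"
begin

lemma vpar_rv: "vpar (rv g v) = vpar v"
  by (cases v) (simp add: rv_def par)

lemma shift: "par_shift False (\<lambda>_. 1) (rv g)"
  by (simp add: par_shift_def vpar_rv)

lemmas ren_mult = Sub_mult[OF shift, folded ren_def] and ren_1 = Sub_1[OF shift, folded ren_def]
  and lin_ren = lin_Sub[OF shift, folded ren_def]

lemmas ren_add = svp.linear_add[OF lin_ren] and ren_scl = svp.linear_scale[OF lin_ren]
  and ren_sum = svp.linear_sum[OF lin_ren]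

lemma ren_var: "ren g (var v) = var (rv g v)"
  by (simp add: ren_def Sub_var[OF shift])

lemma ren_gam: "ren g (gam d x) = gam d (ren g x)"
  by (induction x rule: salg_induct)
    (simp_all add: ren_1 gam_mult gam_var ren_mult ren_var ren_add gam_add ren_scl gam_scl vpar_rv
      scl_mult_left)

lemma rv_eq_iff: "rv g v = Xv (g t) k \<longleftrightarrow> v = Xv t k"
  by (cases v) (auto simp: rv_def dest: arg_cong[of _ _ g'] simp: g'g)

lemma ren_loc: "ren g (loc t x z) = loc (g t) x (ren g z)"
proof (induction z rule: salg_induct)
  case (var v z)
  show ?case
    by (simp add: loc_simps(2) loc_var ren_add ren_mult ren_var gam_var var rv_eq_iff vpar_rv ren_scl scl_mult_left
        svp.linear_0[OF lin_ren])
qed (simp_all add: loc_simps ren_1 ren_add ren_scl svp.linear_0[OF lin_ren])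

lemma ren_eh: "ren g (eh t x z) = eh (g t) x (ren g z)"
  by (simp add: eh_def ren_gam ren_loc)

lemma ren_Z: "ren g (Z R r s) = Z R (g r) s"
  by (simp add: Z_def ren_sum ren_mult ren_var)

lemma ren_mon_Y:
  assumes "\<forall>v\<in>set ys. fst v"
  shows "ren g (mon (cnt ys)) = mon (cnt ys)"
proof -
  have "ren g (wprod ys) = wprod ys"
    using assms
  proof (induction ys)
    case (Cons v ys)
    thus ?case by (cases v) (simp add: ren_mult ren_var)
  qed (simp add: ren_1)
  moreover obtain \<zeta> where "pm1 \<zeta>" "wprod ys = scl \<zeta> (mon (cnt ys))"
    using wprod_eq_mon by blast
  ultimately show ?thesis by (simp add: ren_scl)
qed

lemma ren_mon_mI:
  assumes "finite T"
  shows "\<exists>\<zeta>. pm1 \<zeta> \<and> ren g (mon (mI T I)) = scl \<zeta> (mon (mI T (\<lambda>t. I (g' t))))"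
proof -
  obtain vs where vs: "cnt vs = mI T I" "mon (mI T I) = wprod vs"
    using mon_eq_wprod[OF is_mono_mI[OF assms]] by blast
  have w: "ren g (wprod vs) = wprod (map (rv g) vs)" for vs
    by (induction vs) (simp_all add: ren_1 ren_mult ren_var)
  have inj: "rv g v = rv g w \<longleftrightarrow> v = w" for v w
    by (cases v; cases w) (auto simp: rv_def dest: arg_cong[of _ _ g'] simp: g'g)
  have c: "cnt (map (rv g) vs) (rv g v) = cnt vs v" for vs v
    by (induction vs) (auto simp: cnt_def inj)
  have "cnt (map (rv g) vs) = mI T (\<lambda>t. I (g' t))"
  proof
    fix v :: var
    obtain b q k where v: "v = (b, q, k)" by (cases v)
    have "v = rv g (rv g' v)" by (simp add: v rv_def gg')
    hence "cnt (map (rv g) vs) v = mI T I (rv g' v)" using c[of vs "rv g' v"] vs(1) by simp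
    also have "\<dots> = mI T (\<lambda>t. I (g' t)) v"
      using gT[of "g' q"] g'T[of q] by (auto simp: v rv_def mI_apply gg')
    finally show "cnt (map (rv g) vs) v = mI T (\<lambda>t. I (g' t)) v" .
  qed
  thus ?thesis using wprod_eq_mon[of "map (rv g) vs"] w[of vs] vs(2) by simp
qed

end

lemma (in row_perm) ren_inverse:
  assumes "row_perm g' g T"
  shows "ren g (ren g' x) = x"
proof -
  interpret i: row_perm g' g T by fact
  have "rv g (rv g' v) = v" for v by (cases v) (simp add: rv_def gg')
  thus ?thesis
    by (induction x rule: salg_induct)
      (simp_all add: ren_1 i.ren_1 ren_add i.ren_add ren_scl i.ren_scl ren_mult i.ren_mult ren_var i.ren_var)
qed

lemma (in row_perm) inverse: "row_perm g' g T"
proof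
  fix t
  show "g' (g t) = t" "g (g' t) = t" by (rule g'g, rule gg')
  show "t \<in> T \<Longrightarrow> g' t \<in> T" "t \<in> T \<Longrightarrow> g t \<in> T" by (erule g'T, erule gT)
  show "fst (g' t) = fst t" using par[of "g' t"] unfolding gg' by (rule sym)
qed

lemma row_perm_exists:
  assumes "distinct ts" "us \<in> permutations_of_set (set ts)" "\<forall>t\<in>set ts. \<not> fst t"
  shows "\<exists>g g'. row_perm g g' (set ts) \<and> map g ts = us"
proof -
  have us: "set us = set ts" "distinct us" using assms(2) by (auto dest: permutations_of_setD)
  have len: "length us = length ts" using us assms(1) by (metis distinct_card)
  define g where "g t = (if t \<in> set ts then the (map_of (zip ts us) t) else t)" for t
  have m: "map g ts = us"
    by (rule nth_equalityI) (simp_all add: len g_def map_of_zip_nth assms(1))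
  have "bij_betw g (set ts) (set ts)"
    unfolding bij_betw_def
  proof
    show "inj_on g (set ts)" using m us(2) by (metis distinct_map)
    show "g ` set ts = set ts" using m us(1) by (metis set_map)
  qed
  hence p: "g permutes set ts" by (rule bij_imp_permutes) (simp add: g_def)
  have "row_perm g (inv g) (set ts)"
  proof
    fix t
    show "g (inv g t) = t" "inv g (g t) = t" using permutes_inverses[OF p] by auto
    show gT: "t \<in> set ts \<Longrightarrow> g t \<in> set ts" using permutes_in_image[OF p] by blast
    show "t \<in> set ts \<Longrightarrow> inv g t \<in> set ts" using permutes_in_image[OF permutes_inv[OF p]] by blast
    show "fst (g t) = fst t"
      using gT assms(3) by (cases "t \<in> set ts") (auto simp: g_def)
  qed
  thus ?thesis using m by blast
qed

section \<open>Invariants that are linear in each row\<close>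

locale multilinear =
  fixes ts :: "idx list" and R S :: "idx set"
  assumes fin: "finite R" "finite S" and dist: "distinct ts" and ev: "\<forall>t\<in>set ts. \<not> fst t"
begin

abbreviation T where "T \<equiv> set ts"

text \<open>\<open>MM\<close> and \<open>NN\<close> are the monomial bases of the two factors: products of one \<open>X\<close>-variable per row, and
  products of as many \<open>Y\<close>-variables as there are rows.  Their products \<open>HH\<close> are sorted, so no signs occur.\<close>

definition MI :: "(idx \<Rightarrow> idx) set" where "MI = PiE T (\<lambda>_. R)"

definition MM :: "mono set" where "MM = mI T ` MI"

definition YV :: "var set" where "YV = {Yv i s | i s. i \<in> R \<and> s \<in> S}"

definition NN :: "mono set" where
  "NN = {cnt ys | ys. set ys \<subseteq> YV \<and> length ys = length ts \<and> is_mono (cnt ys)}"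

definition HH :: "mono set" where "HH = {\<alpha> + \<beta> | \<alpha> \<beta>. \<alpha> \<in> MM \<and> \<beta> \<in> NN}"

lemma finite_MI: "finite MI"
  unfolding MI_def by (rule finite_PiE) (simp_all add: fin)

lemma finite_MM: "finite MM"
  unfolding MM_def by (simp add: finite_MI)

lemma finite_NN: "finite NN"
proof -
  have "YV = (\<lambda>(i, s). Yv i s) ` (R \<times> S)" unfolding YV_def by auto
  hence "finite YV" by (simp add: fin)
  moreover have "NN \<subseteq> cnt ` {ys. set ys \<subseteq> YV \<and> length ys = length ts}" unfolding NN_def by blast
  ultimately show ?thesis using finite_lists_length_eq finite_subset by blast
qed

lemma MM_mono: "\<alpha> \<in> MM \<Longrightarrow> is_mono \<alpha>"
  unfolding MM_def by (auto simp: is_mono_mI)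

lemma NN_mono: "\<beta> \<in> NN \<Longrightarrow> is_mono \<beta>"
  unfolding NN_def by blast

lemma MM_Y: "\<alpha> \<in> MM \<Longrightarrow> \<alpha> (Yv i s) = 0"
  unfolding MM_def by (auto simp: mI_apply)

lemma NN_X: "\<beta> \<in> NN \<Longrightarrow> \<beta> (Xv r i) = 0"
proof -
  assume "\<beta> \<in> NN"
  then obtain ys where ys: "\<beta> = cnt ys" "set ys \<subseteq> YV" unfolding NN_def by blast
  have "Xv r i \<notin> set ys" using ys(2) unfolding YV_def by auto
  thus ?thesis unfolding ys(1) cnt_eq_0_iff .
qed

lemma inj_mI: "inj_on (mI T) MI"
proof (rule inj_onI)
  fix I J assume "I \<in> MI" "J \<in> MI" "mI T I = mI T J"
  thus "I = J" unfolding MI_def mI_eq_iff by (intro PiE_ext[of I T "\<lambda>_. R" J]) auto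
qed

lemma MM_NN_eq:
  assumes "\<alpha> \<in> MM" "\<alpha>' \<in> MM" "\<beta> \<in> NN" "\<beta>' \<in> NN"
  shows "\<alpha> + \<beta> = \<alpha>' + \<beta>' \<longleftrightarrow> \<alpha> = \<alpha>' \<and> \<beta> = \<beta>'"
proof
  assume e: "\<alpha> + \<beta> = \<alpha>' + \<beta>'"
  have "\<alpha> v = \<alpha>' v \<and> \<beta> v = \<beta>' v" for v
  proof -
    obtain b q k where v: "v = (b, q, k)" by (cases v)
    show ?thesis using fun_cong[OF e, of v] assms
      by (cases b) (simp_all add: v plus_fun_apply MM_Y NN_X)
  qed
  thus "\<alpha> = \<alpha>' \<and> \<beta> = \<beta>'" by blast
qed simp

text \<open>Since \<open>False < True\<close>, the lexicographic order puts every X-variable before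
  every Y-variable, and the two odd supports have no inversion.\<close>

lemma mon_MM_NN:
  assumes "\<alpha> \<in> MM" "\<beta> \<in> NN"
  shows "mon \<alpha> * mon \<beta> = mon (\<alpha> + \<beta>)" "is_mono (\<alpha> + \<beta>)"
proof -
  have X: "\<alpha> v \<noteq> 0 \<Longrightarrow> \<not> fst v" for v
    using MM_Y[OF assms(1), of "fst (snd v)" "snd (snd v)"] by (cases v; cases "fst v") auto
  have Y: "\<beta> v \<noteq> 0 \<Longrightarrow> fst v" for v
    using NN_X[OF assms(2), of "fst (snd v)" "snd (snd v)"] by (cases v; cases "fst v") auto
  have "odd_supp \<alpha> \<subseteq> {v. \<not> fst v}" "odd_supp \<beta> \<subseteq> {v. fst v}"
    unfolding odd_supp_def using X Y by blast+
  moreover from this have "inversions (odd_supp \<alpha>) (odd_supp \<beta>) = {}"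
    by (auto simp: inversions_def less_prod_def' subset_iff)
  ultimately have "odd_supp \<alpha> \<inter> odd_supp \<beta> = {}" "inversions (odd_supp \<alpha>) (odd_supp \<beta>) = {}" by auto
  hence "msign \<alpha> \<beta> = 1" by (simp add: msign_alt)
  thus "mon \<alpha> * mon \<beta> = mon (\<alpha> + \<beta>)" "is_mono (\<alpha> + \<beta>)"
    using mon_times_mon[OF MM_mono[OF assms(1)] NN_mono[OF assms(2)]]
      is_mono_plus[OF MM_mono[OF assms(1)] NN_mono[OF assms(2)]] by simp_all
qed

text \<open>The coefficient in \<open>M\<close> of the basis monomial \<open>\<beta>\<close> of
  \<open>N\<close>, when \<open>h\<close> is regarded as an element of the tensor product of
  \<open>M\<close> and \<open>N\<close>.\<close>

definition slice :: "mono \<Rightarrow> salg \<Rightarrow> salg" where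
  "slice \<beta> h = (\<Sum>\<alpha>\<in>MM. scl (cf h (\<alpha> + \<beta>)) (mon \<alpha>))"

lemma lin_slice: "lin (slice \<beta>)"
  unfolding slice_def by (rule linI) (simp_all add: sv.scale_left_distrib sum.distrib sv.scale_sum_right)

lemma slice_Sp: "slice \<beta> h \<in> Sp MM"
  unfolding slice_def by (intro Sp_sum Sp_scl mon_in_Sp)

lemma cf_slice: "\<alpha> \<in> MM \<Longrightarrow> cf (slice \<beta> h) \<alpha> = cf h (\<alpha> + \<beta>)"
proof -
  assume a: "\<alpha> \<in> MM"
  have "cf (slice \<beta> h) \<alpha> = (\<Sum>\<alpha>'\<in>MM. if \<alpha>' = \<alpha> then cf h (\<alpha> + \<beta>) else 0)"
    unfolding slice_def cf_sum by (intro sum.cong refl) (auto simp: cf_mon MM_mono)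
  thus ?thesis using a finite_MM by simp
qed

lemma cf_times_NN:
  assumes "a \<in> Sp MM" "\<alpha> \<in> MM" "\<beta> \<in> NN" "\<beta>' \<in> NN"
  shows "cf (a * mon \<beta>') (\<alpha> + \<beta>) = (if \<beta> = \<beta>' then cf a \<alpha> else 0)"
proof -
  have "a = (\<Sum>\<alpha>'\<in>MM. scl (cf a \<alpha>') (mon \<alpha>'))"
    by (rule salg_expand[OF finite_MM]) (use assms(1) in \<open>simp add: Sp_def\<close>)
  hence "cf (a * mon \<beta>') (\<alpha> + \<beta>) = cf ((\<Sum>\<alpha>'\<in>MM. scl (cf a \<alpha>') (mon \<alpha>')) * mon \<beta>') (\<alpha> + \<beta>)" by simp
  also have "\<dots> = (\<Sum>\<alpha>'\<in>MM. cf (scl (cf a \<alpha>') (mon \<alpha>' * mon \<beta>')) (\<alpha> + \<beta>))"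
    unfolding sum_distrib_right cf_sum scl_mult_left ..
  also have "\<dots> = (\<Sum>\<alpha>'\<in>MM. if \<alpha>' = \<alpha> then (if \<beta> = \<beta>' then cf a \<alpha> else 0) else 0)"
    by (intro sum.cong refl) (auto simp: mon_MM_NN assms cf_mon MM_NN_eq)
  also have "\<dots> = (if \<beta> = \<beta>' then cf a \<alpha> else 0)" using assms(2) finite_MM by simp
  finally show ?thesis .
qed

lemma Sp_times_NN: "a \<in> Sp MM \<Longrightarrow> \<beta> \<in> NN \<Longrightarrow> a * mon \<beta> \<in> Sp HH"
proof -
  assume a: "a \<in> Sp MM" and b: "\<beta> \<in> NN"
  have l: "lin (\<lambda>a. a * mon \<beta>)" by (rule linI) (simp_all add: distrib_right scl_mult_left)
  show ?thesis
    by (rule lin_Sp[OF l a]) (use b in \<open>auto simp: mon_MM_NN HH_def intro!: mon_in_Sp\<close>)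
qed

lemma slice_sum:
  assumes "\<And>\<beta>. \<beta> \<in> NN \<Longrightarrow> a \<beta> \<in> Sp MM" "\<beta> \<in> NN"
  shows "slice \<beta> (\<Sum>\<beta>'\<in>NN. a \<beta>' * mon \<beta>') = a \<beta>"
proof (rule salg_eqI)
  fix \<alpha>
  show "cf (slice \<beta> (\<Sum>\<beta>'\<in>NN. a \<beta>' * mon \<beta>')) \<alpha> = cf (a \<beta>) \<alpha>"
  proof (cases "\<alpha> \<in> MM")
    case True
    have "cf (slice \<beta> (\<Sum>\<beta>'\<in>NN. a \<beta>' * mon \<beta>')) \<alpha> = (\<Sum>\<beta>'\<in>NN. if \<beta>' = \<beta> then cf (a \<beta>) \<alpha> else 0)"
      unfolding cf_slice[OF True] cf_sum
      by (intro sum.cong refl) (auto simp: cf_times_NN[OF assms(1)] True assms(2))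
    thus ?thesis using assms(2) finite_NN by simp
  next
    case False
    have "cf (slice \<beta> x) \<alpha> = 0" for x using slice_Sp[of \<beta> x] False unfolding Sp_iff by blast
    moreover have "cf (a \<beta>) \<alpha> = 0" using assms(1)[OF assms(2)] False unfolding Sp_iff by blast
    ultimately show ?thesis by simp
  qed
qed

lemma slice_decomp:
  assumes "h \<in> Sp HH"
  shows "h = (\<Sum>\<beta>\<in>NN. slice \<beta> h * mon \<beta>)"
proof (rule salg_eqI)
  fix \<gamma>
  show "cf h \<gamma> = cf (\<Sum>\<beta>\<in>NN. slice \<beta> h * mon \<beta>) \<gamma>"
  proof (cases "\<gamma> \<in> HH")
    case True
    then obtain \<alpha> \<beta> where g: "\<gamma> = \<alpha> + \<beta>" "\<alpha> \<in> MM" "\<beta> \<in> NN" unfolding HH_def by blast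
    have "cf (\<Sum>\<beta>'\<in>NN. slice \<beta>' h * mon \<beta>') \<gamma> = (\<Sum>\<beta>'\<in>NN. if \<beta>' = \<beta> then cf h \<gamma> else 0)"
      unfolding cf_sum g(1) by (intro sum.cong refl) (auto simp: cf_times_NN[OF slice_Sp] g(2,3) cf_slice)
    thus ?thesis using g(3) finite_NN by simp
  next
    case False
    moreover have "(\<Sum>\<beta>\<in>NN. slice \<beta> h * mon \<beta>) \<in> Sp HH"
      by (intro Sp_sum Sp_times_NN slice_Sp)
    ultimately show ?thesis using assms unfolding Sp_iff by metis
  qed
qed

lemma eh_MM:
  assumes "m \<in> Sp MM" "t \<in> T" "fst x \<in> R"
  shows "eh t x m \<in> Sp MM"
proof (rule lin_Sp[OF lin_eh assms(1)])
  fix \<alpha> assume "\<alpha> \<in> MM"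
  then obtain K where K: "K \<in> MI" "\<alpha> = mI T K" unfolding MM_def by blast
  have "K(t := fst x) \<in> MI" using K(1) assms(2,3) unfolding MI_def by (auto simp: PiE_iff extensional_def)
  hence "mon (mI T (K(t := fst x))) \<in> Sp MM" unfolding MM_def by (intro mon_in_Sp) blast
  thus "eh t x (mon \<alpha>) \<in> Sp MM"
    using eh_mI[of T t x K] assms(2) unfolding K(2) by (auto intro!: Sp_scl)
qed

lemma loc_eq_gam_eh: "loc t x m = gam (odd_unit x) (eh t x m)"
  by (simp add: eh_def)

lemma loc_MM: "m \<in> Sp MM \<Longrightarrow> t \<in> T \<Longrightarrow> fst x \<in> R \<Longrightarrow> loc t x m \<in> Sp MM"
  unfolding loc_eq_gam_eh by (intro gam_Sp eh_MM)

lemma superderiv_wprod_0: "superderiv d D \<Longrightarrow> (\<forall>v\<in>set vs. D (var v) = 0) \<Longrightarrow> D (wprod vs) = 0"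
  by (induction vs) (simp_all add: superderivD)

lemma EV_MM:
  assumes "m \<in> Sp MM"
  shows "EV i j m = (\<Sum>t\<in>T. loc t (i, j) m)"
proof -
  have d: "odd_unit (i, j) = (fst i \<noteq> fst j)" by (simp add: odd_unit_def)
  have s: "superderiv (fst i \<noteq> fst j) (\<lambda>x. \<Sum>t\<in>T. loc t (i, j) x)"
    using superderiv_loc[of "(i, j)"] unfolding d by (intro superderiv_sum)
  have D: "superderiv (fst i \<noteq> fst j) (\<lambda>x. EV i j x - (\<Sum>t\<in>T. loc t (i, j) x))"
    by (rule superderiv_diff[OF superderiv_EV s])
  have "EV i j m - (\<Sum>t\<in>T. loc t (i, j) m) = 0"
  proof (rule lin_eq_on[OF superderivD(1)[OF D] lin_zero assms])
    fix \<alpha> assume "\<alpha> \<in> MM"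
    then obtain K where K: "\<alpha> = mI T K" unfolding MM_def by blast
    obtain vs where vs: "cnt vs = \<alpha>" "mon \<alpha> = wprod vs"
      using mon_eq_wprod[OF MM_mono[OF \<open>\<alpha> \<in> MM\<close>]] by blast
    have "EV i j (var v) - (\<Sum>t\<in>T. loc t (i, j) (var v)) = 0" if "v \<in> set vs" for v
    proof -
      have "mI T K v \<noteq> 0" using that cnt_eq_0_iff[of vs v] unfolding vs(1) K by simp
      then obtain t k where v: "v = Xv t k" "t \<in> T" by (cases v) (auto simp: mI_apply split: if_splits)
      have "(\<Sum>u\<in>T. loc u (i, j) (var v)) = (\<Sum>u\<in>T. if u = t then (if k = j then var (Xv t i) else 0) else 0)"
        by (intro sum.cong) (auto simp: v loc_var)
      thus ?thesis using v ev by (simp add: EV_var_X)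
    qed
    thus "EV i j (mon \<alpha>) - (\<Sum>t\<in>T. loc t (i, j) (mon \<alpha>)) = 0"
      unfolding vs(2) by (intro superderiv_wprod_0[OF D] ballI)
  qed
  thus ?thesis by simp
qed

lemma EV_NN:
  assumes "\<beta> \<in> NN" "j \<in> R"
  shows "EV i j (mon \<beta>) \<in> Sp NN"
proof -
  obtain ys where ys: "\<beta> = cnt ys" "set ys \<subseteq> YV" "length ys = length ts" using assms(1) unfolding NN_def by blast
  have "\<gamma> \<in> NN" if g: "\<gamma> \<in> supp (EV i j (mon \<beta>))" for \<gamma>
  proof -
    obtain v where v: "\<beta> v \<noteq> 0" "EV_coef i j v \<noteq> 0" "\<gamma> + sng v = \<beta> + sng (EV_var i j v)"
      using Der_mon_Sp[OF EV_shift NN_mono[OF assms(1)], of i j] g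
      unfolding EV_def Sp_def by blast
    have "v \<in> set ys" using v(1) unfolding ys(1) cnt_eq_0_iff by simp
    then obtain as bs where ab: "ys = as @ v # bs" by (meson split_list)
    obtain q s where q: "v = Yv q s" "s \<in> S" using ys(2) \<open>v \<in> set ys\<close> unfolding YV_def by blast
    let ?zs = "as @ Yv j s # bs"
    have "\<gamma> + sng v = cnt ?zs + sng v"
      using v(3) unfolding ys(1) ab by (simp add: q(1) EV_var_def add_ac)
    hence c: "\<gamma> = cnt ?zs" by simp
    have "set ?zs \<subseteq> YV" using ys(2) assms(2) q(2) unfolding ab YV_def by auto
    moreover have "length ?zs = length ts" using ys(3) unfolding ab by simp
    moreover have "is_mono (cnt ?zs)" using supp_is_mono[OF g] unfolding c .
    ultimately show ?thesis unfolding NN_def c by blast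
  qed
  thus ?thesis unfolding Sp_def by blast
qed

definition is_inv :: "salg \<Rightarrow> bool" where
  "is_inv f \<longleftrightarrow> f \<in> Sp HH \<and> (\<forall>i\<in>R. \<forall>j\<in>R. EV i j f = 0)"

text \<open>Invariance of \<open>f\<close>, written out by the Leibniz rule on the sum of the
  \<open>slice \<beta> f * mon \<beta>\<close>, equates the action on the slices with minus the
  action on \<open>N\<close>. The point is that the right side combines slices with scalars that do
  not depend on \<open>f\<close>.\<close>

lemma eh_slice:
  assumes f: "is_inv f" and x: "fst x \<in> R" "snd x \<in> R" and b: "\<beta>' \<in> NN"
  shows "(\<Sum>t\<in>T. eh t x (slice \<beta>' f)) =
    (\<Sum>\<beta>\<in>NN. scl (- cf (EV (fst x) (snd x) (mon \<beta>)) \<beta>') (slice \<beta> f))"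
proof -
  obtain i j where ij: "x = (i, j)" by (cases x)
  have i: "i \<in> R" "j \<in> R" using x by (simp_all add: ij)
  let ?d = "fst i \<noteq> fst j"
  let ?q = "\<lambda>\<beta>' \<beta>. cf (EV i j (mon \<beta>)) \<beta>'"
  let ?a = "\<lambda>\<beta>'. EV i j (slice \<beta>' f) + (\<Sum>\<beta>\<in>NN. scl (?q \<beta>' \<beta>) (gam ?d (slice \<beta> f)))"
  have fH: "f \<in> Sp HH" using f by (simp add: is_inv_def)
  have exp: "EV i j (mon \<beta>) = (\<Sum>\<beta>'\<in>NN. scl (?q \<beta>' \<beta>) (mon \<beta>'))" if "\<beta> \<in> NN" for \<beta>
    by (rule salg_expand[OF finite_NN]) (use EV_NN[OF that i(2)] in \<open>simp add: Sp_def\<close>)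
  have "0 = EV i j f" using f i by (simp add: is_inv_def)
  also have "\<dots> = EV i j (\<Sum>\<beta>\<in>NN. slice \<beta> f * mon \<beta>)" using slice_decomp[OF fH] by simp
  also have "\<dots> = (\<Sum>\<beta>\<in>NN. EV i j (slice \<beta> f) * mon \<beta>) + (\<Sum>\<beta>\<in>NN. gam ?d (slice \<beta> f) * EV i j (mon \<beta>))"
    unfolding EV_simps(9) EV_simps(2) sum.distrib ..
  also have "(\<Sum>\<beta>\<in>NN. gam ?d (slice \<beta> f) * EV i j (mon \<beta>))
      = (\<Sum>\<beta>\<in>NN. \<Sum>\<beta>'\<in>NN. scl (?q \<beta>' \<beta>) (gam ?d (slice \<beta> f)) * mon \<beta>')"
    by (intro sum.cong refl) (subst exp, simp_all add: sum_distrib_left scl_mult_left scl_mult_right)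
  also have "\<dots> = (\<Sum>\<beta>'\<in>NN. (\<Sum>\<beta>\<in>NN. scl (?q \<beta>' \<beta>) (gam ?d (slice \<beta> f))) * mon \<beta>')"
    unfolding sum_distrib_right by (rule sum.swap)
  finally have z: "0 = (\<Sum>\<beta>'\<in>NN. ?a \<beta>' * mon \<beta>')" by (simp add: sum.distrib distrib_right)
  have aM: "?a \<beta>' \<in> Sp MM" for \<beta>'
    using i(1) by (intro Sp_add Sp_sum Sp_scl gam_Sp slice_Sp) (auto simp: EV_MM[OF slice_Sp] intro!: Sp_sum loc_MM slice_Sp)
  have "?a \<beta>' = 0"
    using slice_sum[of ?a, OF aM b] z[symmetric] svp.linear_0[OF lin_slice] by simp
  hence "EV i j (slice \<beta>' f) = (\<Sum>\<beta>\<in>NN. scl (- ?q \<beta>' \<beta>) (gam ?d (slice \<beta> f)))"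
    by (simp add: eq_neg_iff_add_eq_0 sum_negf)
  hence "(\<Sum>t\<in>T. loc t x (slice \<beta>' f)) = (\<Sum>\<beta>\<in>NN. scl (- ?q \<beta>' \<beta>) (gam ?d (slice \<beta> f)))"
    unfolding EV_MM[OF slice_Sp] ij .
  \<comment> \<open>One more parity automorphism cancels the one on the slices on the right and
    turns \<open>loc\<close> into \<open>eh\<close> on the left.\<close>
  hence "gam ?d (\<Sum>t\<in>T. loc t x (slice \<beta>' f)) = gam ?d (\<Sum>\<beta>\<in>NN. scl (- ?q \<beta>' \<beta>) (gam ?d (slice \<beta> f)))" by simp
  moreover have "odd_unit x = ?d" by (simp add: ij odd_unit_def)
  ultimately show ?thesis by (simp add: gam_sum gam_scl svp.linear_neg[OF lin_gam] eh_def ij)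
qed

lemma MM_row: "m \<in> Sp MM \<Longrightarrow> t \<in> T \<Longrightarrow> m \<in> Sp {\<alpha>. rdeg t \<alpha> = 1}"
  by (erule Sp_mono) (auto simp: MM_def rdeg_mI)

text \<open>By induction the operators of the tail turn a slice of \<open>f\<close> into a
  combination of slices of \<open>f\<close>, so \<open>eh_slice\<close> can be applied again, slice
  by slice; normal ordering then subtracts corrections by lists no longer than the tail. One matrix
  \<open>C\<close> serves all invariants.\<close>

lemma Nop_slice:
  assumes "fst ` set L \<subseteq> R" "snd ` set L \<subseteq> R"
  shows "\<exists>C. \<forall>f \<beta>. is_inv f \<longrightarrow> \<beta> \<in> NN \<longrightarrow> Nop T L (slice \<beta> f) = (\<Sum>\<beta>'\<in>NN. scl (C \<beta> \<beta>') (slice \<beta>' f))"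
  using assms
proof (induction "length L" arbitrary: L rule: less_induct)
  case less
  show ?case
  proof (cases L)
    case Nil
    have "(\<Sum>\<beta>'\<in>NN. scl (if \<beta>' = \<beta> then 1 else 0) (slice \<beta>' f)) = slice \<beta> f" if "\<beta> \<in> NN" for \<beta> f
      using that finite_NN by (simp add: if_distrib[of "\<lambda>c. scl c _"] cong: if_cong)
    thus ?thesis by (intro exI[of _ "\<lambda>\<beta> \<beta>'. if \<beta>' = \<beta> then 1 else 0"]) (simp add: Nil)
  next
    case (Cons x L0)
    obtain cs where cs0: "\<forall>(c, L')\<in>set cs. length L' = length L0 \<and> fst ` set L' \<subseteq> fst ` set (x # L0)
          \<and> snd ` set L' \<subseteq> snd ` set (x # L0)"
        and cs1: "\<forall>T z. finite T \<longrightarrow> (\<forall>t\<in>T. z \<in> Sp {\<alpha>. rdeg t \<alpha> = 1}) \<longrightarrow>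
          (\<Sum>t\<in>T. eh t x (Nop T L0 z)) = Nop T (x # L0) z + sum_list (map (\<lambda>(c, L'). scl c (Nop T L' z)) cs)"
      using eh_Nop[of L0 x] by (elim exE conjE)
    define ok where "ok L' \<longleftrightarrow> length L' < length L \<and> fst ` set L' \<subseteq> R \<and> snd ` set L' \<subseteq> R" for L' :: "(idx \<times> idx) list"
    have "\<forall>L'. \<exists>C. ok L' \<longrightarrow> (\<forall>f \<beta>. is_inv f \<longrightarrow> \<beta> \<in> NN \<longrightarrow> Nop T L' (slice \<beta> f) = (\<Sum>\<beta>'\<in>NN. scl (C \<beta> \<beta>') (slice \<beta>' f)))"
    proof
      fix L'
      show "\<exists>C. ok L' \<longrightarrow> (\<forall>f \<beta>. is_inv f \<longrightarrow> \<beta> \<in> NN \<longrightarrow>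
          Nop T L' (slice \<beta> f) = (\<Sum>\<beta>'\<in>NN. scl (C \<beta> \<beta>') (slice \<beta>' f)))"
      proof (cases "ok L'")
        case True
        thus ?thesis using less.hyps[of L'] by (simp add: ok_def)
      qed simp
    qed
    then obtain C where C: "\<And>L' f \<beta>. ok L' \<Longrightarrow> is_inv f \<Longrightarrow> \<beta> \<in> NN \<Longrightarrow>
        Nop T L' (slice \<beta> f) = (\<Sum>\<beta>'\<in>NN. scl (C L' \<beta> \<beta>') (slice \<beta>' f))"
      unfolding choice_iff by (elim exE) simp
    have ok0: "ok L0" using less.prems unfolding ok_def Cons by auto
    have okc: "ok L'" if "(c, L') \<in> set cs" for c L'
    proof -
      have "length L' = length L0" and f: "fst ` set L' \<subseteq> fst ` set (x # L0)"
        and s: "snd ` set L' \<subseteq> snd ` set (x # L0)" using bspec[OF cs0 that] unfolding prod.case by blast+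
      thus ?thesis
        using subset_trans[OF f less.prems(1)[unfolded Cons]] subset_trans[OF s less.prems(2)[unfolded Cons]]
        unfolding ok_def Cons by (intro conjI) simp_all
    qed
    define Q where "Q \<beta>' \<beta> = - cf (EV (fst x) (snd x) (mon \<beta>)) \<beta>'" for \<beta>' \<beta>
    define D where "D \<beta> \<beta>' = (\<Sum>\<kappa>\<in>NN. C L0 \<beta> \<kappa> * Q \<kappa> \<beta>') - sum_list (map (\<lambda>(c, L'). c * C L' \<beta> \<beta>') cs)" for \<beta> \<beta>'
    have "Nop T L (slice \<beta> f) = (\<Sum>\<beta>'\<in>NN. scl (D \<beta> \<beta>') (slice \<beta>' f))" if f: "is_inv f" and b: "\<beta> \<in> NN" for f \<beta>
    proof -
      have "(\<Sum>t\<in>T. eh t x (Nop T L0 (slice \<beta> f))) = (\<Sum>t\<in>T. \<Sum>\<kappa>\<in>NN. scl (C L0 \<beta> \<kappa>) (eh t x (slice \<kappa> f)))"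
        by (simp add: C[OF ok0 f b] eh_sum eh_scl)
      also have "\<dots> = (\<Sum>\<kappa>\<in>NN. scl (C L0 \<beta> \<kappa>) (\<Sum>t\<in>T. eh t x (slice \<kappa> f)))"
        unfolding sv.scale_sum_right by (rule sum.swap)
      also have "\<dots> = (\<Sum>\<kappa>\<in>NN. \<Sum>\<beta>'\<in>NN. scl (C L0 \<beta> \<kappa> * Q \<kappa> \<beta>') (slice \<beta>' f))"
        using less.prems by (intro sum.cong refl) (simp add: eh_slice[OF f] Cons Q_def sv.scale_sum_right)
      also have "\<dots> = (\<Sum>\<beta>'\<in>NN. scl (\<Sum>\<kappa>\<in>NN. C L0 \<beta> \<kappa> * Q \<kappa> \<beta>') (slice \<beta>' f))"
        unfolding sv.scale_sum_left by (rule sum.swap)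
      finally have 1: "(\<Sum>t\<in>T. eh t x (Nop T L0 (slice \<beta> f))) = \<dots>" .
      have 2: "sum_list (map (\<lambda>(c, L'). scl c (Nop T L' (slice \<beta> f))) xs)
          = (\<Sum>\<beta>'\<in>NN. scl (sum_list (map (\<lambda>(c, L'). c * C L' \<beta> \<beta>') xs)) (slice \<beta>' f))"
        if "set xs \<subseteq> set cs" for xs
        using that
      proof (induction xs)
        case (Cons p xs)
        obtain c L' where p: "p = (c, L')" by (cases p)
        have "ok L'" using Cons.prems okc by (auto simp: p)
        thus ?case using Cons by (simp add: p C[OF _ f b] sv.scale_sum_right sv.scale_left_distrib sum.distrib)
      qed simp
      have "(\<Sum>t\<in>T. eh t x (Nop T L0 (slice \<beta> f))) = Nop T L (slice \<beta> f)
          + sum_list (map (\<lambda>(c, L'). scl c (Nop T L' (slice \<beta> f))) cs)"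
        unfolding Cons by (rule cs1[rule_format]) (use MM_row[OF slice_Sp] in auto)
      thus ?thesis unfolding 1 2[OF subset_refl]
        by (simp add: D_def sv.scale_left_diff_distrib sum_subtractf)
    qed
    thus ?thesis by blast
  qed
qed

section \<open>Matrix units of the first factor\<close>

definition unit_op :: "(idx \<Rightarrow> idx) \<Rightarrow> (idx \<Rightarrow> idx) \<Rightarrow> salg \<Rightarrow> salg" where
  "unit_op I' I = foldr (\<lambda>t. eh t (I' t, I t)) ts"

text \<open>The value of this sign is never computed; what matters is that one sign serves every
  \<open>K\<close>.\<close>

definition unit_sign :: "(idx \<Rightarrow> idx) \<Rightarrow> (idx \<Rightarrow> idx) \<Rightarrow> complex" where
  "unit_sign I' I = (SOME \<zeta>. pm1 \<zeta> \<and> (\<forall>K. unit_op I' I (mon (mI T K)) =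
    (if mI T K = mI T I then scl \<zeta> (mon (mI T I')) else 0)))"

lemma unit_op_mI:
  "pm1 (unit_sign I' I)"
  "unit_op I' I (mon (mI T K)) = (if mI T K = mI T I then scl (unit_sign I' I) (mon (mI T I')) else 0)"
proof -
  have "\<exists>\<zeta>. pm1 \<zeta> \<and> (\<forall>K. unit_op I' I (mon (mI T K)) =
    (if mI T K = mI T I then scl \<zeta> (mon (mI T I')) else 0))"
    unfolding unit_op_def by (rule foldr_eh_unit) (simp_all add: dist)
  from someI_ex[OF this, folded unit_sign_def]
  show "pm1 (unit_sign I' I)"
    "unit_op I' I (mon (mI T K)) = (if mI T K = mI T I then scl (unit_sign I' I) (mon (mI T I')) else 0)"
    by blast+
qed

lemma lin_foldr_eh: "lin (foldr (\<lambda>t. eh t (x t)) l)"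
proof (induction l)
  case Nil
  show ?case by (rule linI) simp_all
next
  case (Cons t l)
  thus ?case using lin_comp[OF lin_eh, of _ t "x t"] by (simp add: comp_def)
qed

text \<open>The expansion of an operator in matrix units. As \<open>unit_sign\<close> squares to 1,
  its occurrence in the coefficient cancels the sign of \<open>unit_op\<close>.\<close>

lemma unit_expand:
  assumes "lin \<Theta>" "\<And>m. m \<in> Sp MM \<Longrightarrow> \<Theta> m \<in> Sp MM" "m \<in> Sp MM"
  shows "\<Theta> m = (\<Sum>I\<in>MI. \<Sum>I'\<in>MI. scl (cf (\<Theta> (mon (mI T I))) (mI T I') * unit_sign I' I) (unit_op I' I m))"
proof (rule lin_eq_on[OF assms(1) _ assms(3)])
  show "lin (\<lambda>m. \<Sum>I\<in>MI. \<Sum>I'\<in>MI. scl (cf (\<Theta> (mon (mI T I))) (mI T I') * unit_sign I' I) (unit_op I' I m))"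
    unfolding unit_op_def by (intro lin_sum lin_scl lin_foldr_eh)
next
  fix \<alpha> assume "\<alpha> \<in> MM"
  then obtain K where K: "K \<in> MI" "\<alpha> = mI T K" unfolding MM_def by blast
  have eq: "mI T K = mI T I \<longleftrightarrow> I = K" if "I \<in> MI" for I
    using inj_mI K(1) that by (metis inj_onD)
  have "(\<Sum>I\<in>MI. \<Sum>I'\<in>MI. scl (cf (\<Theta> (mon (mI T I))) (mI T I') * unit_sign I' I) (unit_op I' I (mon \<alpha>)))
      = (\<Sum>I\<in>MI. if I = K then (\<Sum>I'\<in>MI. scl (cf (\<Theta> (mon \<alpha>)) (mI T I')) (mon (mI T I'))) else 0)"
  proof (rule sum.cong[OF refl])
    fix I assume "I \<in> MI"
    show "(\<Sum>I'\<in>MI. scl (cf (\<Theta> (mon (mI T I))) (mI T I') * unit_sign I' I) (unit_op I' I (mon \<alpha>)))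
      = (if I = K then (\<Sum>I'\<in>MI. scl (cf (\<Theta> (mon \<alpha>)) (mI T I')) (mon (mI T I'))) else 0)"
      by (auto simp: K(2) unit_op_mI(2) eq[OF \<open>I \<in> MI\<close>] unit_op_mI(1) mult.assoc intro!: sum.cong)
  qed
  also have "\<dots> = (\<Sum>I'\<in>MI. scl (cf (\<Theta> (mon \<alpha>)) (mI T I')) (mon (mI T I')))"
    using K(1) finite_MI by simp
  also have "\<dots> = (\<Sum>\<alpha>'\<in>MM. scl (cf (\<Theta> (mon \<alpha>)) \<alpha>') (mon \<alpha>'))"
    unfolding MM_def by (simp add: sum.reindex[OF inj_mI])
  also have "\<dots> = \<Theta> (mon \<alpha>)"
    by (rule salg_expand[OF finite_MM, symmetric])
      (use assms(2)[OF mon_in_Sp[OF \<open>\<alpha> \<in> MM\<close>]] in \<open>simp add: Sp_def\<close>)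
  finally show "\<Theta> (mon \<alpha>) = (\<Sum>I\<in>MI. \<Sum>I'\<in>MI. scl (cf (\<Theta> (mon (mI T I))) (mI T I') * unit_sign I' I)
      (unit_op I' I (mon \<alpha>)))" ..
qed

text \<open>A row permutation moves each operator to the image row and leaves its matrix unit
  unchanged. Summing conjugates over all permutations therefore leads to \<open>Nop\<close>.\<close>

lemma ren_foldr_eh:
  assumes "row_perm g g' T"
  shows "ren g (foldr (\<lambda>t. eh t (x t)) l z) = foldr (\<lambda>(u, x). eh u x) (zip (map g l) (map x l)) (ren g z)"
  by (induction l) (simp_all add: row_perm.ren_eh[OF assms])

lemma ren_MM:
  assumes "row_perm g g' T" "m \<in> Sp MM"
  shows "ren g m \<in> Sp MM"
proof (rule lin_Sp[OF row_perm.lin_ren[OF assms(1)] assms(2)])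
  interpret row_perm g g' T by fact
  fix \<alpha> assume "\<alpha> \<in> MM"
  then obtain K where K: "K \<in> MI" "\<alpha> = mI T K" unfolding MM_def by blast
  have "restrict (\<lambda>t. K (g' t)) T \<in> MI"
    using K(1) g'T unfolding MI_def by auto
  moreover have "mI T (\<lambda>t. K (g' t)) = mI T (restrict (\<lambda>t. K (g' t)) T)"
    by (rule mI_cong) simp
  ultimately have "mI T (\<lambda>t. K (g' t)) \<in> MM" unfolding MM_def by blast
  moreover obtain \<zeta> where "ren g (mon (mI T K)) = scl \<zeta> (mon (mI T (\<lambda>t. K (g' t))))"
    using ren_mon_mI[of K] by auto
  ultimately show "ren g (mon \<alpha>) \<in> Sp MM" unfolding K(2) by (simp add: Sp_scl mon_in_Sp)
qed

lemma ren_NN: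
  assumes "row_perm g g' T" "\<beta> \<in> NN"
  shows "ren g (mon \<beta>) = mon \<beta>"
proof -
  obtain ys where ys: "\<beta> = cnt ys" "set ys \<subseteq> YV" using assms(2) unfolding NN_def by blast
  show ?thesis unfolding ys(1)
    by (rule row_perm.ren_mon_Y[OF assms(1)]) (use ys(2) in \<open>auto simp: YV_def\<close>)
qed

lemma ren_HH:
  assumes "row_perm g g' T" "h \<in> Sp HH"
  shows "ren g h = (\<Sum>\<beta>\<in>NN. ren g (slice \<beta> h) * mon \<beta>)" "ren g h \<in> Sp HH"
    "\<beta> \<in> NN \<Longrightarrow> slice \<beta> (ren g h) = ren g (slice \<beta> h)"
proof -
  have "ren g h = ren g (\<Sum>\<beta>\<in>NN. slice \<beta> h * mon \<beta>)" using slice_decomp[OF assms(2)] by simp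
  also have "\<dots> = (\<Sum>\<beta>\<in>NN. ren g (slice \<beta> h) * mon \<beta>)"
    by (simp add: row_perm.ren_sum[OF assms(1)] row_perm.ren_mult[OF assms(1)] ren_NN[OF assms(1)])
  finally show e: "ren g h = (\<Sum>\<beta>\<in>NN. ren g (slice \<beta> h) * mon \<beta>)" .
  show "ren g h \<in> Sp HH" unfolding e by (intro Sp_sum Sp_times_NN ren_MM[OF assms(1)] slice_Sp)
  show "\<beta> \<in> NN \<Longrightarrow> slice \<beta> (ren g h) = ren g (slice \<beta> h)" unfolding e
    by (rule slice_sum[of "\<lambda>\<beta>. ren g (slice \<beta> h)"]) (intro ren_MM[OF assms(1)] slice_Sp)
qed

abbreviation PP where "PP \<equiv> pairings R S"

lemma ren_Gen:
  assumes "row_perm g g' T" "x \<in> Gen PP"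
  shows "ren g x \<in> Gen PP"
proof -
  interpret row_perm g g' T by fact
  have "ren g a \<in> Gen PP" if "a \<in> PP" for a
  proof -
    obtain r s where a: "a = Z R r s" "s \<in> S" using \<open>a \<in> PP\<close> unfolding pairings_def by blast
    show ?thesis unfolding pairings_def a(1) ren_Z using a(2) by (intro Gen.base) blast
  qed
  from Gen_hom[OF lin_ren ren_1 ren_mult this assms(2)] show ?thesis .
qed

text \<open>Averaging a linear projection onto the span of the products of pairings over the permutations
  of the rows gives an operator which on invariants acts through the second tensor factor only.\<close>

lemma averaged_projection:
  "\<exists>Q E. (\<forall>f. is_inv f \<longrightarrow> Q f \<in> Gen PP \<and> Q f \<in> Sp HH)
    \<and> (\<forall>f. is_inv f \<longrightarrow> f \<in> Gen PP \<longrightarrow> Q f = scl (of_nat (card (permutations_of_set T))) f)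
    \<and> (\<forall>f \<alpha> \<beta>. is_inv f \<longrightarrow> \<alpha> \<in> MM \<longrightarrow> \<beta> \<in> NN \<longrightarrow> cf (Q f) (\<alpha> + \<beta>) = (\<Sum>\<kappa>\<in>NN. E \<beta> \<kappa> * cf f (\<alpha> + \<kappa>)))"
proof -
  have "sv.subspace (Sp HH \<inter> Gen PP)"
    using sv.subspace_inter[OF Sp_subspace Gen_subspace] by simp
  moreover have "lin (\<lambda>x. x)" by (rule linI) simp_all
  \<comment> \<open>A left inverse of the identity on the subspace is a linear projection onto it.
    It commutes with the permutations only after the averaging.\<close>
  ultimately obtain P where P: "range P \<subseteq> Sp HH \<inter> Gen PP" "lin P" "\<forall>v\<in>Sp HH \<inter> Gen PP. P v = v"
    using svp.linear_exists_left_inverse_on[of "\<lambda>x. x" "Sp HH \<inter> Gen PP"] by auto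
  have PH: "P x \<in> Sp HH" "P x \<in> Gen PP" for x using P(1) by blast+
  have "\<forall>us\<in>permutations_of_set T. \<exists>g. \<exists>g'. row_perm g g' T \<and> map g ts = us"
    using row_perm_exists[OF dist _ ev] by blast
  then obtain G where G1: "\<forall>us\<in>permutations_of_set T. \<exists>g'. row_perm (G us) g' T \<and> map (G us) ts = us"
    unfolding bchoice_iff by blast
  then obtain G' where G: "\<And>us. us \<in> permutations_of_set T \<Longrightarrow> row_perm (G us) (G' us) T"
      "\<And>us. us \<in> permutations_of_set T \<Longrightarrow> map (G us) ts = us"
    unfolding bchoice_iff by blast
  note G' = row_perm.inverse[OF G(1)]
  \<comment> \<open>The sum of conjugates is not divided by their number, which therefore reappears
    as the factor on invariants in the subalgebra.\<close>
  define Q where "Q f = (\<Sum>us\<in>permutations_of_set T. ren (G us) (P (ren (G' us) f)))" for f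
  have Q1: "Q f \<in> Gen PP" for f
    unfolding Q_def by (intro sv.subspace_sum[OF Gen_subspace] ren_Gen[OF G(1)] PH)
  have Q1': "Q f \<in> Sp HH" for f
    unfolding Q_def by (intro Sp_sum ren_HH(2)[OF G(1)] PH)
  have Q2: "Q f = scl (of_nat (card (permutations_of_set T))) f" if "is_inv f" "f \<in> Gen PP" for f
  proof -
    have "ren (G us) (P (ren (G' us) f)) = f" if us: "us \<in> permutations_of_set T" for us
    proof -
      have "ren (G' us) f \<in> Sp HH \<inter> Gen PP"
        using ren_HH(2)[OF G'[OF us], of f] ren_Gen[OF G'[OF us] \<open>f \<in> Gen PP\<close>] \<open>is_inv f\<close>
        by (simp add: is_inv_def)
      hence "P (ren (G' us) f) = ren (G' us) f" using P(3) by blast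
      thus ?thesis using row_perm.ren_inverse[OF G(1)[OF us] G'[OF us]] by simp
    qed
    hence "Q f = (\<Sum>us\<in>permutations_of_set T. scl 1 f)" unfolding Q_def by simp
    also have "\<dots> = scl (\<Sum>us\<in>permutations_of_set T. 1) f" by (simp only: sv.scale_sum_left)
    finally show ?thesis by simp
  qed
  \<comment> \<open>The matrix entries of \<open>P\<close> with respect to the basis
    \<open>NN\<close> of the second factor; each is an operator on \<open>M\<close>.\<close>
  define \<Theta> where "\<Theta> \<beta>' \<beta> m = slice \<beta>' (P (m * mon \<beta>))" for \<beta>' \<beta> m
  have lm: "lin (\<lambda>m. m * mon \<beta>)" for \<beta> by (rule linI) (simp_all add: distrib_right scl_mult_left)
  have l\<Theta>: "lin (\<Theta> \<beta>' \<beta>)" for \<beta>' \<beta>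
    using lin_comp[OF lin_slice lin_comp[OF P(2) lm], of \<beta>' \<beta>] unfolding \<Theta>_def[symmetric] .
  have \<Theta>M: "\<Theta> \<beta>' \<beta> m \<in> Sp MM" for \<beta>' \<beta> m unfolding \<Theta>_def by (rule slice_Sp)
  define p where "p \<beta>' \<beta> I I' = cf (\<Theta> \<beta>' \<beta> (mon (mI T I))) (mI T I') * unit_sign I' I" for \<beta>' \<beta> I I'
  define xs where "xs I I' = map (\<lambda>t. (I' t, I t)) ts" for I I' :: "idx \<Rightarrow> idx"
  have Pdec: "P h = (\<Sum>\<beta>'\<in>NN. (\<Sum>\<beta>\<in>NN. \<Theta> \<beta>' \<beta> (slice \<beta> h)) * mon \<beta>')" if "h \<in> Sp HH" for h
  proof -
    have "P h = P (\<Sum>\<beta>\<in>NN. slice \<beta> h * mon \<beta>)" using slice_decomp[OF that] by simp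
    also have "\<dots> = (\<Sum>\<beta>\<in>NN. P (slice \<beta> h * mon \<beta>))" by (simp add: svp.linear_sum[OF P(2)])
    also have "\<dots> = (\<Sum>\<beta>\<in>NN. \<Sum>\<beta>'\<in>NN. \<Theta> \<beta>' \<beta> (slice \<beta> h) * mon \<beta>')"
      unfolding \<Theta>_def by (intro sum.cong refl slice_decomp PH)
    also have "\<dots> = (\<Sum>\<beta>'\<in>NN. (\<Sum>\<beta>\<in>NN. \<Theta> \<beta>' \<beta> (slice \<beta> h)) * mon \<beta>')"
      unfolding sum_distrib_right by (rule sum.swap)
    finally show ?thesis .
  qed
  \<comment> \<open>After conjugation the units sit on the rows listed by \<open>us\<close>, while
    the scalars \<open>p\<close> are the same for every permutation.\<close>
  have conj: "ren (G us) (\<Theta> \<beta>' \<beta> (ren (G' us) m)) =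
      (\<Sum>I\<in>MI. \<Sum>I'\<in>MI. scl (p \<beta>' \<beta> I I') (foldr (\<lambda>(u, x). eh u x) (zip us (xs I I')) m))"
    if us: "us \<in> permutations_of_set T" and m: "m \<in> Sp MM" for us \<beta>' \<beta> m
  proof -
    interpret row_perm "G us" "G' us" T by (rule G(1)[OF us])
    have "\<Theta> \<beta>' \<beta> (ren (G' us) m) = (\<Sum>I\<in>MI. \<Sum>I'\<in>MI. scl (p \<beta>' \<beta> I I') (unit_op I' I (ren (G' us) m)))"
      unfolding p_def by (rule unit_expand[OF l\<Theta> \<Theta>M ren_MM[OF G'[OF us] m]])
    moreover have "ren (G us) (unit_op I' I (ren (G' us) m))
        = foldr (\<lambda>(u, x). eh u x) (zip us (xs I I')) m" for I I'
      unfolding unit_op_def xs_def ren_foldr_eh[OF G(1)[OF us]] ren_inverse[OF G'[OF us]] G(2)[OF us] ..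
    ultimately show ?thesis by (simp add: ren_sum ren_scl)
  qed
  have Qdec: "Q f = (\<Sum>\<beta>'\<in>NN. (\<Sum>\<beta>\<in>NN. \<Sum>I\<in>MI. \<Sum>I'\<in>MI. scl (p \<beta>' \<beta> I I') (Nop T (xs I I') (slice \<beta> f))) * mon \<beta>')"
    if f: "f \<in> Sp HH" for f
  proof -
    let ?F = "\<lambda>us \<beta>' \<beta> I I'. scl (p \<beta>' \<beta> I I') (foldr (\<lambda>(u, x). eh u x) (zip us (xs I I')) (slice \<beta> f))"
    have "ren (G us) (P (ren (G' us) f)) = (\<Sum>\<beta>'\<in>NN. (\<Sum>\<beta>\<in>NN. \<Sum>I\<in>MI. \<Sum>I'\<in>MI. ?F us \<beta>' \<beta> I I') * mon \<beta>')"
      if us: "us \<in> permutations_of_set T" for us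
    proof -
      interpret row_perm "G us" "G' us" T by (rule G(1)[OF us])
      note r = ren_HH[OF G'[OF us] f]
      have "ren (G us) (P (ren (G' us) f))
        = (\<Sum>\<beta>'\<in>NN. (\<Sum>\<beta>\<in>NN. ren (G us) (\<Theta> \<beta>' \<beta> (slice \<beta> (ren (G' us) f)))) * mon \<beta>')"
        by (simp add: Pdec[OF r(2)] ren_sum ren_mult ren_NN[OF G(1)[OF us]])
      also have "\<dots> = (\<Sum>\<beta>'\<in>NN. (\<Sum>\<beta>\<in>NN. ren (G us) (\<Theta> \<beta>' \<beta> (ren (G' us) (slice \<beta> f)))) * mon \<beta>')"
        by (simp add: r(3))
      finally show ?thesis by (simp add: conj[OF us slice_Sp])
    qed
    hence "Q f = (\<Sum>us\<in>permutations_of_set T. \<Sum>\<beta>'\<in>NN. (\<Sum>\<beta>\<in>NN. \<Sum>I\<in>MI. \<Sum>I'\<in>MI. ?F us \<beta>' \<beta> I I') * mon \<beta>')"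
      unfolding Q_def by simp
    also have "\<dots> = (\<Sum>\<beta>'\<in>NN. (\<Sum>us\<in>permutations_of_set T. \<Sum>\<beta>\<in>NN. \<Sum>I\<in>MI. \<Sum>I'\<in>MI. ?F us \<beta>' \<beta> I I') * mon \<beta>')"
      unfolding sum_distrib_right by (rule sum.swap)
    also have "\<dots> = (\<Sum>\<beta>'\<in>NN. (\<Sum>\<beta>\<in>NN. \<Sum>I\<in>MI. \<Sum>I'\<in>MI. \<Sum>us\<in>permutations_of_set T. ?F us \<beta>' \<beta> I I') * mon \<beta>')"
    proof -
      have "(\<Sum>us\<in>permutations_of_set T. \<Sum>\<beta>\<in>NN. \<Sum>I\<in>MI. \<Sum>I'\<in>MI. ?F us \<beta>' \<beta> I I')
        = (\<Sum>\<beta>\<in>NN. \<Sum>I\<in>MI. \<Sum>I'\<in>MI. \<Sum>us\<in>permutations_of_set T. ?F us \<beta>' \<beta> I I')" for \<beta>'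
        by (rule trans[OF sum.swap], rule sum.cong[OF refl], rule trans[OF sum.swap],
            rule sum.cong[OF refl], rule sum.swap)
      thus ?thesis by simp
    qed
    also have "\<dots> = (\<Sum>\<beta>'\<in>NN. (\<Sum>\<beta>\<in>NN. \<Sum>I\<in>MI. \<Sum>I'\<in>MI. scl (p \<beta>' \<beta> I I') (Nop T (xs I I') (slice \<beta> f))) * mon \<beta>')"
    proof -
      \<comment> \<open>Each list \<open>xs I I'\<close> has one unit per row, so the sum over the
        permutations is a normal ordered product.\<close>
      have "(\<Sum>us\<in>permutations_of_set T. ?F us \<beta>' \<beta> I I') = scl (p \<beta>' \<beta> I I') (Nop T (xs I I') (slice \<beta> f))"
        for \<beta>' \<beta> I I'
      proof -
        have "length (xs I I') = card T" by (simp add: xs_def distinct_card[OF dist])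
        from sum_permutations_eq_Nop[OF _ this] show ?thesis
          unfolding sv.scale_sum_right[symmetric] by simp
      qed
      thus ?thesis by simp
    qed
    finally show ?thesis .
  qed
  have "\<forall>x. \<exists>C. fst x \<in> MI \<longrightarrow> snd x \<in> MI \<longrightarrow> (\<forall>f \<beta>. is_inv f \<longrightarrow> \<beta> \<in> NN \<longrightarrow>
      Nop T (xs (fst x) (snd x)) (slice \<beta> f) = (\<Sum>\<kappa>\<in>NN. scl (C \<beta> \<kappa>) (slice \<kappa> f)))"
  proof
    fix x :: "(idx \<Rightarrow> idx) \<times> (idx \<Rightarrow> idx)"
    show "\<exists>C. fst x \<in> MI \<longrightarrow> snd x \<in> MI \<longrightarrow> (\<forall>f \<beta>. is_inv f \<longrightarrow> \<beta> \<in> NN \<longrightarrow>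
      Nop T (xs (fst x) (snd x)) (slice \<beta> f) = (\<Sum>\<kappa>\<in>NN. scl (C \<beta> \<kappa>) (slice \<kappa> f)))"
    proof (cases "fst x \<in> MI \<and> snd x \<in> MI")
      case True
      hence "fst ` set (xs (fst x) (snd x)) \<subseteq> R" "snd ` set (xs (fst x) (snd x)) \<subseteq> R"
        unfolding xs_def MI_def by (auto simp: PiE_iff)
      from Nop_slice[OF this] show ?thesis by (elim exE) (intro exI impI)
    qed simp
  qed
  from choice[OF this] obtain C0 where C0: "\<forall>x. fst x \<in> MI \<longrightarrow> snd x \<in> MI \<longrightarrow>
      (\<forall>f \<beta>. is_inv f \<longrightarrow> \<beta> \<in> NN \<longrightarrow>
      Nop T (xs (fst x) (snd x)) (slice \<beta> f) = (\<Sum>\<kappa>\<in>NN. scl (C0 x \<beta> \<kappa>) (slice \<kappa> f)))" ..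
  define C where "C I I' = C0 (I, I')" for I I'
  have C: "Nop T (xs I I') (slice \<beta> f) = (\<Sum>\<kappa>\<in>NN. scl (C I I' \<beta> \<kappa>) (slice \<kappa> f))"
    if "I \<in> MI" "I' \<in> MI" "is_inv f" "\<beta> \<in> NN" for I I' f \<beta>
    using C0[THEN spec, of "(I, I')"] that unfolding C_def by simp
  \<comment> \<open>Both indices belong to \<open>N\<close>, and the entry involves neither
    \<open>f\<close> nor a basis element of \<open>M\<close>; this is what allows test elements to
    determine it.\<close>
  define E where "E \<beta>' \<kappa> = (\<Sum>\<beta>\<in>NN. \<Sum>I\<in>MI. \<Sum>I'\<in>MI. p \<beta>' \<beta> I I' * C I I' \<beta> \<kappa>)" for \<beta>' \<kappa>
  have Q3: "cf (Q f) (\<alpha> + \<beta>') = (\<Sum>\<kappa>\<in>NN. E \<beta>' \<kappa> * cf f (\<alpha> + \<kappa>))"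
    if f: "is_inv f" and a: "\<alpha> \<in> MM" and b: "\<beta>' \<in> NN" for f \<alpha> \<beta>'
  proof -
    have fH: "f \<in> Sp HH" using f by (simp add: is_inv_def)
    let ?a = "\<lambda>\<beta>'. \<Sum>\<kappa>\<in>NN. scl (E \<beta>' \<kappa>) (slice \<kappa> f)"
    have e: "(\<Sum>\<beta>\<in>NN. \<Sum>I\<in>MI. \<Sum>I'\<in>MI. scl (p \<beta>' \<beta> I I') (Nop T (xs I I') (slice \<beta> f))) = ?a \<beta>'" for \<beta>'
    proof -
      have "(\<Sum>\<beta>\<in>NN. \<Sum>I\<in>MI. \<Sum>I'\<in>MI. scl (p \<beta>' \<beta> I I') (Nop T (xs I I') (slice \<beta> f)))
        = (\<Sum>\<beta>\<in>NN. \<Sum>I\<in>MI. \<Sum>I'\<in>MI. \<Sum>\<kappa>\<in>NN. scl (p \<beta>' \<beta> I I' * C I I' \<beta> \<kappa>) (slice \<kappa> f))"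
        by (intro sum.cong refl) (simp add: C[OF _ _ f] sv.scale_sum_right)
      also have "\<dots> = (\<Sum>\<beta>\<in>NN. \<Sum>I\<in>MI. \<Sum>\<kappa>\<in>NN. \<Sum>I'\<in>MI. scl (p \<beta>' \<beta> I I' * C I I' \<beta> \<kappa>) (slice \<kappa> f))"
        by (rule sum.cong[OF refl], rule sum.cong[OF refl], rule sum.swap)
      also have "\<dots> = (\<Sum>\<beta>\<in>NN. \<Sum>\<kappa>\<in>NN. \<Sum>I\<in>MI. \<Sum>I'\<in>MI. scl (p \<beta>' \<beta> I I' * C I I' \<beta> \<kappa>) (slice \<kappa> f))"
        by (rule sum.cong[OF refl], rule sum.swap)
      also have "\<dots> = (\<Sum>\<kappa>\<in>NN. \<Sum>\<beta>\<in>NN. \<Sum>I\<in>MI. \<Sum>I'\<in>MI. scl (p \<beta>' \<beta> I I' * C I I' \<beta> \<kappa>) (slice \<kappa> f))"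
        by (rule sum.swap)
      finally show ?thesis by (simp add: E_def sv.scale_sum_left)
    qed
    have "slice \<beta>' (Q f) = ?a \<beta>'"
      unfolding Qdec[OF fH] e by (rule slice_sum[of ?a, OF _ b]) (intro Sp_sum Sp_scl slice_Sp)
    hence "cf (slice \<beta>' (Q f)) \<alpha> = cf (?a \<beta>') \<alpha>" by simp
    thus ?thesis by (simp add: cf_slice[OF a])
  qed
  show ?thesis using Q1 Q1' Q2 Q3 by blast
qed

text \<open>Write \<open>\<beta>\<close> as the word of the variables \<open>Yv (I t) (s t)\<close>
  and take the product of the pairings of \<open>t\<close> with \<open>s t\<close>. Along the basis
  tensor of \<open>I\<close> each pairing contributes only its term with \<open>i = I t\<close>,
  which leaves \<open>\<beta>\<close> up to sign.\<close>

lemma test_element: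
  assumes "\<beta> \<in> NN"
  shows "\<exists>z \<alpha> \<zeta>. is_inv z \<and> z \<in> Gen PP \<and> \<alpha> \<in> MM \<and> pm1 \<zeta> \<and> (\<forall>\<kappa>\<in>NN. cf z (\<alpha> + \<kappa>) = (if \<kappa> = \<beta> then \<zeta> else 0))"
proof -
  obtain ys where ys: "\<beta> = cnt ys" "set ys \<subseteq> YV" "length ys = length ts" "is_mono (cnt ys)"
    using assms unfolding NN_def by blast
  define y where "y t = the (map_of (zip ts ys) t)" for t
  have ym: "map y ts = ys"
    by (rule nth_equalityI) (simp_all add: ys(3) y_def map_of_zip_nth dist)
  define I where "I = restrict (\<lambda>t. fst (snd (y t))) T"
  define s where "s t = snd (snd (y t))" for t
  have y: "y t = Yv (I t) (s t)" "I t \<in> R" "s t \<in> S" if "t \<in> T" for t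
  proof -
    have "y t \<in> YV" using ys(2) ym that by (metis imageI set_map subsetD)
    thus "y t = Yv (I t) (s t)" "I t \<in> R" "s t \<in> S" using that unfolding YV_def I_def s_def by auto
  qed
  have IM: "I \<in> MI" unfolding MI_def using y(2) by (auto simp: I_def)
  have yms: "map (\<lambda>t. Yv (I t) (s t)) ts = ys" using y(1) ym by (metis (mono_tags, lifting) map_cong)
  define zl where "zl l = prod_list (map (\<lambda>t. Z R t (s t)) l)" for l
  have G: "zl ts \<in> Gen PP"
    unfolding zl_def by (rule Gen_prod_list) (use y(3) in \<open>auto simp: pairings_def intro!: Gen.base\<close>)
  have EVz: "EV i j (zl l) = 0" if "i \<in> R" "j \<in> R" for i j l
    by (induction l) (simp_all add: zl_def EV_simps EV_Z[OF fin(1) that])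
  have "zl l \<in> Sp {mI (set l) J + cnt ws | J ws. J \<in> PiE (set l) (\<lambda>_. R) \<and> set ws \<subseteq> YV \<and> length ws = length l}"
    (is "_ \<in> Sp (?A l)") if "distinct l" "set l \<subseteq> T" for l
    using that
  proof (induction l)
    case Nil
    have "0 \<in> ?A []"
      by (rule CollectI, rule exI[of _ "\<lambda>_. undefined"], rule exI[of _ "[]"])
        (simp add: mI_def zero_fun_def case_prod_unfold)
    from mon_in_Sp[OF this] show ?case unfolding mon_0 by (simp add: zl_def)
  next
    case (Cons t l)
    have sub: "(+) (sng (Xv t i)) ` ((+) (sng (Yv i (s t))) ` ?A l) \<subseteq> ?A (t # l)" if i: "i \<in> R" for i
    proof clarify
      fix J ws assume J: "J \<in> PiE (set l) (\<lambda>_. R)" "set ws \<subseteq> YV" "length ws = length l"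
      let ?J = "J(t := i)" and ?ws = "Yv i (s t) # ws"
      have "mI (set l) ?J = mI (set l) J" by (rule mI_cong) (use Cons.prems in auto)
      hence "mI (set (t # l)) ?J = sng (Xv t i) + mI (set l) J"
        using mI_split[of t "set (t # l)" ?J] Cons.prems by simp
      hence "sng (Xv t i) + (sng (Yv i (s t)) + (mI (set l) J + cnt ws)) = mI (set (t # l)) ?J + cnt ?ws"
        by (simp add: add_ac)
      moreover have "?J \<in> PiE (set (t # l)) (\<lambda>_. R)" using J(1) i by (simp add: PiE_fun_upd)
      moreover have "set ?ws \<subseteq> YV" using J(2) i y(3)[of t] Cons.prems by (auto simp: YV_def)
      ultimately show "\<exists>J' ws'. sng (Xv t i) + (sng (Yv i (s t)) + (mI (set l) J + cnt ws)) = mI (set (t # l)) J' + cnt ws'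
          \<and> J' \<in> PiE (set (t # l)) (\<lambda>_. R) \<and> set ws' \<subseteq> YV \<and> length ws' = length (t # l)"
        using J(3) by (intro exI[of _ ?J] exI[of _ ?ws]) simp
    qed
    have IH: "zl l \<in> Sp (?A l)" using Cons by simp
    have "zl (t # l) = (\<Sum>i\<in>R. var (Xv t i) * (var (Yv i (s t)) * zl l))"
      by (simp add: zl_def Z_def sum_distrib_right mult.assoc)
    also have "\<dots> \<in> Sp (?A (t # l))"
      by (intro Sp_sum Sp_mono[OF var_times_Sp[OF var_times_Sp[OF IH]] sub])
    finally show ?case .
  qed
  from this[OF dist] have "supp (zl ts) \<subseteq> ?A ts" by (simp add: Sp_def)
  hence "\<gamma> \<in> HH" if g: "\<gamma> \<in> supp (zl ts)" for \<gamma>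
  proof -
    have "\<gamma> \<in> ?A ts" using \<open>supp (zl ts) \<subseteq> ?A ts\<close> g by blast
    then obtain J ws where J: "\<gamma> = mI T J + cnt ws" "J \<in> MI" "set ws \<subseteq> YV" "length ws = length ts"
      unfolding MI_def by blast
    have "is_mono (cnt ws)" using supp_is_mono[OF g] unfolding J(1) by (rule mono_plusD(2))
    thus ?thesis using J unfolding HH_def MM_def NN_def by blast
  qed
  hence H: "zl ts \<in> Sp HH" unfolding Sp_def by blast
  \<comment> \<open>Killing the X-variables other than the \<open>Xv t (I t)\<close> leaves the
    coefficients at \<open>mI T I + \<kappa>\<close> unchanged and, being multiplicative, reduces
    each pairing to a single product.\<close>
  define K where "K = {Xv t (I t) | t. t \<in> T} \<union> {v. fst v}"
  have kZ: "keep K (Z R t u) = var (Xv t (I t)) * var (Yv (I t) u)" if "t \<in> T" for t u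
  proof -
    have "keep K (Z R t u) = (\<Sum>i\<in>R. if i = I t then var (Xv t (I t)) * var (Yv (I t) u) else 0)"
      unfolding Z_def svp.linear_sum[OF lin_keep]
      by (intro sum.cong refl) (use that in \<open>auto simp: keep_mult keep_var K_def\<close>)
    thus ?thesis using y(2)[OF that] fin(1) by simp
  qed
  have kz: "keep K (zl l) = wprod (concat (map (\<lambda>t. [Xv t (I t), Yv (I t) (s t)]) l))" if "set l \<subseteq> T" for l
    using that by (induction l) (simp_all add: zl_def keep_1 keep_mult kZ mult.assoc)
  have c: "cnt (concat (map (\<lambda>t. [Xv t (I t), Yv (I t) (s t)]) l)) = mI (set l) I + cnt (map (\<lambda>t. Yv (I t) (s t)) l)"
    if "distinct l" for l
    using that
  proof (induction l)
    case Nil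
    have "mI {} I = 0" by (simp add: mI_def zero_fun_def case_prod_unfold)
    thus ?case by simp
  next
    case (Cons t l)
    have "mI (set (t # l)) I = sng (Xv t (I t)) + mI (set l) I"
      using mI_split[of t "set (t # l)" I] Cons.prems by simp
    thus ?case using Cons by (simp add: add_ac)
  qed
  obtain \<zeta> where z: "pm1 \<zeta>" "keep K (zl ts) = scl \<zeta> (mon (mI T I + \<beta>))"
    using wprod_eq_mon[of "concat (map (\<lambda>t. [Xv t (I t), Yv (I t) (s t)]) ts)"]
    unfolding kz[OF subset_refl, symmetric] c[OF dist] yms ys(1) by blast
  have IMM: "mI T I \<in> MM" using IM unfolding MM_def by blast
  have "cf (zl ts) (mI T I + \<kappa>) = (if \<kappa> = \<beta> then \<zeta> else 0)" if k: "\<kappa> \<in> NN" for \<kappa>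
  proof -
    have "v \<in> K" if "(mI T I + \<kappa>) v \<noteq> 0" for v
    proof (cases "fst v")
      case False
      then obtain q i where v: "v = Xv q i" by (cases v) auto
      hence "mI T I (Xv q i) \<noteq> 0" using that NN_X[OF k] by (simp add: plus_fun_apply)
      thus ?thesis by (auto simp: v K_def mI_apply split: if_splits)
    qed (simp add: K_def)
    hence "cf (zl ts) (mI T I + \<kappa>) = cf (keep K (zl ts)) (mI T I + \<kappa>)" by (auto simp: cf_keep)
    also have "\<dots> = (if \<kappa> = \<beta> then \<zeta> else 0)"
      unfolding z(2) by (auto simp: cf_mon mon_MM_NN(2)[OF IMM assms])
    finally show ?thesis .
  qed
  moreover have "is_inv (zl ts)" unfolding is_inv_def using H EVz by blast
  ultimately show ?thesis using G IMM z(1) by blast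
qed

theorem multilinear_invariant_in_Gen:
  assumes "is_inv f"
  shows "f \<in> Gen PP"
proof -
  let ?c = "of_nat (card (permutations_of_set T)) :: complex"
  obtain Q E where Q: "\<And>f. is_inv f \<Longrightarrow> Q f \<in> Gen PP \<and> Q f \<in> Sp HH" "\<And>f. is_inv f \<Longrightarrow> f \<in> Gen PP \<Longrightarrow> Q f = scl ?c f"
      "\<And>f \<alpha> \<beta>. is_inv f \<Longrightarrow> \<alpha> \<in> MM \<Longrightarrow> \<beta> \<in> NN \<Longrightarrow> cf (Q f) (\<alpha> + \<beta>) = (\<Sum>\<kappa>\<in>NN. E \<beta> \<kappa> * cf f (\<alpha> + \<kappa>))"
    using averaged_projection by (elim exE conjE) blast
  \<comment> \<open>Comparing both descriptions of \<open>Q\<close> on the test element of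
    \<open>\<beta>\<close> isolates the entries of column \<open>\<beta>\<close>; so
    \<open>E\<close> is a scalar matrix.\<close>
  have E: "E \<beta>' \<beta> = (if \<beta>' = \<beta> then ?c else 0)" if b: "\<beta> \<in> NN" "\<beta>' \<in> NN" for \<beta> \<beta>'
  proof -
    obtain z \<alpha> \<zeta> where z: "is_inv z" "z \<in> Gen PP" "\<alpha> \<in> MM" "pm1 \<zeta>"
        "\<forall>\<kappa>\<in>NN. cf z (\<alpha> + \<kappa>) = (if \<kappa> = \<beta> then \<zeta> else 0)"
      using test_element[OF b(1)] by blast
    have "(\<Sum>\<kappa>\<in>NN. E \<beta>' \<kappa> * cf z (\<alpha> + \<kappa>)) = (\<Sum>\<kappa>\<in>NN. if \<kappa> = \<beta> then E \<beta>' \<beta> * \<zeta> else 0)"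
      by (intro sum.cong refl) (auto simp: z(5))
    hence "E \<beta>' \<beta> * \<zeta> = ?c * cf z (\<alpha> + \<beta>')"
      using Q(3)[OF z(1,3) b(2)] Q(2)[OF z(1,2)] b(1) finite_NN by simp
    thus ?thesis using z(4,5) b by (auto split: if_splits)
  qed
  have c0: "?c \<noteq> 0" by (simp add: card_eq_0_iff)
  have "Q f = scl ?c f"
  proof (rule salg_eqI)
    fix \<gamma>
    show "cf (Q f) \<gamma> = cf (scl ?c f) \<gamma>"
    proof (cases "\<gamma> \<in> HH")
      case True
      then obtain \<alpha> \<beta> where g: "\<gamma> = \<alpha> + \<beta>" "\<alpha> \<in> MM" "\<beta> \<in> NN" unfolding HH_def by blast
      have "cf (Q f) \<gamma> = (\<Sum>\<kappa>\<in>NN. if \<kappa> = \<beta> then ?c * cf f \<gamma> else 0)"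
        unfolding g(1) Q(3)[OF assms g(2,3)] by (intro sum.cong refl) (auto simp: E g(3))
      thus ?thesis using g(3) finite_NN by simp
    next
      case False
      hence "cf (Q f) \<gamma> = 0" "cf f \<gamma> = 0"
        using Q(1)[OF assms] assms unfolding is_inv_def Sp_iff by blast+
      thus ?thesis by simp
    qed
  qed
  hence "f = scl (1 / ?c) (Q f)" using c0 by simp
  thus ?thesis using Gen.scl[OF conjunct1[OF Q(1)[OF assms]], of "1 / ?c"] by simp
qed

end

section \<open>Polarisation\<close>

lemma rdeg_plus_sng: "is_mono \<beta> \<Longrightarrow> rdeg q (\<beta> + sng (Xv r k)) = rdeg q \<beta> + (if r = q then 1 else 0)"
  unfolding rdeg_def by (simp add: wt_plus_sng)

text \<open>Rows of X-variables are left free to make room for the auxiliary ones.\<close>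

definition okv :: "idx set \<Rightarrow> idx set \<Rightarrow> var \<Rightarrow> bool" where
  "okv R S = (\<lambda>(b, q, k). if b then q \<in> R \<and> k \<in> S else k \<in> R)"

definition okm :: "idx set \<Rightarrow> idx set \<Rightarrow> mono set" where
  "okm R S = {\<alpha>. \<forall>v. \<alpha> v \<noteq> 0 \<longrightarrow> okv R S v}"

definition glinv :: "idx set \<Rightarrow> idx set \<Rightarrow> salg \<Rightarrow> bool" where
  "glinv R S f \<longleftrightarrow> f \<in> Sp (okm R S) \<and> (\<forall>i\<in>R. \<forall>j\<in>R. EV i j f = 0)"

lemma EV_diag:
  assumes "is_mono \<alpha>"
  shows "EV i i (mon \<alpha>) = scl (wt (EV_coef i i) \<alpha>) (mon \<alpha>)"
proof -
  have s: "superderiv False (EV i i)" using superderiv_EV[of i i] by simp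
  have "EV i i (mon \<alpha>) = Der False (EV_coef i i) id (mon \<alpha>)"
  proof (rule superderiv_eqI[OF s superderiv_Der[OF par_shift_id]])
    fix v :: var
    obtain b q k where v: "v = (b, q, k)" by (cases v)
    show "EV i i (var v) = Der False (EV_coef i i) id (var v)"
      unfolding Der_var[OF par_shift_id]
      by (cases b) (auto simp: v EV_var_X EV_var_Y EV_coef_def)
  qed
  thus ?thesis by (simp only: Der_diag[OF assms])
qed

lemma diag_zeroD:
  assumes "lin D" "D f = 0" "\<And>\<alpha>. is_mono \<alpha> \<Longrightarrow> D (mon \<alpha>) = scl (c \<alpha>) (mon \<alpha>)" "\<alpha> \<in> supp f"
  shows "c \<alpha> = 0"
proof -
  have "cf (D f) \<alpha> = (\<Sum>\<beta>\<in>supp f. if \<beta> = \<alpha> then cf f \<alpha> * c \<alpha> else 0)"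
    unfolding lin_expand[OF assms(1), of f] cf_sum
    by (intro sum.cong refl) (auto simp: assms(3) supp_is_mono cf_mon)
  thus ?thesis using assms(2,4) by (simp add: supp_iff)
qed

text \<open>Monomials are eigenvectors of every \<open>EV i i\<close>, so those in the support of an
  invariant have eigenvalue 0. Summed over \<open>i\<close>, the eigenvalue is the number of
  X-variables minus the number of Y-variables.\<close>

lemma glinv_balanced:
  assumes "finite R" "glinv R S f" "cnt vs \<in> supp f"
  shows "length (filter (\<lambda>v. \<not> fst v) vs) = length (filter fst vs)"
proof -
  have m: "is_mono (cnt vs)" by (rule supp_is_mono[OF assms(3)])
  have w: "sum_list (map (EV_coef i i) vs) = 0" if "i \<in> R" for i
  proof -
    have "wt (EV_coef i i) (cnt vs) = 0"
      by (rule diag_zeroD[OF EV_simps(1) _ EV_diag assms(3)]) (use assms(2) that in \<open>simp add: glinv_def\<close>)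
    thus ?thesis by (simp add: wt_cnt[OF m])
  qed
  have "cnt vs \<in> okm R S" using assms(2,3) unfolding glinv_def Sp_def by blast
  hence ok: "okv R S v" if "v \<in> set vs" for v
    using that cnt_eq_0_iff[of vs v] unfolding okm_def by blast
  have "(\<Sum>i\<in>R. sum_list (map (EV_coef i i) vs)) =
    of_nat (length (filter (\<lambda>v. \<not> fst v) vs)) - of_nat (length (filter fst vs))"
    using ok
  proof (induction vs)
    case (Cons v vs)
    obtain b q k where v: "v = (b, q, k)" by (cases v)
    have "(\<Sum>i\<in>R. EV_coef i i v) = (\<Sum>i\<in>R. if i = (if b then q else k) then (if b then -1 else 1) else 0)"
      by (intro sum.cong refl) (auto simp: v EV_coef_def)
    also have "\<dots> = (if b then -1 else 1)"
      using Cons.prems[of v] assms(1) by (auto simp: v okv_def)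
    finally show ?case using Cons by (simp add: sum.distrib v)
  qed simp
  thus ?thesis using w by simp
qed

lemma row_split:
  assumes "is_mono \<alpha>" "finite T" "\<And>q. rdeg q \<alpha> = (if q \<in> T then 1 else 0)" "\<And>q k. \<alpha> (Yv q k) = 0"
  shows "\<exists>I. \<alpha> = mI T I"
proof -
  have "\<exists>k. \<forall>i. \<alpha> (Xv t i) = (if i = k then 1 else 0)" if "t \<in> T" for t
  proof -
    have "rdeg t \<alpha> = 1" using assms(3) that by simp
    then obtain k \<beta> where b: "\<alpha> = sng (Xv t k) + \<beta>" "is_mono \<beta>" "rdeg t \<beta> = 0"
      using rdeg_1E[OF assms(1)] by blast
    have "\<alpha> (Xv t i) = (if i = k then 1 else 0)" for i
      using rdeg_0D[OF b(2,3), of i] unfolding b(1) by (simp add: plus_fun_apply sng_def)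
    thus ?thesis by blast
  qed
  then obtain I where I: "\<And>t i. t \<in> T \<Longrightarrow> \<alpha> (Xv t i) = (if i = I t then 1 else 0)" by metis
  have "\<alpha> v = mI T I v" for v
  proof -
    obtain b q k where v: "v = (b, q, k)" by (cases v)
    show ?thesis
    proof (cases b)
      case True
      thus ?thesis using assms(4) by (simp add: v mI_apply)
    next
      case False
      thus ?thesis using I[of q k] rdeg_0D[OF assms(1), of q k] assms(3)[of q]
        by (cases "q \<in> T") (simp_all add: v mI_apply)
    qed
  qed
  thus ?thesis by blast
qed

lemma mdeg_mI: "finite T \<Longrightarrow> mdeg (mI T I) = card T"
proof -
  assume "finite T"
  have s: "{v. mI T I v \<noteq> 0} = (\<lambda>t. Xv t (I t)) ` T"
    by (auto simp: mI_apply split: if_splits)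
  have "mdeg (mI T I) = (\<Sum>t\<in>T. mI T I (Xv t (I t)))"
    unfolding mdeg_def s by (subst sum.reindex) (auto simp: inj_on_def)
  also have "\<dots> = (\<Sum>t\<in>T. 1)" by (intro sum.cong refl) (simp add: mI_apply)
  finally show ?thesis by simp
qed

lemma mdeg_cnt: "is_mono (cnt vs) \<Longrightarrow> mdeg (cnt vs) = length vs"
  unfolding mdeg_eq_wt wt_cnt by (simp add: sum_list_triv)

text \<open>Balance forces as many Y-variables as there are rows, so the support lies in
  \<open>HH\<close>.\<close>

lemma multilinear_case:
  assumes R: "finite R" "finite S" and T: "finite T" "\<forall>t\<in>T. \<not> fst t" and f: "glinv R S f"
    and hom: "\<And>\<alpha> q. \<alpha> \<in> supp f \<Longrightarrow> rdeg q \<alpha> = (if q \<in> T then 1 else 0)"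
  shows "f \<in> Gen (pairings R S)"
proof -
  obtain ts where ts: "set ts = T" "distinct ts" using finite_distinct_list[OF T(1)] by blast
  interpret multilinear ts R S
    by unfold_locales (use R T ts in auto)
  have "\<gamma> \<in> HH" if g: "\<gamma> \<in> supp f" for \<gamma>
  proof -
    have m: "is_mono \<gamma>" by (rule supp_is_mono[OF g])
    obtain vs where vs: "cnt vs = \<gamma>" using mon_eq_wprod[OF m] by blast
    let ?xs = "filter (\<lambda>v. \<not> fst v) vs" and ?ys = "filter fst vs"
    have sp: "\<gamma> = cnt ?xs + cnt ?ys"
      unfolding vs[symmetric] by (induction vs) (simp_all add: add_ac)
    have mx: "is_mono (cnt ?xs)" and my: "is_mono (cnt ?ys)"
      using m unfolding sp by (rule mono_plusD)+
    have len: "length ?xs = length ?ys"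
      by (rule glinv_balanced[OF R(1) f]) (simp add: vs g)
    have "\<gamma> \<in> okm R S" using f g unfolding glinv_def Sp_def by blast
    hence ok: "okv R S v" if "v \<in> set vs" for v
      using that cnt_eq_0_iff[of vs v] unfolding okm_def vs by blast
    have Y: "cnt ?xs (Yv q k) = 0" for q k by (simp add: cnt_eq_0_iff)
    have "rdeg q (cnt ?ys) = 0" for q
      unfolding rdeg_def wt_cnt[OF my] by (induction vs) (auto simp: case_prod_unfold)
    hence rx: "rdeg q (cnt ?xs) = (if q \<in> T then 1 else 0)" for q
      using hom[OF g, of q] unfolding sp by (simp add: rdeg_plus[OF mx my])
    obtain I where I: "cnt ?xs = mI T I" using row_split[OF mx T(1) rx Y] by blast
    define J where "J = restrict I T"
    have J: "mI T J = mI T I" by (rule mI_cong) (simp add: J_def)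
    have "I t \<in> R" if "t \<in> T" for t
    proof -
      have "cnt ?xs (Xv t (I t)) \<noteq> 0" unfolding I using that by (simp add: mI_apply)
      hence "Xv t (I t) \<in> set vs" unfolding cnt_eq_0_iff by simp
      thus ?thesis using ok[of "Xv t (I t)"] by (simp add: okv_def)
    qed
    hence "J \<in> MI" unfolding MI_def ts(1) J_def by auto
    hence "cnt ?xs \<in> MM" unfolding MM_def I ts(1) J[symmetric] by blast
    moreover have "cnt ?ys \<in> NN"
    proof -
      have "set ?ys \<subseteq> YV"
      proof
        fix v assume v: "v \<in> set ?ys"
        obtain b q k where "v = (b, q, k)" by (cases v)
        thus "v \<in> YV" using v ok[of v] unfolding YV_def by (auto simp: okv_def)
      qed
      moreover have "length ?ys = length ts"
        using mdeg_cnt[OF mx] mdeg_mI[OF T(1), of I] len distinct_card[OF ts(2)]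
        unfolding I ts(1) by simp
      ultimately show ?thesis using my unfolding NN_def by blast
    qed
    ultimately show ?thesis unfolding HH_def using sp by blast
  qed
  hence "is_inv f" using f unfolding is_inv_def glinv_def Sp_def by blast
  thus ?thesis by (rule multilinear_invariant_in_Gen)
qed

section \<open>Polarisation and restitution operators\<close>

lemma EU_mon_E:
  assumes "is_mono \<alpha>" "\<gamma> \<in> supp (EU r' r (mon \<alpha>))"
  obtains k where "\<alpha> (Xv r k) \<noteq> 0" "\<gamma> + sng (Xv r k) = \<alpha> + sng (Xv r' k)"
proof -
  obtain v where v: "\<alpha> v \<noteq> 0" "(case v of (b, q, k) \<Rightarrow> if \<not> b \<and> q = r then 1 else (0::complex)) \<noteq> 0"
      "\<gamma> + sng v = \<alpha> + sng (case v of (b, q, k) \<Rightarrow> Xv r' k)"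
    using Der_mon_Sp[OF EU_shift assms(1), of r' r] assms(2) unfolding EU_def Sp_def by blast
  obtain k where k: "v = Xv r k" using v(2) by (cases v) (auto split: if_splits)
  show ?thesis by (rule that[of k]) (use v k in auto)
qed

lemma EU_E:
  assumes "\<gamma> \<in> supp (EU r' r f)"
  obtains \<alpha> k where "\<alpha> \<in> supp f" "\<alpha> (Xv r k) \<noteq> 0" "\<gamma> + sng (Xv r k) = \<alpha> + sng (Xv r' k)"
proof -
  have "(\<Sum>\<alpha>\<in>supp f. cf (scl (cf f \<alpha>) (EU r' r (mon \<alpha>))) \<gamma>) \<noteq> 0"
    using assms unfolding supp_iff lin_expand[OF EU_simps(1), of _ _ f] cf_sum .
  then obtain \<alpha> where a: "\<alpha> \<in> supp f" "cf (scl (cf f \<alpha>) (EU r' r (mon \<alpha>))) \<gamma> \<noteq> 0"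
    by (rule sum.not_neutral_contains_not_neutral)
  hence "\<gamma> \<in> supp (EU r' r (mon \<alpha>))" by (simp add: supp_iff)
  from EU_mon_E[OF supp_is_mono[OF a(1)] this] show ?thesis using that[OF a(1)] by blast
qed

text \<open>\<open>EU r r'\<close> kills \<open>f\<close>, in which row \<open>r'\<close> does not
  occur, so the left side equals the supercommutator of the two operators applied to
  \<open>f\<close>. That is a diagonal derivation, and on \<open>f\<close> it measures the degree in
  row \<open>r\<close>.\<close>

lemma EU_restitution:
  assumes rr: "r \<noteq> r'" and r': "\<And>\<alpha>. \<alpha> \<in> supp f \<Longrightarrow> rdeg r' \<alpha> = 0" and r: "\<And>\<alpha>. \<alpha> \<in> supp f \<Longrightarrow> rdeg r \<alpha> = d"
  shows "EU r r' (EU r' r f) = scl (of_nat d) f"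
proof -
  let ?s = "sg ((fst r \<noteq> fst r') \<and> (fst r' \<noteq> fst r))"
  \<comment> \<open>The eigenvalues of the supercommutator on the variables: it is
    \<open>EU r r - EU r' r'\<close> when the two operators are even, and
    \<open>EU r r + EU r' r'\<close> when they are odd.\<close>
  define c where "c = (\<lambda>(b, q, k :: idx). if b then 0 else if q = r then 1 else if q = r' then - ?s else (0::complex))"
  have z: "EU r r' f = 0"
  proof -
    have "supp (EU r r' f) = {}"
    proof (rule ccontr)
      assume "supp (EU r r' f) \<noteq> {}"
      then obtain \<gamma> where "\<gamma> \<in> supp (EU r r' f)" by blast
      then obtain \<alpha> k where a: "\<alpha> \<in> supp f" "\<alpha> (Xv r' k) \<noteq> 0" by (rule EU_E)
      thus False using rdeg_0D[OF supp_is_mono[OF a(1)] r'[OF a(1)], of k] by simp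
    qed
    thus ?thesis by (intro salg_eqI) (simp add: supp_def)
  qed
  have D: "superderiv False (\<lambda>x. EU r r' (EU r' r x) - scl ?s (EU r' r (EU r r' x)))"
    using superderiv_commutator[OF superderiv_EU[of r r'] superderiv_EU[of r' r]] by (simp add: eq_commute)
  have "EU r r' (EU r' r f) - scl ?s (EU r' r (EU r r' f)) = Der False c id f"
  proof (rule superderiv_eqI[OF D superderiv_Der[OF par_shift_id]])
    fix v :: var
    obtain b q k where v: "v = (b, q, k)" by (cases v)
    show "EU r r' (EU r' r (var v)) - scl ?s (EU r' r (EU r r' (var v))) = Der False c id (var v)"
      unfolding Der_var[OF par_shift_id]
      by (cases b) (use rr in \<open>auto simp: v EU_var c_def EU_simps(5)\<close>)
  qed
  hence "EU r r' (EU r' r f) = Der False c id f" by (simp add: z EU_simps(5))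
  also have "\<dots> = (\<Sum>\<alpha>\<in>supp f. scl (cf f \<alpha>) (scl (wt c \<alpha>) (mon \<alpha>)))"
    unfolding lin_expand[OF lin_Der[OF par_shift_id], of _ f]
    by (intro sum.cong refl) (simp only: Der_diag[OF supp_is_mono])
  also have "\<dots> = (\<Sum>\<alpha>\<in>supp f. scl (of_nat d) (scl (cf f \<alpha>) (mon \<alpha>)))"
  proof (rule sum.cong[OF refl])
    fix \<alpha> assume a: "\<alpha> \<in> supp f"
    have "wt c \<alpha> = of_nat (rdeg r \<alpha>)"
      unfolding rdeg_def wt_def of_nat_sum
    proof (rule sum.cong[OF refl])
      fix v assume v: "v \<in> {v. \<alpha> v \<noteq> 0}"
      obtain b q k where vv: "v = (b, q, k)" by (cases v)
      have "q \<noteq> r'" if "\<not> b"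
        using v rdeg_0D[OF supp_is_mono[OF a] r'[OF a], of k] that by (auto simp: vv)
      thus "of_nat (\<alpha> v) * c v = of_nat (of_nat (\<alpha> v) * (case v of (b, q, k) \<Rightarrow> if \<not> b \<and> q = r then 1 else 0))"
        by (auto simp: vv c_def)
    qed
    thus "scl (cf f \<alpha>) (scl (wt c \<alpha>) (mon \<alpha>)) = scl (of_nat d) (scl (cf f \<alpha>) (mon \<alpha>))"
      by (simp add: r[OF a] mult.commute)
  qed
  also have "\<dots> = scl (of_nat d) f"
    unfolding sv.scale_sum_right[symmetric] using salg_expand[of "supp f" f] by simp
  finally show ?thesis .
qed

lemma EU_Gen:
  assumes "x \<in> Gen (pairings R S)"
  shows "EU r' r x \<in> Gen (pairings R S)"
proof (rule Gen_superderiv[OF superderiv_EU _ _ assms])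
  fix a assume "a \<in> pairings R S"
  then obtain q s where a: "a = Z R q s" "s \<in> S" unfolding pairings_def by blast
  have "Z R q' s \<in> Gen (pairings R S)" for q'
    using a(2) unfolding pairings_def by (intro Gen.base) blast
  thus "EU r' r a \<in> Gen (pairings R S)" "gam (fst r' \<noteq> fst r) a \<in> Gen (pairings R S)"
    unfolding a(1) EU_Z gam_Z by (simp_all add: Gen_0 Gen.scl)
qed

lemma EU_glinv:
  assumes "glinv R S f"
  shows "glinv R S (EU r' r f)"
  unfolding glinv_def
proof (intro conjI ballI)
  fix i j assume "i \<in> R" "j \<in> R"
  thus "EV i j (EU r' r f) = 0" using assms by (simp add: EV_EU_commute glinv_def EU_simps(5))
next
  have "\<gamma> \<in> okm R S" if g: "\<gamma> \<in> supp (EU r' r f)" for \<gamma>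
  proof -
    obtain \<alpha> k where a: "\<alpha> \<in> supp f" "\<alpha> (Xv r k) \<noteq> 0" "\<gamma> + sng (Xv r k) = \<alpha> + sng (Xv r' k)"
      using EU_E[OF g] by blast
    have o: "\<alpha> v \<noteq> 0 \<Longrightarrow> okv R S v" for v using assms a(1) unfolding glinv_def Sp_def okm_def by blast
    show ?thesis unfolding okm_def
    proof (intro CollectI allI impI)
      fix v assume "\<gamma> v \<noteq> 0"
      hence "\<alpha> v \<noteq> 0 \<or> v = Xv r' k"
        using fun_cong[OF a(3), of v] by (auto simp: plus_fun_apply sng_def split: if_splits)
      thus "okv R S v" using o[of v] o[OF a(2)] by (auto simp: okv_def)
    qed
  qed
  thus "EU r' r f \<in> Sp (okm R S)" unfolding Sp_def by blast
qed

text \<open>\<open>D\<close> holds the rows still to be polarised, \<open>T\<close> the even rows in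
  which \<open>f\<close> is already linear, and \<open>c\<close> is the degree left in
  \<open>D\<close>. Each step moves one unit of degree from \<open>D\<close> to a fresh row of
  \<open>T\<close>; restitution with the nonzero factor \<open>\<delta> r\<close> returns to
  \<open>f\<close>.\<close>

lemma homogeneous_case:
  assumes R: "finite R" "finite S" and D: "finite D"
  shows "finite T \<Longrightarrow> \<forall>t\<in>T. \<not> fst t \<and> \<delta> t = 1 \<Longrightarrow> D \<inter> T = {} \<Longrightarrow> \<forall>q. q \<notin> D \<union> T \<longrightarrow> \<delta> q = 0 \<Longrightarrow> sum \<delta> D = c
    \<Longrightarrow> glinv R S f \<Longrightarrow> \<forall>\<alpha>\<in>supp f. \<forall>q. rdeg q \<alpha> = \<delta> q \<Longrightarrow> f \<in> Gen (pairings R S)"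
proof (induction c arbitrary: T \<delta> f)
  case 0
  have "\<delta> q = (if q \<in> T then 1 else 0)" for q
    using 0 D by (cases "q \<in> D") auto
  thus ?case using 0 by (intro multilinear_case[OF R, of T f]) auto
next
  case (Suc c)
  obtain r where r: "r \<in> D" "\<delta> r \<noteq> 0"
    using Suc.prems(5) by (metis nat.distinct(1) sum.neutral)
  have "infinite (range (Pair False :: nat \<Rightarrow> idx))"
    by (simp add: finite_image_iff inj_on_def)
  then obtain r' where r': "r' \<in> range (Pair False :: nat \<Rightarrow> idx)" "r' \<notin> D \<union> T"
    using D Suc.prems(1) by (meson finite_UnI finite_subset subsetI)
  have rr: "r \<noteq> r'" using r r' by blast
  let ?f = "EU r' r f"
  define \<delta>' where "\<delta>' = \<delta>(r := \<delta> r - 1, r' := 1)"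
  have h: "rdeg q \<gamma> = \<delta>' q" if g: "\<gamma> \<in> supp ?f" for \<gamma> q
  proof -
    obtain \<alpha> k where a: "\<alpha> \<in> supp f" "\<alpha> (Xv r k) \<noteq> 0" "\<gamma> + sng (Xv r k) = \<alpha> + sng (Xv r' k)"
      using EU_E[OF g] by blast
    have m: "is_mono \<alpha>" "is_mono \<gamma>" using a(1) g by (simp_all add: supp_is_mono)
    have "rdeg q \<gamma> + (if q = r then 1 else 0) = rdeg q \<alpha> + (if q = r' then 1 else 0)"
      using arg_cong[OF a(3), of "rdeg q"] by (simp add: rdeg_plus_sng[OF m(1)] rdeg_plus_sng[OF m(2)] eq_commute)
    moreover have "rdeg q \<alpha> = \<delta> q" "\<delta> r' = 0" using Suc.prems(4,7) a(1) r' by auto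
    ultimately show ?thesis using rr r(2) by (auto simp: \<delta>'_def split: if_splits)
  qed
  have "?f \<in> Gen (pairings R S)"
  proof (rule Suc.IH[of "insert r' T" \<delta>'])
    show "finite (insert r' T)" using Suc.prems(1) by simp
    show "\<forall>t\<in>insert r' T. \<not> fst t \<and> \<delta>' t = 1"
      using Suc.prems(2,3) r r' rr unfolding \<delta>'_def by auto
    show "D \<inter> insert r' T = {}" using Suc.prems(3) r' by auto
    show "\<forall>q. q \<notin> D \<union> insert r' T \<longrightarrow> \<delta>' q = 0" using Suc.prems(4) r unfolding \<delta>'_def by auto
    have "sum \<delta> D = \<delta> r + sum \<delta> (D - {r})" using D r(1) by (rule sum.remove)
    moreover have "sum \<delta>' D = \<delta>' r + sum \<delta>' (D - {r})" using D r(1) by (rule sum.remove)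
    moreover have "sum \<delta>' (D - {r}) = sum \<delta> (D - {r})"
      by (rule sum.cong) (use r' in \<open>auto simp: \<delta>'_def\<close>)
    moreover have "\<delta>' r = \<delta> r - 1" using rr by (simp add: \<delta>'_def)
    ultimately show "sum \<delta>' D = c" using Suc.prems(5) r(2) by simp
    show "glinv R S ?f" by (rule EU_glinv[OF Suc.prems(6)])
    show "\<forall>\<alpha>\<in>supp ?f. \<forall>q. rdeg q \<alpha> = \<delta>' q" using h by blast
  qed
  hence "EU r r' ?f \<in> Gen (pairings R S)" by (rule EU_Gen)
  moreover have "EU r r' ?f = scl (of_nat (\<delta> r)) f"
    by (rule EU_restitution[OF rr]) (use Suc.prems(4,7) r' in auto)
  ultimately have "scl (1 / of_nat (\<delta> r)) (scl (of_nat (\<delta> r)) f) \<in> Gen (pairings R S)"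
    by (metis Gen.scl)
  thus ?case using r(2) by simp
qed

section \<open>Components homogeneous in every row\<close>

definition part :: "mono set \<Rightarrow> salg \<Rightarrow> salg" where
  "part B f = (\<Sum>\<alpha>\<in>supp f \<inter> B. scl (cf f \<alpha>) (mon \<alpha>))"

lemma cf_part: "cf (part B f) \<alpha> = (if \<alpha> \<in> B then cf f \<alpha> else 0)"
proof -
  have "cf (part B f) \<alpha> = (\<Sum>\<beta>\<in>supp f \<inter> B. if \<beta> = \<alpha> then cf f \<alpha> else 0)"
    unfolding part_def cf_sum by (intro sum.cong refl) (auto simp: cf_mon supp_is_mono)
  thus ?thesis by (simp add: supp_iff)
qed

lemma EV_row_degrees:
  assumes "is_mono \<alpha>"
  shows "EV i j (mon \<alpha>) \<in> Sp {\<gamma>. \<forall>q. rdeg q \<gamma> = rdeg q \<alpha>}"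
proof -
  have "rdeg q \<gamma> = rdeg q \<alpha>" if g: "\<gamma> \<in> supp (EV i j (mon \<alpha>))" for \<gamma> q
  proof -
    obtain v where v: "\<gamma> + sng v = \<alpha> + sng (EV_var i j v)"
      using Der_mon_Sp[OF EV_shift assms, of i j] g unfolding EV_def Sp_def by blast
    show ?thesis unfolding rdeg_def
      by (rule wt_move[OF assms supp_is_mono[OF g] v]) (cases v, auto simp: EV_var_def)
  qed
  thus ?thesis unfolding Sp_def by blast
qed

text \<open>The operators of gl(V) preserve the degree in each row, so the images of a component and
  of the remainder have disjoint supports. As the images add up to 0, both vanish, and the
  components of an invariant are invariant.\<close>

theorem glinv_in_Gen:
  assumes R: "finite R" "finite S" and f: "glinv R S f"
  shows "f \<in> Gen (pairings R S)"
proof -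
  define B where "B \<alpha> = {\<gamma>. \<forall>q. rdeg q \<gamma> = rdeg q \<alpha>}" for \<alpha>
  have pG: "part (B \<alpha>) f \<in> Gen (pairings R S)" if a: "\<alpha> \<in> supp f" for \<alpha>
  proof -
    have g: "glinv R S (part (B \<alpha>) f)"
      unfolding glinv_def
    proof (intro conjI ballI)
      show "part (B \<alpha>) f \<in> Sp (okm R S)" using f unfolding glinv_def Sp_iff cf_part by simp
      fix i j assume ij: "i \<in> R" "j \<in> R"
      let ?x = "EV i j (part (B \<alpha>) f)" and ?y = "EV i j (part (- B \<alpha>) f)"
      have "f = part (B \<alpha>) f + part (- B \<alpha>) f" by (rule salg_eqI) (simp add: cf_part)
      hence "?x + ?y = EV i j f" by (metis EV_simps(6))
      hence s: "?x + ?y = 0" using f ij by (simp add: glinv_def)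
      have "?x \<in> Sp (B \<alpha>)"
        by (rule lin_Sp[OF EV_simps(1), of _ "B \<alpha>"])
          (simp add: Sp_iff cf_part, rule Sp_mono[OF EV_row_degrees], auto simp: B_def)
      moreover have "?y \<in> Sp (- B \<alpha>)"
        by (rule lin_Sp[OF EV_simps(1), of _ "- B \<alpha>"])
          (simp add: Sp_iff cf_part, rule Sp_mono[OF EV_row_degrees], auto simp: B_def)
      ultimately show "?x = 0"
        using s unfolding Sp_iff by (intro salg_eqI) (metis ComplD add.right_neutral cf_simps(1) cf_simps(4))
    qed
    let ?D = "{q. rdeg q \<alpha> \<noteq> 0}"
    have "q \<in> (\<lambda>v. fst (snd v)) ` {v. \<alpha> v \<noteq> 0}" if q: "rdeg q \<alpha> \<noteq> 0" for q
    proof -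
      obtain v where "\<alpha> v \<noteq> 0" "(case v of (b, q', k) \<Rightarrow> if \<not> b \<and> q' = q then 1 else (0::nat)) \<noteq> 0"
        using wt_pos_ex[OF q[unfolded rdeg_def]] by blast
      thus ?thesis by (cases v) (force split: if_splits)
    qed
    hence "?D \<subseteq> (\<lambda>v. fst (snd v)) ` {v. \<alpha> v \<noteq> 0}" by blast
    hence D: "finite ?D"
      using supp_is_mono[OF a] unfolding is_mono_def by (meson finite_imageI finite_subset)
    show ?thesis
      by (rule homogeneous_case[OF R D, of "{}" "\<lambda>q. rdeg q \<alpha>", OF _ _ _ _ refl g])
        (auto simp: supp_iff cf_part B_def split: if_splits)
  qed
  \<comment> \<open>Indexing by the classes \<open>B \<alpha>\<close> instead of the monomials
    counts every component once.\<close>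
  have "f = (\<Sum>C\<in>B ` supp f. part C f)"
  proof (rule salg_eqI)
    fix \<gamma>
    show "cf f \<gamma> = cf (\<Sum>C\<in>B ` supp f. part C f) \<gamma>"
    proof (cases "\<gamma> \<in> supp f")
      case True
      have "\<gamma> \<in> B \<alpha> \<longleftrightarrow> B \<alpha> = B \<gamma>" for \<alpha> unfolding B_def by auto
      hence "(\<Sum>C\<in>B ` supp f. cf (part C f) \<gamma>) = (\<Sum>C\<in>B ` supp f. if C = B \<gamma> then cf f \<gamma> else 0)"
        by (intro sum.cong refl) (auto simp: cf_part)
      thus ?thesis using True by simp
    next
      case False
      thus ?thesis by (simp add: cf_part supp_iff cong: if_cong)
    qed
  qed
  also have "\<dots> \<in> Gen (pairings R S)"
    by (rule sv.subspace_sum[OF Gen_subspace]) (use pG in blast)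
  finally show ?thesis .
qed

section \<open>The first fundamental theorem\<close>

lemma finite_Ridx: "finite (Ridx a b)"
proof -
  have "Ridx a b = Pair False ` {1..a} \<union> Pair True ` {1..b}" by (auto simp: Ridx_def)
  thus ?thesis by simp
qed

lemma cf_Z: "cf (Z (Ridx n m) r s) = pairing n m r s"
  by (rule ext) (simp add: Z_def pairing_def cf_times cf_var)

lemma Gen_cf: "x \<in> Gen A \<Longrightarrow> cf x \<in> gen_alg (cf ` A)"
  by (induction rule: Gen.induct)
    (simp_all only: cf_1 cf_plus cf_scl cf_times gen_alg.one gen_alg.add gen_alg.scale gen_alg.mult
      gen_alg.base imageI)

lemma gen_alg_cf: "h \<in> gen_alg (cf ` A) \<Longrightarrow> \<exists>x\<in>Gen A. cf x = h"
proof (induction rule: gen_alg.induct)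
  case one
  show ?case using Gen.one cf_1 by blast
next
  case (base s)
  thus ?case using Gen.base by blast
next
  case (add a b)
  thus ?case using Gen.add cf_plus by blast
next
  case (scale a c)
  thus ?case using Gen.scl cf_scl by blast
next
  case (mult a b)
  thus ?case using Gen.mult cf_times by blast
qed

theorem theorem2p1:
  fixes k l p q n m :: nat
  shows "{f \<in> Alg k l p q n m. gl_invariant n m f} =
         gen_alg {pairing n m r s | r s. r \<in> Ridx k l \<and> s \<in> Ridx p q}"
proof -
  let ?R = "Ridx n m" and ?S = "Ridx p q" and ?U = "Ridx k l"
  let ?A = "{Z ?R r s | r s. r \<in> ?U \<and> s \<in> ?S}"
  define K where "K = {v. valid_var k l p q n m v}"
  have A: "{pairing n m r s | r s. r \<in> ?U \<and> s \<in> ?S} = cf ` ?A"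
    unfolding cf_Z[symmetric] by blast
  have kZ: "keep K (Z ?R r s) = (if r \<in> ?U then Z ?R r s else 0)" if "s \<in> ?S" for r s
  proof -
    have "keep K (Z ?R r s) = (\<Sum>i\<in>?R. if r \<in> ?U then var (Xv r i) * var (Yv i s) else 0)"
      unfolding Z_def svp.linear_sum[OF lin_keep]
      by (intro sum.cong refl) (use that in \<open>auto simp: keep_mult keep_var K_def valid_var_def\<close>)
    thus ?thesis by (simp add: Z_def)
  qed
  \<comment> \<open>Membership becomes being fixed by a homomorphism, so closure under the algebra
    operations is immediate.\<close>
  have Alg_iff: "cf x \<in> Alg k l p q n m \<longleftrightarrow> keep K x = x" for x
  proof -
    have "cf x \<in> Alg k l p q n m \<longleftrightarrow> (\<forall>\<alpha>. cf x \<alpha> \<noteq> 0 \<longrightarrow> {v. \<alpha> v \<noteq> 0} \<subseteq> K)"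
      using finite_supp[of x] supp_is_mono[of _ x] unfolding Alg_def supp_def K_def by blast
    also have "\<dots> \<longleftrightarrow> (\<forall>\<alpha>. cf (keep K x) \<alpha> = cf x \<alpha>)" by (auto simp: cf_keep)
    also have "\<dots> \<longleftrightarrow> keep K x = x" by (metis cf_inject ext)
    finally show ?thesis .
  qed
  have inv_iff: "gl_invariant n m (cf x) \<longleftrightarrow> (\<forall>i\<in>?R. \<forall>j\<in>?R. EV i j x = 0)" for x
    unfolding gl_invariant_def Eact_cf cf_0[symmetric] cf_inject ..
  show ?thesis
  proof (intro equalityI subsetI)
    fix f assume "f \<in> {f \<in> Alg k l p q n m. gl_invariant n m f}"
    hence f: "f \<in> Alg k l p q n m" "gl_invariant n m f" by auto
    have "cf (Salg f) = f" by (rule cf_Salg) (use f(1) in \<open>auto simp: Alg_def\<close>)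
    then obtain x where x: "f = cf x" by metis
    have "x \<in> Sp (okm ?R ?S)"
      unfolding Sp_iff
    proof (intro allI impI)
      fix \<alpha> assume "cf x \<alpha> \<noteq> 0"
      hence v: "\<forall>v. \<alpha> v \<noteq> 0 \<longrightarrow> valid_var k l p q n m v" using f(1) unfolding x Alg_def by blast
      have "valid_var k l p q n m v \<Longrightarrow> okv ?R ?S v" for v
        by (cases v) (auto simp: valid_var_def okv_def split: if_splits)
      thus "\<alpha> \<in> okm ?R ?S" using v unfolding okm_def by blast
    qed
    hence "glinv ?R ?S x" using f(2) unfolding x inv_iff glinv_def by blast
    hence xG: "x \<in> Gen (pairings ?R ?S)" by (rule glinv_in_Gen[OF finite_Ridx finite_Ridx])
    \<comment> \<open>The pairings obtained so far may involve any row. The homomorphism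
      \<open>keep K\<close> fixes \<open>x\<close> and the pairings of rows in \<open>?U\<close>,
      and kills those of all other rows.\<close>
    have "keep K x \<in> Gen ?A"
    proof (rule Gen_hom[OF lin_keep keep_1 keep_mult _ xG])
      fix a assume "a \<in> pairings ?R ?S"
      then obtain r s where a: "a = Z ?R r s" "s \<in> ?S" unfolding pairings_def by blast
      show "keep K a \<in> Gen ?A"
      proof (cases "r \<in> ?U")
        case True
        thus ?thesis using a(2) unfolding a(1) kZ[OF a(2)] by (intro Gen.base) auto
      qed (simp add: a(1) kZ[OF a(2)] Gen_0)
    qed
    moreover have "keep K x = x" using f(1) unfolding x Alg_iff .
    ultimately show "f \<in> gen_alg {pairing n m r s | r s. r \<in> ?U \<and> s \<in> ?S}"
      unfolding A x using Gen_cf[of x ?A] by simp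
  next
    fix f assume "f \<in> gen_alg {pairing n m r s | r s. r \<in> ?U \<and> s \<in> ?S}"
    then obtain x where x: "x \<in> Gen ?A" "f = cf x" unfolding A using gen_alg_cf by blast
    from x(1) have "keep K x = x \<and> (\<forall>i\<in>?R. \<forall>j\<in>?R. EV i j x = 0)"
    proof (induction rule: Gen.induct)
      case (base a)
      thus ?case using EV_Z[OF finite_Ridx] kZ by auto
    qed (simp_all add: keep_1 keep_mult svp.linear_add[OF lin_keep] svp.linear_scale[OF lin_keep] EV_simps)
    thus "f \<in> {f \<in> Alg k l p q n m. gl_invariant n m f}" unfolding x(2) by (simp add: Alg_iff inv_iff)
  qed
qed

end
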